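(* Let $V_{I,k}$ ($0\le k\le n$), $V_{IV,k}$ ($1\le k\le n$), $V_{II}$, $V_{III}$, $V_V$ be the following variance functions of natural exponential families on $\mathbb{R}^n$: - $V_{I,0}(m)=I_n$ on $\mathbb{R}^n$, and for $1\le k\le n$, $V_{I,k}(m)=\mathrm{diag}(m_1,\dots,m_k,1,\dots,1)$ on $(0,\infty)^k\times\mathbb{R}^{n-k}$; - for $1\le k\le n$, $V_{IV,k}(m)=mm^T+\mathrm{diag}(0,m_2,\dots,m_k,m_1,\dots,m_1)$ on $(0,\infty)^k\times\mathbb{R}^{n-k}$ (with $n-k$ entries $m_1$ at the end); - $V_{II}(m)=-mm^T+\mathrm{diag}(m_1,\dots,m_n)$ on the interior of the convex hull of $\{0,e_1,\dots,e_n\}$, where $(e_i)$ is the canonical basis of $\mathbb{R}^n$; - $V_{III}(m)=mm^T+\mathrm{diag}(m_1,\dots,m_n)$ on $(0,\infty)^n$; - $V_V(m)=mm^T+\mathrm{diag}\big(m_1,\dots,m_{n-1},1+\sum_{k=1}^{n-1}m_k\big)$ on $(0,\infty)^{n-1}\times\mathbb{R}$. Then: 1. For every $k=1,\dots,n$, $V_{I,k}$ and $V_{IV,k}$ are in the same $G$-orbit. 2. $V_{II}$ and $V_{III}$ are in the same $G$-orbit. 3. The $n+3$ $G$-orbits of $V_{I,0},V_{I,1},\dots,V_{I,n},V_{II}$ and $V_V$ are pairwise disjoint.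
   Context: For a positive measure $\mu$ on $\mathbb{R}^n$ let $L_\mu(\theta)=\int e^{\langle\theta,x\rangle}\mu(dx)$, $\Theta(\mu)$ the interior of $\{L_\mu<\infty\}$, $k_\mu=\log L_\mu$. When $\Theta(\mu)\neq\emptyset$ and $\mu$ is not concentrated on an affine hyperplane, the natural exponential family (NEF) generated by $\mu$ is $F(\mu)=\{e^{\langle\theta,x\rangle-k_\mu(\theta)}\mu(dx):\theta\in\Theta(\mu)\}$; its domain of the means is the open set $M_F=k_\mu'(\Theta(\mu))$, and its variance function is $V_F(m)=k_\mu''(\psi_\mu(m))$ for $m\in M_F$, where $\psi_\mu$ is the inverse of the diffeomorphism $k'_\mu:\Theta(\mu)\to M_F$. The functions listed in the claim are known to be variance functions of NEFs with the indicated domains of the means. $G=GL(n+1,\mathbb{R})$, with elements written $g=\begin{bmatrix}A&b\\c^T&d\end{bmatrix}$ ($A$ an $n\times n$ matrix, $b,c\in\mathbb{R}^n$, $d\in\mathbb{R}$). Put $h_g(m)=\frac{Am+b}{c^Tm+d}$ for $c^Tm+d\neq0$, with (invertible) Jacobian matrix $h_g'(m)$. For an open set $U\subset\mathbb{R}^n$, $U_g=\{m: c^Tm+d>0,\ h_g(m)\in U\}$. If $V$ is a map from $U$ to the positive definite matrices, then for $m\in U_g$ $$T_g(V)(m)=\frac{1}{c^Tm+d}\,(h'_g(m))^{-1}\,V(h_g(m))\,(h'_g(m)^T)^{-1}.$$ The $G$-orbit of a variance function $V$ with domain of the means $M$ is the set of all variance functions $V_1$ of NEFs on $\mathbb{R}^n$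 (with domain of the means $M_1$) such that, for some $g\in G$, $T_g(V)(m)=V_1(m)$ for all $m$ in some non-empty open subset of $M_1\cap M_g$. *)

theory Defs
  imports "HOL-Analysis.Analysis"
begin

section \<open>Natural exponential families and their variance functions\<close>

definition laplace_tr :: "(real^'n) measure \<Rightarrow> real^'n \<Rightarrow> ennreal" where
  "laplace_tr \<mu> \<theta> = (\<integral>\<^sup>+ x. ennreal (exp (\<theta> \<bullet> x)) \<partial>\<mu>)"

definition Theta :: "(real^'n) measure \<Rightarrow> (real^'n) set" where
  "Theta \<mu> = interior {\<theta>. laplace_tr \<mu> \<theta> < \<infinity>}"

definition cumulant :: "(real^'n) measure \<Rightarrow> real^'n \<Rightarrow> real" where
  "cumulant \<mu> \<theta> = ln (enn2real (laplace_tr \<mu> \<theta>))"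

definition cumulant_grad :: "(real^'n) measure \<Rightarrow> real^'n \<Rightarrow> real^'n" where
  "cumulant_grad \<mu> \<theta> = (THE D. GDERIV (cumulant \<mu>) \<theta> :> D)"

definition cumulant_hess :: "(real^'n) measure \<Rightarrow> real^'n \<Rightarrow> real^'n^'n" where
  "cumulant_hess \<mu> \<theta> = jacobian (cumulant_grad \<mu>) (at \<theta>)"

definition nef_generator :: "(real^'n) measure \<Rightarrow> bool" where
  "nef_generator \<mu> \<longleftrightarrow> sets \<mu> = sets borel \<and> Theta \<mu> \<noteq> {} \<and>
     \<not> (\<exists>a b. a \<noteq> 0 \<and> (AE x in \<mu>. a \<bullet> x = b))"

definition nef :: "(real^'n) measure \<Rightarrow> (real^'n) measure set" where
  "nef \<mu> = (\<lambda>\<theta>. density \<mu> (\<lambda>x. ennreal (exp (\<theta> \<bullet> x - cumulant \<mu> \<theta>)))) ` Theta \<mu>"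

definition mean_domain :: "(real^'n) measure \<Rightarrow> (real^'n) set" where
  "mean_domain \<mu> = cumulant_grad \<mu> ` Theta \<mu>"

definition variance_fun :: "(real^'n) measure \<Rightarrow> real^'n \<Rightarrow> real^'n^'n" where
  "variance_fun \<mu> m = cumulant_hess \<mu> (inv_into (Theta \<mu>) (cumulant_grad \<mu>) m)"

text \<open>A matrix-valued function on an open set is a pair (M, V); the values of V outside M are
  irrelevant.\<close>

type_synonym 'n varfun = "(real, 'n) vec set \<times> ((real, 'n) vec \<Rightarrow> ((real, 'n) vec, 'n) vec)"

definition is_variance_function_of :: "'n::finite varfun \<Rightarrow> (real^'n) measure set \<Rightarrow> bool" where
  "is_variance_function_of W F \<longleftrightarrow>
     (\<exists>\<mu>. nef_generator \<mu> \<and> F = nef \<mu> \<and> fst W = mean_domain \<mu> \<and>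
          (\<forall>m\<in>fst W. snd W m = variance_fun \<mu> m))"

definition nef_variance_function :: "'n::finite varfun \<Rightarrow> bool" where
  "nef_variance_function W \<longleftrightarrow> (\<exists>F. is_variance_function_of W F)"


section \<open>The action of GL(n+1)\<close>

text \<open>An (n+1)-square matrix is indexed by \<open>'n option\<close>; the index \<open>None\<close> is the last row or
  column of the block decomposition.\<close>

type_synonym 'n gmat = "((real, 'n option) vec, 'n option) vec"

definition blkA :: "'n::finite gmat \<Rightarrow> real^'n^'n" where
  "blkA g = (\<chi> i j. g $ Some i $ Some j)"

definition blkb :: "'n::finite gmat \<Rightarrow> real^'n" where
  "blkb g = (\<chi> i. g $ Some i $ None)"

definition blkc :: "'n::finite gmat \<Rightarrow> real^'n" where
  "blkc g = (\<chi> j. g $ None $ Some j)"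

definition blkd :: "'n::finite gmat \<Rightarrow> real" where
  "blkd g = g $ None $ None"

definition denom :: "'n::finite gmat \<Rightarrow> real^'n \<Rightarrow> real" where
  "denom g m = blkc g \<bullet> m + blkd g"

definition moebius :: "'n::finite gmat \<Rightarrow> real^'n \<Rightarrow> real^'n" where
  "moebius g m = (1 / denom g m) *\<^sub>R (blkA g *v m + blkb g)"

definition pull_dom :: "'n::finite gmat \<Rightarrow> (real^'n) set \<Rightarrow> (real^'n) set" where
  "pull_dom g U = {m. denom g m > 0 \<and> moebius g m \<in> U}"

definition pull_fun ::
  "'n::finite gmat \<Rightarrow> (real^'n \<Rightarrow> real^'n^'n) \<Rightarrow> real^'n \<Rightarrow> real^'n^'n" where
  "pull_fun g V m = (let J = jacobian (moebius g) (at m) in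
     (1 / denom g m) *\<^sub>R (matrix_inv J ** V (moebius g m) ** matrix_inv (transpose J)))"

definition G_orbit :: "'n::finite varfun \<Rightarrow> 'n varfun set" where
  "G_orbit W = {W1. nef_variance_function W1 \<and>
     (\<exists>g :: 'n gmat. invertible g \<and>
       (\<exists>S. open S \<and> S \<noteq> {} \<and> S \<subseteq> fst W1 \<inter> pull_dom g (fst W) \<and>
          (\<forall>m\<in>S. pull_fun g (snd W) m = snd W1 m)))}"


section \<open>The particular variance functions\<close>

text \<open>The coordinates 1, ..., n are the elements of a finite linearly ordered index type, numbered
  increasingly.\<close>

definition pos :: "'n::{finite,linorder} \<Rightarrow> nat" where
  "pos i = card {j. j \<le> i}"

definition first :: "'n::{finite,linorder}" where
  "first = Min UNIV"

definition last_ix :: "'n::{finite,linorder}" where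
  "last_ix = Max UNIV"

definition diag :: "('n \<Rightarrow> real) \<Rightarrow> real^'n^'n" where
  "diag v = (\<chi> i j. if i = j then v i else 0)"

definition outer :: "real^'n \<Rightarrow> real^'n^'n" where
  "outer m = (\<chi> i j. m $ i * m $ j)"

definition V_I :: "nat \<Rightarrow> 'n::{finite,linorder} varfun" where
  "V_I k = ({m. \<forall>i. pos i \<le> k \<longrightarrow> 0 < m $ i},
            \<lambda>m. diag (\<lambda>i. if pos i \<le> k then m $ i else 1))"

definition V_IV :: "nat \<Rightarrow> 'n::{finite,linorder} varfun" where
  "V_IV k = ({m. \<forall>i. pos i \<le> k \<longrightarrow> 0 < m $ i},
             \<lambda>m. outer m + diag (\<lambda>i. if i = first then 0
                                      else if pos i \<le> k then m $ i else m $ first))"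

definition V_II :: "'n::finite varfun" where
  "V_II = (interior (convex hull (insert 0 (range (\<lambda>i. axis i 1)))),
           \<lambda>m. - outer m + diag (\<lambda>i. m $ i))"

definition V_III :: "'n::finite varfun" where
  "V_III = ({m. \<forall>i. 0 < m $ i}, \<lambda>m. outer m + diag (\<lambda>i. m $ i))"

definition V_V :: "'n::{finite,linorder} varfun" where
  "V_V = ({m. \<forall>i. i \<noteq> last_ix \<longrightarrow> 0 < m $ i},
          \<lambda>m. outer m + diag (\<lambda>i. if i = last_ix then 1 + (\<Sum>j\<in>UNIV - {last_ix}. m $ j)
                                   else m $ i))"

end

theory Submission
  imports Defs "HOL-Complex_Analysis.Conformal_Mappings" "HOL-Probability.Distributions"
begin

text \<open>For each listed \<open>V\<close> the determinant \<open>det (V m)\<close> is the value at \<open>(m, 1)\<close> of a polynomial \<open>P\<close>,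
  homogeneous of degree \<open>n + 2\<close>, and \<open>det (T\<^sub>g V m) = P (g (m, 1)) / (det g)\<^sup>2\<close>. By analyticity of the
  Laplace transform this formula, known on some open subset of the domain of the means, holds on all
  of it; so a variance function common to two orbits makes the two polynomials proportional up to a
  linear substitution. Restriction to lines excludes this: \<open>P\<close> is a product of powers of \<open>k + 1\<close>
  distinct linear forms for \<open>V_I k\<close>, of \<open>n + 2\<close> distinct ones for \<open>V_II\<close>, and for \<open>V_V\<close> it is
  nonconstant without real zeros on a suitable line. That \<open>V_I\<close>, \<open>V_III\<close>, \<open>V_IV\<close> are variance functions
  is seen from mixtures of products of Dirac, Poisson and normal laws whose parameter is fixed or
  exponentially distributed, and for \<open>V_II\<close> from the measure with unit masses at \<open>0\<close> and the \<open>e\<^sub>i\<close>.\<close>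

section \<open>Block matrices and the projective action\<close>

text \<open>The degree n + 2 comes from the shape of the action. The scalar 1/(c^T m + d)
  contributes the power -n to the determinant, and the two inverse Jacobians, each of determinant
  (c^T m + d)^(n+1) / det g, contribute 2n + 2. A form of exactly this degree absorbs the remaining
  power, so the nonlinear action on V becomes a linear substitution in P. The obstacle is that a
  member of two orbits is tied to each of them only on some open set, and the two sets may be
  disjoint. Each determinant formula has to be carried over the whole domain of the means before the
  two can be compared. The comparison avoids factorization theory: zeros on a line bound the number
  of linear factors from below, and k + 1 \<le> n + 1 < n + 2 separates types I and II.\<close>

lemma sum_option: "(\<Sum>i\<in>UNIV. f i) = f None + (\<Sum>i\<in>UNIV. f (Some i))"
  for f :: "'a::finite option \<Rightarrow> 'b::comm_monoid_add"
  by (simp add: UNIV_option_conv sum.reindex)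

lemma prod_option: "(\<Prod>i\<in>UNIV. f i) = f None * (\<Prod>i\<in>UNIV. f (Some i))"
  for f :: "'a::finite option \<Rightarrow> 'b::comm_monoid_mult"
  by (simp add: UNIV_option_conv prod.reindex)

text \<open>Indexes the Leibniz terms that survive in a block triangular determinant: dropping the
  fixed point \<open>None\<close> gives a permutation of the smaller index set, and
  \<open>map_permutation\<close> preserves its sign.\<close>

lemma permutes_fixing_None:
  "{p. p permutes UNIV \<and> p None = None}
     = map_permutation UNIV Some ` {q. q permutes (UNIV :: 'a::finite set)}"
proof (intro equalityI subsetI)
  fix p :: "'a option \<Rightarrow> 'a option"
  assume p: "p \<in> {p. p permutes UNIV \<and> p None = None}"
  then have pi: "inj p" using permutes_inj by blast
  define q where "q = (\<lambda>i. the (p (Some i)))"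
  have q: "p (Some i) = Some (q i)" for i
  proof -
    have "p (Some i) \<noteq> p None" using pi by (simp add: inj_eq)
    then show ?thesis using p by (auto simp: q_def)
  qed
  have "inj q"
    using pi q by (metis injI inj_eq option.inject)
  then have "q permutes UNIV"
    by (intro bij_imp_permutes) (simp_all add: bij_betw_def finite_UNIV_inj_surj)
  moreover have "p = map_permutation UNIV Some q"
  proof
    fix x show "p x = map_permutation UNIV Some q x"
    proof (cases x)
      case None
      then show ?thesis using p by (simp add: map_permutation_def restrict_id_def)
    next
      case (Some i)
      then show ?thesis using q by (simp add: map_permutation_apply)
    qed
  qed
  ultimately show "p \<in> map_permutation UNIV Some ` {q. q permutes (UNIV :: 'a set)}" by blast
next
  fix p assume "p \<in> map_permutation UNIV Some ` {q. q permutes (UNIV :: 'a set)}"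
  then obtain q where q: "q permutes (UNIV::'a set)" "p = map_permutation UNIV Some q" by blast
  have "bij_betw Some UNIV (range Some)" by (simp add: bij_betw_def)
  then have "p permutes range Some"
    using q map_permutation_permutes by blast
  then show "p \<in> {p. p permutes UNIV \<and> p None = None}"
    by (auto intro: permutes_subset simp: permutes_not_in)
qed

text \<open>A permutation that moves \<open>None\<close> sends some \<open>Some i\<close> to
  \<open>None\<close>, so its Leibniz term contains the vanishing entry
  \<open>M $ Some i $ None\<close>. The remaining permutations are those of the small block.\<close>

lemma det_block_lower:
  fixes M :: "'n::finite gmat"
  assumes z: "\<And>i. M $ Some i $ None = 0"
  shows "det M = M $ None $ None * det (blkA M)"
proof -
  let ?P = "{p. p permutes (UNIV :: 'n option set)}"
  let ?Q = "{p. p permutes (UNIV :: 'n option set) \<and> p None = None}"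
  let ?t = "\<lambda>p. of_int (sign p) * (\<Prod>i\<in>UNIV. M $ i $ p i)"
  have fin: "finite ?P" by (simp add: finite_permutations)
  have 0: "?t p = 0" if "p \<in> ?P - ?Q" for p
  proof -
    from that have "surj p" "p None \<noteq> None" by (auto simp: permutes_surj)
    then obtain j where "p j = None" by (metis surj_def)
    with \<open>p None \<noteq> None\<close> obtain i where "p (Some i) = None" by (cases j) auto
    then have "M $ Some i $ p (Some i) = 0" using z by simp
    then have "(\<Prod>i\<in>UNIV. M $ i $ p i) = 0" by (intro prod_zero) auto
    then show ?thesis by simp
  qed
  have inj: "inj_on (map_permutation UNIV Some) {q. q permutes (UNIV :: 'n set)}"
  proof (rule inj_onI)
    fix p q assume pq: "map_permutation UNIV Some p = map_permutation UNIV Some (q :: 'n \<Rightarrow> 'n)"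
    show "p = q"
    proof
      fix x
      have "Some (p x) = Some (q x)"
        using fun_cong[OF pq, of "Some x"] by (simp add: map_permutation_apply)
      then show "p x = q x" by simp
    qed
  qed
  have "det M = sum ?t ?P" by (simp add: det_def)
  also have "\<dots> = sum ?t ?Q"
    by (rule sum.mono_neutral_right[OF fin]) (use 0 in auto)
  also have "\<dots> = (\<Sum>q | q permutes (UNIV :: 'n set). ?t (map_permutation UNIV Some q))"
    by (simp only: permutes_fixing_None sum.reindex[OF inj] o_def)
  also have "\<dots> = (\<Sum>q | q permutes (UNIV :: 'n set).
      M $ None $ None * (of_int (sign q) * (\<Prod>i\<in>UNIV. blkA M $ i $ q i)))"
  proof (rule sum.cong[OF refl])
    fix q assume "q \<in> {q. q permutes (UNIV :: 'n set)}"
    then have q: "q permutes (UNIV :: 'n set)" by simp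
    have N: "map_permutation UNIV Some q None = None"
      by (simp add: map_permutation_def restrict_id_def)
    have s: "sign (map_permutation UNIV Some q) = sign q"
      using q by (intro sign_map_permutation) auto
    show "?t (map_permutation UNIV Some q) =
      M $ None $ None * (of_int (sign q) * (\<Prod>i\<in>UNIV. blkA M $ i $ q i))"
      by (simp add: s N prod_option map_permutation_apply blkA_def)
  qed
  also have "\<dots> = M $ None $ None * det (blkA M)"
    by (simp add: det_def sum_distrib_left)
  finally show ?thesis .
qed

lemma det_block_upper:
  fixes M :: "'n::finite gmat"
  assumes z: "\<And>i. M $ None $ Some i = 0"
  shows "det M = M $ None $ None * det (blkA M)"
proof -
  have "det (Finite_Cartesian_Product.transpose M) = M $ None $ None * det (Finite_Cartesian_Product.transpose (blkA M))"
    using det_block_lower[of "Finite_Cartesian_Product.transpose M"] z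
    by (simp add: transpose_def blkA_def)
  then show ?thesis by simp
qed

definition block :: "real^'n^'n \<Rightarrow> real^'n \<Rightarrow> real^'n \<Rightarrow> real \<Rightarrow> 'n::finite gmat" where
  "block A b c d = (\<chi> i j. case i of
      None \<Rightarrow> (case j of None \<Rightarrow> d | Some j' \<Rightarrow> c $ j')
    | Some i' \<Rightarrow> (case j of None \<Rightarrow> b $ i' | Some j' \<Rightarrow> A $ i' $ j'))"

lemma block_nth [simp]:
  "block A b c d $ None $ None = d" "block A b c d $ None $ Some j = c $ j"
  "block A b c d $ Some i $ None = b $ i" "block A b c d $ Some i $ Some j = A $ i $ j"
  by (simp_all add: block_def)

lemma blk_block [simp]: "blkA (block A b c d) = A" "blkb (block A b c d) = b"
  "blkc (block A b c d) = c" "blkd (block A b c d) = d"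
  by (simp_all add: blkA_def blkb_def blkc_def blkd_def vec_eq_iff)

lemma block_eq_iff:
  "block A b c d = block A' b' c' d' \<longleftrightarrow> A = A' \<and> b = b' \<and> c = c' \<and> d = d'"
  by (metis blk_block)

lemma det_block_0:
  "det (block A b 0 d) = d * det A" "det (block A 0 c d) = d * det A"
  by (simp_all add: det_block_lower det_block_upper)

lemma gmat_eqI:
  assumes "M $ None $ None = N $ None $ None" "\<And>j. M $ None $ Some j = N $ None $ Some j"
    "\<And>i. M $ Some i $ None = N $ Some i $ None" "\<And>i j. M $ Some i $ Some j = N $ Some i $ Some j"
  shows "M = (N :: 'n::finite gmat)"
proof -
  have "M $ i $ j = N $ i $ j" for i j
    using assms by (cases i; cases j) auto
  then show ?thesis by (simp add: vec_eq_iff)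
qed

lemma block_mult:
  "block A b c d ** block A' b' c' d' =
   block (A ** A' + (\<chi> i j. b $ i * c' $ j)) (A *v b' + d' *\<^sub>R b)
         (transpose A' *v c + d *\<^sub>R c') (c \<bullet> b' + d * d')"
  by (rule gmat_eqI)
    (simp_all add: matrix_matrix_mult_def sum_option matrix_vector_mult_def
      transpose_def inner_vec_def mult.commute)

lemma block_blk: "block (blkA g) (blkb g) (blkc g) (blkd g) = g"
  by (rule gmat_eqI) (simp_all add: blkA_def blkb_def blkc_def blkd_def)

text \<open>Both sides are the determinant of the matrix with blocks \<open>diag d\<close>, \<open>- s m\<close>, \<open>m\<close>, \<open>1\<close>,
  brought to block triangular form by column and by row operations.\<close>

lemma det_diag_plus_outer:
  fixes m :: "real^'n::finite"
  assumes "\<And>i. v i \<noteq> 0"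
  shows "det (s *\<^sub>R outer m + diag v) = (\<Prod>i\<in>UNIV. v i) * (1 + s * (\<Sum>i\<in>UNIV. (m $ i)\<^sup>2 / v i))"
proof -
  let ?M = "block (diag v) (- s *\<^sub>R m) m 1"
  have dd: "det (diag v :: real^'n^'n) = (\<Prod>i\<in>UNIV. v i)"
    by (subst det_diagonal) (simp_all add: diag_def)
  have *: "block (diag v) (- s *\<^sub>R m) m 1 ** block (mat 1) 0 (- m) 1
      = block (s *\<^sub>R outer m + diag v) (- s *\<^sub>R m) 0 1"
    by (simp add: block_mult block_eq_iff) (simp add: vec_eq_iff outer_def)
  have "det (?M ** block (mat 1) 0 (- m) 1) = det (s *\<^sub>R outer m + diag v)"
    unfolding * by (simp add: det_block_0)
  then have 1: "det ?M = det (s *\<^sub>R outer m + diag v)"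
    by (simp add: det_mul det_block_0)
  have "transpose (diag v) *v (\<chi> i. - m $ i / v i) = - m"
    using assms
    by (simp add: vec_eq_iff diag_def transpose_def matrix_vector_mult_def if_distrib[of "\<lambda>x. x * _"]
        sum.delta' cong: if_cong) (simp add: if_distrib[of "\<lambda>x. - (x / _)"] cong: if_cong)
  then have *: "block (mat 1) 0 (\<chi> i. - m $ i / v i) 1 ** ?M
     = block (diag v) (- s *\<^sub>R m) 0 (1 + s * (\<Sum>i\<in>UNIV. (m $ i)\<^sup>2 / v i))"
    by (simp add: block_mult block_eq_iff) (simp add: vec_eq_iff inner_vec_def sum_distrib_left sum_negf power2_eq_square algebra_simps)
  have "det (block (mat 1) 0 (\<chi> i. - m $ i / v i) 1 ** ?M) = (\<Prod>i\<in>UNIV. v i) * (1 + s * (\<Sum>i\<in>UNIV. (m $ i)\<^sup>2 / v i))"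
    unfolding * by (simp add: det_block_0 dd)
  then have "det ?M = (\<Prod>i\<in>UNIV. v i) * (1 + s * (\<Sum>i\<in>UNIV. (m $ i)\<^sup>2 / v i))"
    by (simp add: det_mul det_block_0)
  with 1 show ?thesis by simp
qed

section \<open>Homogeneous coordinates and the Jacobian of the projective map\<close>

definition hvec :: "real^'n \<Rightarrow> real^'n option" where
  "hvec m = (\<chi> i. case i of None \<Rightarrow> 1 | Some j \<Rightarrow> m $ j)"

lemma hvec_nth [simp]: "hvec m $ None = 1" "hvec m $ Some i = m $ i"
  by (simp_all add: hvec_def)

lemma mult_hvec_nth:
  "(g *v hvec m) $ None = denom g m" "(g *v hvec m) $ Some i = (blkA g *v m + blkb g) $ i"
  by (simp_all add: matrix_vector_mult_def sum_option denom_def blkA_def blkb_def blkc_def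
      blkd_def inner_vec_def)

text \<open>In homogeneous coordinates the projective map is the matrix itself; the scale factor
  \<open>denom g m\<close> is what the homogeneity of the determinant forms later absorbs.\<close>

lemma mult_hvec:
  assumes "denom g m \<noteq> 0"
  shows "g *v hvec m = denom g m *\<^sub>R hvec (moebius g m)"
proof -
  have "(g *v hvec m) $ i = (denom g m *\<^sub>R hvec (moebius g m)) $ i" for i
    using assms by (cases i) (simp_all add: mult_hvec_nth moebius_def del: vector_add_component)
  then show ?thesis by (simp add: vec_eq_iff)
qed

lemma jacobian_eqI: "(f has_derivative (\<lambda>h. J *v h)) (at x) \<Longrightarrow> jacobian f (at x) = J"
  for J :: "real^'n^'m"
  using frechet_derivative_at[of f "(*v) J" x, symmetric] by (simp add: jacobian_def)

text \<open>The quotient rule in closed form. Up to the factor \<open>denom g m\<close> it is the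
  Schur complement of the corner entry of g after translation by m, which is how its determinant is
  found.\<close>

definition moebius_jac :: "'n::finite gmat \<Rightarrow> real^'n \<Rightarrow> real^'n^'n" where
  "moebius_jac g m = (\<chi> i j. (blkA g $ i $ j - moebius g m $ i * blkc g $ j) / denom g m)"

lemma jacobian_moebius:
  assumes "denom g m \<noteq> 0"
  shows "jacobian (moebius g) (at m) = moebius_jac g m"
proof (rule jacobian_eqI)
  have d: "(denom g has_derivative (\<lambda>h. blkc g \<bullet> h)) (at m)"
    unfolding denom_def by (auto intro!: derivative_eq_intros)
  have a: "((\<lambda>m. blkA g *v m + blkb g) has_derivative (\<lambda>h. blkA g *v h + 0)) (at m)"
    by (intro has_derivative_add has_derivative_const bounded_linear_imp_has_derivative
        matrix_vector_mul_bounded_linear)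
  have D: "(moebius g has_derivative
     (\<lambda>h. (1 / denom g m) *\<^sub>R (blkA g *v h + 0) +
       (- 1 * (inverse (denom g m) * (blkc g \<bullet> h) * inverse (denom g m)) + 0 / denom g m) *\<^sub>R (blkA g *v m + blkb g))) (at m)"
    unfolding moebius_def[abs_def]
    by (rule has_derivative_scaleR[OF has_derivative_divide[OF has_derivative_const d assms] a])
  have "(moebius_jac g m *v h) $ i = ((1 / denom g m) *\<^sub>R (blkA g *v h + 0) +
       (- 1 * (inverse (denom g m) * (blkc g \<bullet> h) * inverse (denom g m)) + 0 / denom g m) *\<^sub>R
         (blkA g *v m + blkb g)) $ i" for h i
  proof -
    have "(moebius_jac g m *v h) $ i
      = (\<Sum>j\<in>UNIV. (1 / denom g m) * (blkA g $ i $ j * h $ j) - (moebius g m $ i / denom g m) * (blkc g $ j * h $ j))"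
      by (simp add: moebius_jac_def matrix_vector_mult_def diff_divide_distrib algebra_simps)
    also have "\<dots> = (1 / denom g m) * (blkA g *v h) $ i - (moebius g m $ i / denom g m) * (blkc g \<bullet> h)"
      by (simp add: sum_subtractf sum_distrib_left matrix_vector_mult_def inner_vec_def)
    finally show ?thesis by (simp add: moebius_def divide_inverse)
  qed
  then have "(\<lambda>h. (1 / denom g m) *\<^sub>R (blkA g *v h + 0) +
       (- 1 * (inverse (denom g m) * (blkc g \<bullet> h) * inverse (denom g m)) + 0 / denom g m) *\<^sub>R
         (blkA g *v m + blkb g)) = (*v) (moebius_jac g m)"
    by (intro ext, subst vec_eq_iff) simp
  with D show "(moebius g has_derivative (*v) (moebius_jac g m)) (at m)"
    by (rule has_derivative_eq_rhs)
qed

lemma det_scaleR: "det (k *\<^sub>R A) = k ^ CARD('n) * det A" for A :: "real^'n::finite^'n"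
proof -
  have "k *\<^sub>R A = (k *\<^sub>R mat 1) ** A" by (simp add: scalar_matrix_assoc[symmetric])
  moreover have "det (k *\<^sub>R mat 1 :: real^'n^'n) = k ^ CARD('n)"
    by (subst det_diagonal) (auto simp: mat_def)
  ultimately show ?thesis by (simp add: det_mul)
qed

lemma matrix_inv_works:
  fixes A :: "real^'n::finite^'n"
  assumes "invertible A"
  shows "A ** matrix_inv A = mat 1" "matrix_inv A ** A = mat 1"
  using someI_ex[OF assms[unfolded invertible_def]] by (simp_all add: matrix_inv_def)

text \<open>Translation by m on the right and by \<open>- moebius g m\<close> on the left has
  determinant 1 and makes g block triangular. The first diagonal block gives n of the n + 1 factors
  \<open>denom g m\<close>, the corner entry the last one.\<close>

lemma det_moebius_jac:
  fixes g :: "'n::finite gmat"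
  assumes d: "denom g m \<noteq> 0"
  shows "det (moebius_jac g m) * denom g m ^ (CARD('n) + 1) = det g"
proof -
  have g: "det (block (mat 1) (- moebius g m) 0 1 ** g ** block (mat 1) m 0 1) = det g"
    by (simp add: det_mul det_block_0)
  have "block (mat 1) (- moebius g m) 0 1 ** (g ** block (mat 1) m 0 1)
    = block (denom g m *\<^sub>R moebius_jac g m) 0 (blkc g) (denom g m)"
  proof -
    have "g ** block (mat 1) m 0 1 = block (blkA g) (blkA g *v m + blkb g) (blkc g) (denom g m)"
      by (subst block_blk[of g, symmetric], subst block_mult)
        (simp add: block_eq_iff, simp add: denom_def vec_eq_iff)
    then show ?thesis
      using d by (simp add: block_mult block_eq_iff) (simp add: vec_eq_iff moebius_jac_def moebius_def)
  qed
  then have "det g = det (block (denom g m *\<^sub>R moebius_jac g m) 0 (blkc g) (denom g m))"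
    using g by (simp add: matrix_mul_assoc)
  then show ?thesis by (simp add: det_block_0 det_scaleR)
qed

lemma det_pull_fun:
  fixes g :: "'n::finite gmat"
  assumes g: "invertible g" and d: "denom g m \<noteq> 0"
  shows "det (pull_fun g V m) * (det g)\<^sup>2 = denom g m ^ (CARD('n) + 2) * det (V (moebius g m))"
proof -
  let ?J = "moebius_jac g m" and ?\<delta> = "denom g m" and ?n = "CARD('n)"
  have dg: "det g \<noteq> 0" using g by (simp add: invertible_det_nz)
  have J: "det ?J * ?\<delta> ^ (?n + 1) = det g" by (rule det_moebius_jac[OF d])
  with dg have J0: "det ?J \<noteq> 0" by auto
  then have inv: "invertible ?J" by (simp add: invertible_det_nz)
  then have "det (matrix_inv ?J ** ?J) = 1" by (simp add: matrix_inv_works)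
  then have "det (matrix_inv ?J) * det ?J = 1" by (simp add: det_mul)
  then have i1: "det (matrix_inv ?J) = 1 / det ?J" using J0 by (simp add: field_simps)
  have "invertible (transpose ?J)" using J0 by (simp add: invertible_det_nz)
  then have "det (matrix_inv (transpose ?J) ** transpose ?J) = 1" by (simp add: matrix_inv_works)
  then have "det (matrix_inv (transpose ?J)) * det ?J = 1" by (simp add: det_mul)
  then have i2: "det (matrix_inv (transpose ?J)) = 1 / det ?J" using J0 by (simp add: field_simps)
  have "det (pull_fun g V m) = (1 / ?\<delta>) ^ ?n * (1 / det ?J * det (V (moebius g m)) * (1 / det ?J))"
    by (simp add: pull_fun_def jacobian_moebius[OF d] Let_def det_scaleR det_mul i1 i2)
  moreover have "(det g)\<^sup>2 = det ?J * det ?J * (?\<delta> ^ ?n * ?\<delta> ^ (?n + 2))"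
    by (simp add: J[symmetric] power2_eq_square power_add)
  ultimately show ?thesis using J0 d by (simp add: power_one_over)
qed

text \<open>Solved for the value of V at the image point, as a congruence by the Jacobian, so that
  the explicit orbit calculations never have to invert \<open>moebius_jac\<close>.\<close>

lemma pull_fun_eqI:
  fixes g :: "'n::finite gmat"
  assumes g: "invertible g" and d: "denom g m \<noteq> 0"
    and eq: "V (moebius g m) = denom g m *\<^sub>R (moebius_jac g m ** V1 ** transpose (moebius_jac g m))"
  shows "pull_fun g V m = V1"
proof -
  let ?J = "moebius_jac g m"
  have "det ?J * denom g m ^ (CARD('n) + 1) = det g" by (rule det_moebius_jac[OF d])
  then have J0: "det ?J \<noteq> 0" using g by (auto simp: invertible_det_nz)
  then have 1: "matrix_inv ?J ** ?J = mat 1"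
    by (simp add: invertible_det_nz matrix_inv_works)
  have 2: "transpose ?J ** matrix_inv (transpose ?J) = mat 1"
    using J0 by (simp add: invertible_det_nz matrix_inv_works)
  have "matrix_inv ?J ** (?J ** V1 ** transpose ?J) ** matrix_inv (transpose ?J) = 
    (matrix_inv ?J ** ?J) ** V1 ** (transpose ?J ** matrix_inv (transpose ?J))"
    by (simp add: matrix_mul_assoc)
  also have "\<dots> = V1" by (simp add: 1 2)
  finally show ?thesis
    using d by (simp add: pull_fun_def jacobian_moebius[OF d] Let_def eq scalar_matrix_assoc[symmetric]
      matrix_scalar_ac)
qed


section \<open>Differentiation under the integral sign\<close>

lemma norm_exp_minus_linear:
  "norm (exp z - 1 - z) \<le> (norm z)\<^sup>2 * exp (norm z)" for z :: complex
proof -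
  have "norm (exp z - 1 - z) \<le> exp (norm z) * (norm z ^ Suc 1) / fact 1"
    using Taylor_exp_field[of z 1] by (simp add: atMost_Suc diff_diff_eq add.commute)
  then show ?thesis by (simp add: power2_eq_square mult.commute)
qed

lemma mult_exp_le: "t \<le> exp (d * t) / d" if "0 < d" for t d :: real
proof -
  have "1 + d * t \<le> exp (d * t)" by (rule exp_ge_add_one_self)
  then have "d * t \<le> exp (d * t)" by linarith
  then show ?thesis using that by (simp add: field_simps)
qed

lemma integrable_le:
  fixes f :: "'a \<Rightarrow> 'b::{banach, second_countable_topology}" and g :: "'a \<Rightarrow> real"
  assumes "integrable M g" "f \<in> borel_measurable M" "\<And>x. norm (f x) \<le> g x"
  shows "integrable M f"
  by (rule Bochner_Integration.integrable_bound[OF assms(1,2)])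
    (use assms(3) in \<open>auto intro!: AE_I2 order_trans[OF _ abs_ge_self]\<close>)

text \<open>The parameter space is left general so that one estimate yields both the Frechet
  derivative in \<theta>, with \<open>l h x\<close> the inner product of h and x, and the complex
  derivative along a line, with \<open>l h x\<close> equal to h times v \<bullet> x. The
  second-order Taylor remainder of exp, dominated by an exponential of \<open>norm x\<close>, leaves
  an error of order \<open>(norm h)\<^sup>2\<close>.\<close>

lemma has_derivative_integral_exp:
  fixes q :: "'a::euclidean_space \<Rightarrow> complex" and l :: "'b::real_normed_vector \<Rightarrow> 'a \<Rightarrow> complex"
  assumes sets [measurable_cong]: "sets \<mu> = sets borel"
    and q [measurable]: "q \<in> borel_measurable borel"
    and l [measurable]: "\<And>h. l h \<in> borel_measurable borel"
    and eps: "0 < \<epsilon>"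
    and int: "integrable \<mu> (\<lambda>x. norm (q x) * exp (\<epsilon> * norm x))"
    and lin: "\<And>x. linear (\<lambda>h. l h x)"
    and bound: "\<And>h x. norm (l h x) \<le> B * norm h * norm x" and B: "0 < B"
  shows "((\<lambda>h. \<integral>x. q x * exp (l h x) \<partial>\<mu>) has_derivative (\<lambda>h. \<integral>x. q x * l h x \<partial>\<mu>)) (at 0)"
proof -
  define G where "G x = norm (q x) * exp (\<epsilon> * norm x)" for x
  \<comment> \<open>A quarter of the available exponential rate: the remainder spends 2d on the
    square of \<open>norm x\<close> and another 2d on \<open>exp (norm (l h x))\<close>.\<close>
  define d where "d = \<epsilon> / 4"
  have d: "0 < d" using eps by (simp add: d_def)
  have G [simp]: "integrable \<mu> G" unfolding G_def using int .
  have n1: "norm x \<le> exp (\<epsilon> * norm x) / d" for x :: 'a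
  proof -
    have "norm x \<le> exp (d * norm x) / d" using mult_exp_le[OF d] .
    also have "\<dots> \<le> exp (\<epsilon> * norm x) / d"
      using d eps by (intro divide_right_mono) (auto simp: d_def intro!: mult_right_mono)
    finally show ?thesis .
  qed
  have n2: "(norm x)\<^sup>2 * exp (2 * d * norm x) \<le> exp (\<epsilon> * norm x) / d\<^sup>2" for x :: 'a
  proof -
    have "(norm x)\<^sup>2 \<le> (exp (d * norm x) / d)\<^sup>2" using mult_exp_le[OF d] by (intro power_mono) auto
    also have "\<dots> = exp (2 * d * norm x) / d\<^sup>2"
      by (simp add: power_divide exp_double[symmetric] mult.assoc)
    finally have "(norm x)\<^sup>2 * exp (2 * d * norm x) \<le> exp (2 * d * norm x) / d\<^sup>2 * exp (2 * d * norm x)"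
      by (intro mult_right_mono) auto
    also have "\<dots> = exp (\<epsilon> * norm x) / d\<^sup>2"
      by (simp add: exp_add[symmetric] d_def)
    finally show ?thesis .
  qed
  have iq: "integrable \<mu> q"
  proof (rule integrable_le[OF G])
    show "norm (q x) \<le> G x" for x
      unfolding G_def using eps mult_left_mono[of 1 "exp (\<epsilon> * norm x)" "norm (q x)"] by simp
  qed simp
  have il: "integrable \<mu> (\<lambda>x. q x * l h x)"
    and ilb: "norm (\<integral>x. q x * l h x \<partial>\<mu>) \<le> norm h * (\<integral>x. B / d * G x \<partial>\<mu>)" for h
  proof -
    have b: "norm (q x * l h x) \<le> norm h * (B / d * G x)" for x
    proof -
      have "norm (l h x) \<le> B * norm h * (exp (\<epsilon> * norm x) / d)"
        using bound[of h x] mult_left_mono[OF n1[of x], of "B * norm h"] B by simp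
      then have "norm (q x) * norm (l h x) \<le> norm (q x) * (B * norm h * (exp (\<epsilon> * norm x) / d))"
        by (rule mult_left_mono) simp
      then show ?thesis by (simp add: G_def norm_mult mult_ac)
    qed
    have i: "integrable \<mu> (\<lambda>x. norm h * (B / d * G x))" by simp
    show "integrable \<mu> (\<lambda>x. q x * l h x)"
      by (rule integrable_le[OF i _ b]) simp
    have "norm (\<integral>x. q x * l h x \<partial>\<mu>) \<le> (\<integral>x. norm h * (B / d * G x) \<partial>\<mu>)"
      using b by (intro Bochner_Integration.integral_norm_bound_integral i \<open>integrable \<mu> (\<lambda>x. q x * l h x)\<close>) auto
    then show "norm (\<integral>x. q x * l h x \<partial>\<mu>) \<le> norm h * (\<integral>x. B / d * G x \<partial>\<mu>)" by simp
  qed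
  \<comment> \<open>For \<open>norm h < r\<close> the bound on l becomes
    \<open>norm (l h x) \<le> 2 * d * norm x\<close>.\<close>
  define r where "r = 2 * d / B"
  have r: "0 < r" using d B by (simp add: r_def)
  define K where "K = (\<integral>x. B\<^sup>2 / d\<^sup>2 * G x \<partial>\<mu>)"
  have rem: "norm (\<integral>x. q x * exp (l h x) \<partial>\<mu> - (\<integral>x. q x * exp (l 0 x) \<partial>\<mu>) - (\<integral>x. q x * l h x \<partial>\<mu>))
      \<le> (norm h)\<^sup>2 * K" if h: "norm h < r" for h
  proof -
    have b: "norm (q x * (exp (l h x) - 1 - l h x)) \<le> (norm h)\<^sup>2 * (B\<^sup>2 / d\<^sup>2 * G x)" for x
    proof -
      have "B * norm h \<le> 2 * d" using h B by (simp add: r_def field_simps)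
      then have "norm (l h x) \<le> 2 * d * norm x"
        using bound[of h x] by (meson mult_right_mono norm_ge_zero order_trans)
      then have e: "exp (norm (l h x)) \<le> exp (2 * d * norm x)" by simp
      have "norm (exp (l h x) - 1 - l h x) \<le> (norm (l h x))\<^sup>2 * exp (norm (l h x))"
        by (rule norm_exp_minus_linear)
      also have "\<dots> \<le> (B * norm h * norm x)\<^sup>2 * exp (2 * d * norm x)"
        using e bound[of h x] by (intro mult_mono power_mono) auto
      also have "\<dots> = B\<^sup>2 * (norm h)\<^sup>2 * ((norm x)\<^sup>2 * exp (2 * d * norm x))"
        by (simp add: power_mult_distrib)
      also have "\<dots> \<le> B\<^sup>2 * (norm h)\<^sup>2 * (exp (\<epsilon> * norm x) / d\<^sup>2)"
        by (rule mult_left_mono[OF n2]) simp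
      finally have "norm (q x) * norm (exp (l h x) - 1 - l h x)
          \<le> norm (q x) * (B\<^sup>2 * (norm h)\<^sup>2 * (exp (\<epsilon> * norm x) / d\<^sup>2))"
        by (rule mult_left_mono) simp
      then show ?thesis by (simp add: G_def norm_mult mult_ac)
    qed
    have i: "integrable \<mu> (\<lambda>x. (norm h)\<^sup>2 * (B\<^sup>2 / d\<^sup>2 * G x))" by simp
    have j: "integrable \<mu> (\<lambda>x. q x * (exp (l h x) - 1 - l h x))"
      by (rule integrable_le[OF i _ b]) simp
    have l0: "l 0 x = 0" for x using linear_0[OF lin[of x]] .
    have k: "integrable \<mu> (\<lambda>x. q x * exp (l h x))"
    proof -
      have "integrable \<mu> (\<lambda>x. q x * (exp (l h x) - 1 - l h x) + q x + q x * l h x)"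
        using j iq il by simp
      moreover have "q x * (exp (l h x) - 1 - l h x) + q x + q x * l h x = q x * exp (l h x)" for x
        by (simp add: algebra_simps)
      ultimately show ?thesis by simp
    qed
    have "(\<integral>x. q x * (exp (l h x) - 1 - l h x) \<partial>\<mu>)
       = (\<integral>x. q x * exp (l h x) - q x - q x * l h x \<partial>\<mu>)"
      by (simp add: algebra_simps)
    also have "\<dots> = \<integral>x. q x * exp (l h x) \<partial>\<mu> - (\<integral>x. q x * exp (l 0 x) \<partial>\<mu>) - (\<integral>x. q x * l h x \<partial>\<mu>)"
      using k iq il by (simp add: l0)
    finally have "norm (\<integral>x. q x * exp (l h x) \<partial>\<mu> - (\<integral>x. q x * exp (l 0 x) \<partial>\<mu>) - (\<integral>x. q x * l h x \<partial>\<mu>))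
      = norm (\<integral>x. q x * (exp (l h x) - 1 - l h x) \<partial>\<mu>)" by simp
    also have "\<dots> \<le> (\<integral>x. (norm h)\<^sup>2 * (B\<^sup>2 / d\<^sup>2 * G x) \<partial>\<mu>)"
      using b by (intro Bochner_Integration.integral_norm_bound_integral i j) auto
    finally show ?thesis by (simp add: K_def)
  qed
  have bl: "bounded_linear (\<lambda>h. \<integral>x. q x * l h x \<partial>\<mu>)"
  proof (rule bounded_linear_intro)
    fix h k :: 'b and c :: real
    have "q x * l (h + k) x = q x * l h x + q x * l k x" for x
      using linear_add[OF lin[of x]] by (simp add: distrib_left)
    then show "(\<integral>x. q x * l (h + k) x \<partial>\<mu>) = (\<integral>x. q x * l h x \<partial>\<mu>) + (\<integral>x. q x * l k x \<partial>\<mu>)"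
      using il by simp
    have "q x * l (c *\<^sub>R h) x = c *\<^sub>R (q x * l h x)" for x
      using linear_scale[OF lin[of x], of c] by simp
    then show "(\<integral>x. q x * l (c *\<^sub>R h) x \<partial>\<mu>) = c *\<^sub>R (\<integral>x. q x * l h x \<partial>\<mu>)"
      by (simp only: integral_scaleR_right)
    show "norm (\<integral>x. q x * l h x \<partial>\<mu>) \<le> norm h * (\<integral>x. B / d * G x \<partial>\<mu>)" by (rule ilb)
  qed
  show ?thesis
  proof (rule has_derivativeI_sandwich[where H = "\<lambda>h. norm h * K", OF r bl])
    fix h :: 'b assume "h \<noteq> 0" "dist h 0 < r"
    then have "norm (\<integral>x. q x * exp (l h x) \<partial>\<mu> - (\<integral>x. q x * exp (l 0 x) \<partial>\<mu>) - (\<integral>x. q x * l (h - 0) x \<partial>\<mu>)) / norm h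
       \<le> (norm h)\<^sup>2 * K / norm h"
      using rem[of h] by (intro divide_right_mono) auto
    also have "\<dots> = norm h * K" using \<open>h \<noteq> 0\<close> by (simp add: power2_eq_square)
    finally show "norm (\<integral>x. q x * exp (l h x) \<partial>\<mu> - (\<integral>x. q x * exp (l 0 x) \<partial>\<mu>) - (\<integral>x. q x * l (h - 0) x \<partial>\<mu>)) / norm (h - 0)
       \<le> norm h * K" by simp
  next
    show "((\<lambda>h. norm h * K) \<longlongrightarrow> 0) (at 0)"
      by (auto intro!: tendsto_eq_intros)
  qed
qed


section \<open>Laplace transforms\<close>

lemma open_Theta [simp]: "open (Theta \<mu>)"
  by (simp add: Theta_def)

text \<open>Pointwise convexity of exp, integrated. It makes the complex strip above a line in
  \<open>Theta\<close> connected, as the identity theorem requires.\<close>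

lemma convex_Theta:
  assumes [measurable_cong]: "sets \<mu> = sets borel"
  shows "convex (Theta \<mu>)"
  unfolding Theta_def
proof (rule convex_interior, rule convexI, rule CollectI)
  fix x y :: "real^'a" and u v :: real
  assume xy: "x \<in> {\<theta>. laplace_tr \<mu> \<theta> < \<infinity>}" "y \<in> {\<theta>. laplace_tr \<mu> \<theta> < \<infinity>}"
    and uv: "0 \<le> u" "0 \<le> v" "u + v = 1"
  have "laplace_tr \<mu> (u *\<^sub>R x + v *\<^sub>R y)
     \<le> (\<integral>\<^sup>+ t. ennreal u * ennreal (exp (x \<bullet> t)) + ennreal v * ennreal (exp (y \<bullet> t)) \<partial>\<mu>)"
    unfolding laplace_tr_def
  proof (rule nn_integral_mono)
    fix t
    have "exp (u *\<^sub>R (x \<bullet> t) + v *\<^sub>R (y \<bullet> t)) \<le> u * exp (x \<bullet> t) + v * exp (y \<bullet> t)"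
      using exp_convex uv unfolding convex_on_def by blast
    then have "exp ((u *\<^sub>R x + v *\<^sub>R y) \<bullet> t) \<le> u * exp (x \<bullet> t) + v * exp (y \<bullet> t)"
      by (simp add: inner_add_left)
    then have "ennreal (exp ((u *\<^sub>R x + v *\<^sub>R y) \<bullet> t)) \<le> ennreal (u * exp (x \<bullet> t) + v * exp (y \<bullet> t))"
      by (rule ennreal_leI)
    also have "\<dots> = ennreal u * ennreal (exp (x \<bullet> t)) + ennreal v * ennreal (exp (y \<bullet> t))"
      using uv by (simp add: ennreal_plus ennreal_mult)
    finally show "ennreal (exp ((u *\<^sub>R x + v *\<^sub>R y) \<bullet> t)) \<le> ennreal u * ennreal (exp (x \<bullet> t)) + ennreal v * ennreal (exp (y \<bullet> t))" .
  qed
  also have "\<dots> = ennreal u * laplace_tr \<mu> x + ennreal v * laplace_tr \<mu> y"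
    unfolding laplace_tr_def by (subst nn_integral_add) (simp_all add: nn_integral_cmult)
  also have "\<dots> < \<infinity>" using xy by (simp add: ennreal_mult_less_top)
  finally show "laplace_tr \<mu> (u *\<^sub>R x + v *\<^sub>R y) < \<infinity>" .
qed

lemma integrable_exp_laplace:
  assumes [measurable_cong]: "sets \<mu> = sets borel" and "laplace_tr \<mu> \<theta> < \<infinity>"
  shows "integrable \<mu> (\<lambda>x. exp (\<theta> \<bullet> x))"
  using assms(2) by (intro integrableI_bounded) (simp_all add: laplace_tr_def)

text \<open>The norm is at most n times the largest coordinate in modulus, and one of the 2n
  exponentials picks out that coordinate with its sign. The radial weight is thus replaced by
  exponentials of linear forms, which the Laplace transform controls.\<close>

lemma exp_norm_le:
  fixes x :: "real^'n::finite"
  assumes "0 \<le> e"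
  shows "exp (e / CARD('n) * norm x) \<le> (\<Sum>i\<in>UNIV. exp (e * x $ i) + exp (- e * x $ i))"
proof -
  define m where "m = Max (range (\<lambda>i. \<bar>x $ i\<bar>))"
  have "m \<in> range (\<lambda>i. \<bar>x $ i\<bar>)" unfolding m_def by (rule Max_in) auto
  then obtain i where i: "m = \<bar>x $ i\<bar>" by blast
  have "norm x \<le> (\<Sum>i\<in>UNIV. \<bar>x $ i\<bar>)" by (rule norm_le_l1_cart)
  also have "\<dots> \<le> (\<Sum>i\<in>(UNIV :: 'n set). m)"
    unfolding m_def by (intro sum_mono Max_ge) auto
  finally have "norm x \<le> CARD('n) * \<bar>x $ i\<bar>" by (simp add: i)
  then have "e / CARD('n) * norm x \<le> e / CARD('n) * (CARD('n) * \<bar>x $ i\<bar>)"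
    using assms by (intro mult_left_mono) auto
  then have "exp (e / CARD('n) * norm x) \<le> exp (e * \<bar>x $ i\<bar>)" by simp
  also have "\<dots> \<le> exp (e * x $ i) + exp (- e * x $ i)"
    by (cases "0 \<le> x $ i") (simp_all add: add_increasing add_increasing2)
  also have "\<dots> \<le> (\<Sum>i\<in>UNIV. exp (e * x $ i) + exp (- e * x $ i))"
    by (rule member_le_sum[of i UNIV "\<lambda>i. exp (e * x $ i) + exp (- e * x $ i)"]) (simp_all add: add_nonneg_nonneg)
  finally show ?thesis .
qed

text \<open>Moving \<theta> by e in either direction along each axis stays in a ball where the
  Laplace transform is finite; the 2n resulting integrals dominate that of a small radial
  exponential.\<close>

lemma Theta_exp_norm_integrable:
  fixes \<mu> :: "(real^'n::finite) measure"
  assumes s [measurable_cong]: "sets \<mu> = sets borel" and "\<theta> \<in> Theta \<mu>"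
  obtains e where "0 < e" "integrable \<mu> (\<lambda>x. exp (\<theta> \<bullet> x) * exp (e * norm x))"
proof -
  from assms(2) obtain r where r: "0 < r" "ball \<theta> r \<subseteq> {\<theta>. laplace_tr \<mu> \<theta> < \<infinity>}"
    unfolding Theta_def mem_interior by blast
  define e where "e = r / 2"
  have e: "0 < e" using r by (simp add: e_def)
  have i: "integrable \<mu> (\<lambda>x. exp ((\<theta> + s *\<^sub>R axis i 1) \<bullet> x))" if "\<bar>s\<bar> = e" for s i
  proof (rule integrable_exp_laplace[OF s])
    have "\<theta> + s *\<^sub>R axis i 1 \<in> ball \<theta> r"
      using that r by (simp add: dist_norm e_def)
    then show "laplace_tr \<mu> (\<theta> + s *\<^sub>R axis i 1) < \<infinity>" using r by blast
  qed
  have i': "integrable \<mu> (\<lambda>x. exp (\<theta> \<bullet> x) * exp (s * x $ i))" if "\<bar>s\<bar> = e" for s i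
    using i[OF that, of i] by (simp add: inner_add_left exp_add inner_axis' mult.commute)
  have I: "integrable \<mu> (\<lambda>x. \<Sum>i\<in>UNIV. exp (\<theta> \<bullet> x) * exp (e * x $ i) + exp (\<theta> \<bullet> x) * exp (- e * x $ i))"
    using i'[of e] i'[of "- e"] e by (intro Bochner_Integration.integrable_sum Bochner_Integration.integrable_add) auto
  have "integrable \<mu> (\<lambda>x. exp (\<theta> \<bullet> x) * exp (e / CARD('n) * norm x))"
  proof (rule integrable_le[OF I])
    show "norm (exp (\<theta> \<bullet> x) * exp (e / CARD('n) * norm x))
       \<le> (\<Sum>i\<in>UNIV. exp (\<theta> \<bullet> x) * exp (e * x $ i) + exp (\<theta> \<bullet> x) * exp (- e * x $ i))" for x
    proof -
      have "exp (\<theta> \<bullet> x) * exp (e / CARD('n) * norm x)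
        \<le> exp (\<theta> \<bullet> x) * (\<Sum>i\<in>UNIV. exp (e * x $ i) + exp (- e * x $ i))"
        using e by (intro mult_left_mono exp_norm_le) auto
      also have "\<dots> = (\<Sum>i\<in>UNIV. exp (\<theta> \<bullet> x) * exp (e * x $ i) + exp (\<theta> \<bullet> x) * exp (- e * x $ i))"
        by (simp add: sum_distrib_left distrib_left)
      finally show ?thesis by (simp add: abs_mult)
    qed
  qed simp
  moreover have "0 < e / CARD('n)" using e by simp
  ultimately show ?thesis using that by blast
qed

section \<open>Weights of subexponential growth and their Laplace transforms\<close>

definition subexp :: "(real^'n \<Rightarrow> real) \<Rightarrow> bool" where
  "subexp p \<longleftrightarrow> p \<in> borel_measurable borel \<and> (\<forall>d>0. \<exists>C. \<forall>x. \<bar>p x\<bar> \<le> C * exp (d * norm x))"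

lemma subexp_measurable: "subexp p \<Longrightarrow> p \<in> borel_measurable borel"
  by (simp add: subexp_def)

lemma subexp_const: "subexp (\<lambda>_. c)"
  unfolding subexp_def
proof (safe intro!: exI[of _ "\<bar>c\<bar>"])
  fix d :: real and x :: "real^'a" assume "0 < d"
  then show "\<bar>c\<bar> \<le> \<bar>c\<bar> * exp (d * norm x)"
    using mult_left_mono[of 1 "exp (d * norm x)" "\<bar>c\<bar>"] by simp
qed simp

text \<open>Each differentiation of the Laplace transform brings down a linear factor, so the class
  of weights has to be closed under it. Half of the rate pays for p, the other half for the linear
  form.\<close>

lemma subexp_mult_inner:
  assumes "subexp p" shows "subexp (\<lambda>x. p x * (h \<bullet> x))"
  unfolding subexp_def
proof (intro conjI allI impI)
  show "(\<lambda>x. p x * (h \<bullet> x)) \<in> borel_measurable borel"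
    using subexp_measurable[OF assms] by measurable
next
  fix d :: real assume "0 < d"
  then have d: "0 < d / 2" by simp
  then obtain C where C: "\<And>x. \<bar>p x\<bar> \<le> C * exp (d / 2 * norm x)"
    using assms unfolding subexp_def by blast
  have "\<bar>p x * (h \<bullet> x)\<bar> \<le> (C * norm h / (d / 2)) * exp (d * norm x)" for x
  proof -
    have "\<bar>h \<bullet> x\<bar> \<le> norm h * norm x" by (rule Cauchy_Schwarz_ineq2)
    also have "\<dots> \<le> norm h * (exp (d / 2 * norm x) / (d / 2))"
      by (intro mult_left_mono mult_exp_le d) simp
    finally have "\<bar>p x\<bar> * \<bar>h \<bullet> x\<bar> \<le> (C * exp (d / 2 * norm x)) * (norm h * (exp (d / 2 * norm x) / (d / 2)))"
      using C[of x] by (intro mult_mono) auto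
    also have "\<dots> = (C * norm h / (d / 2)) * (exp (d / 2 * norm x) * exp (d / 2 * norm x))"
      by simp
    also have "exp (d / 2 * norm x) * exp (d / 2 * norm x) = exp (d * norm x)"
      by (simp add: exp_add[symmetric])
    finally show ?thesis by (simp add: abs_mult)
  qed
  then show "\<exists>C. \<forall>x. \<bar>p x * (h \<bullet> x)\<bar> \<le> C * exp (d * norm x)" by blast
qed

lemma subexp_mult_nth: "subexp p \<Longrightarrow> subexp (\<lambda>x. p x * x $ i)"
  using subexp_mult_inner[of p "axis i 1"] by (simp add: inner_axis')

lemma subexp_exp_norm_integrable:
  fixes \<mu> :: "(real^'n::finite) measure"
  assumes s [measurable_cong]: "sets \<mu> = sets borel" and t: "\<theta> \<in> Theta \<mu>" and p: "subexp p"
  obtains e where "0 < e" "integrable \<mu> (\<lambda>x. \<bar>p x * exp (\<theta> \<bullet> x)\<bar> * exp (e * norm x))"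
proof -
  note [measurable] = subexp_measurable[OF p]
  obtain e where e: "0 < e" "integrable \<mu> (\<lambda>x. exp (\<theta> \<bullet> x) * exp (e * norm x))"
    using Theta_exp_norm_integrable[OF s t] by blast
  then have e2: "0 < e / 2" by simp
  then obtain C where C: "\<And>x. \<bar>p x\<bar> \<le> C * exp (e / 2 * norm x)"
    using p unfolding subexp_def by blast
  have I: "integrable \<mu> (\<lambda>x. C * (exp (\<theta> \<bullet> x) * exp (e * norm x)))" using e by simp
  have "integrable \<mu> (\<lambda>x. \<bar>p x * exp (\<theta> \<bullet> x)\<bar> * exp (e / 2 * norm x))"
  proof (rule integrable_le[OF I])
    show "norm (\<bar>p x * exp (\<theta> \<bullet> x)\<bar> * exp (e / 2 * norm x)) \<le> C * (exp (\<theta> \<bullet> x) * exp (e * norm x))" for x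
    proof -
      have "\<bar>p x\<bar> * (exp (\<theta> \<bullet> x) * exp (e / 2 * norm x)) \<le> C * exp (e / 2 * norm x) * (exp (\<theta> \<bullet> x) * exp (e / 2 * norm x))"
        using C by (intro mult_right_mono) auto
      also have "\<dots> = C * (exp (\<theta> \<bullet> x) * exp (e * norm x))"
        by (simp add: exp_add[symmetric] mult_ac)
      finally show ?thesis by (simp add: abs_mult mult_ac)
    qed
  qed simp
  with e2 show ?thesis using that by blast
qed

lemma subexp_integrable:
  fixes \<mu> :: "(real^'n::finite) measure"
  assumes s [measurable_cong]: "sets \<mu> = sets borel" and t: "\<theta> \<in> Theta \<mu>" and p: "subexp p"
  shows "integrable \<mu> (\<lambda>x. p x * exp (\<theta> \<bullet> x))"
proof -
  note [measurable] = subexp_measurable[OF p]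
  obtain e where e: "0 < e" "integrable \<mu> (\<lambda>x. \<bar>p x * exp (\<theta> \<bullet> x)\<bar> * exp (e * norm x))"
    using subexp_exp_norm_integrable[OF s t p] by blast
  show ?thesis
  proof (rule integrable_le[OF e(2)])
    show "norm (p x * exp (\<theta> \<bullet> x)) \<le> \<bar>p x * exp (\<theta> \<bullet> x)\<bar> * exp (e * norm x)" for x
      using e mult_left_mono[of 1 "exp (e * norm x)" "\<bar>p x * exp (\<theta> \<bullet> x)\<bar>"] by simp
  qed simp
qed

text \<open>Treats the Laplace transform and its moments of all orders alike: differentiation only
  changes the weight p.\<close>

definition wlaplace :: "(real^'n) measure \<Rightarrow> (real^'n \<Rightarrow> real) \<Rightarrow> real^'n \<Rightarrow> real" where
  "wlaplace \<mu> p \<theta> = (\<integral>x. p x * exp (\<theta> \<bullet> x) \<partial>\<mu>)"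

lemma wlaplace_has_derivative:
  fixes \<mu> :: "(real^'n::finite) measure"
  assumes s: "sets \<mu> = sets borel" and t: "\<theta> \<in> Theta \<mu>" and p: "subexp p"
  shows "(wlaplace \<mu> p has_derivative (\<lambda>h. wlaplace \<mu> (\<lambda>x. p x * (h \<bullet> x)) \<theta>)) (at \<theta>)"
proof -
  note [measurable] = subexp_measurable[OF p]
  obtain e where e: "0 < e" "integrable \<mu> (\<lambda>x. \<bar>p x * exp (\<theta> \<bullet> x)\<bar> * exp (e * norm x))"
    using subexp_exp_norm_integrable[OF s t p] by blast
  have "((\<lambda>h. \<integral>x. complex_of_real (p x * exp (\<theta> \<bullet> x)) * exp (complex_of_real (h \<bullet> x)) \<partial>\<mu>) has_derivative
     (\<lambda>h. \<integral>x. complex_of_real (p x * exp (\<theta> \<bullet> x)) * complex_of_real (h \<bullet> x) \<partial>\<mu>)) (at 0)"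
  proof (rule has_derivative_integral_exp[OF s _ _ e(1), where B = 1])
    show "integrable \<mu> (\<lambda>x. cmod (complex_of_real (p x * exp (\<theta> \<bullet> x))) * exp (e * norm x))"
      using e(2) by (simp only: norm_of_real)
    show "linear (\<lambda>h. complex_of_real (h \<bullet> x))" for x :: "real^'n"
      by (rule linearI) (simp_all add: inner_add_left complex_eq_iff)
    show "cmod (complex_of_real (h \<bullet> x)) \<le> 1 * norm h * norm x" for h x :: "real^'n"
      using Cauchy_Schwarz_ineq2[of h x] by simp
  qed simp_all
  \<comment> \<open>The general estimate is complex valued; the integrand is real here, so taking
    real parts recovers the real statement.\<close>
  then have "((\<lambda>h. Re (\<integral>x. complex_of_real (p x * exp (\<theta> \<bullet> x)) * exp (complex_of_real (h \<bullet> x)) \<partial>\<mu>)) has_derivative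
     (\<lambda>h. Re (\<integral>x. complex_of_real (p x * exp (\<theta> \<bullet> x)) * complex_of_real (h \<bullet> x) \<partial>\<mu>))) (at 0)"
    by (rule bounded_linear.has_derivative[OF bounded_linear_Re])
  moreover have "Re (\<integral>x. complex_of_real (p x * exp (\<theta> \<bullet> x)) * exp (complex_of_real (h \<bullet> x)) \<partial>\<mu>) = wlaplace \<mu> p (\<theta> + h)" for h
    by (simp only: of_real_mult[symmetric] exp_of_real integral_complex_of_real Re_complex_of_real wlaplace_def
      inner_add_left exp_add mult.assoc)
  moreover have "Re (\<integral>x. complex_of_real (p x * exp (\<theta> \<bullet> x)) * complex_of_real (h \<bullet> x) \<partial>\<mu>) = wlaplace \<mu> (\<lambda>x. p x * (h \<bullet> x)) \<theta>" for h
    by (simp only: of_real_mult[symmetric] integral_complex_of_real Re_complex_of_real wlaplace_def mult_ac)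
  ultimately have "((\<lambda>h. wlaplace \<mu> p (\<theta> + h)) has_derivative (\<lambda>h. wlaplace \<mu> (\<lambda>x. p x * (h \<bullet> x)) \<theta>)) (at 0)"
    by simp
  then show ?thesis unfolding has_derivative_at by simp
qed

text \<open>Real analyticity in the form that the identity theorem consumes: one function,
  holomorphic on all of S, restricts to f at the real points of S.\<close>

definition hol_ext :: "complex set \<Rightarrow> (real \<Rightarrow> real) \<Rightarrow> bool" where
  "hol_ext S f \<longleftrightarrow> (\<exists>F. F holomorphic_on S \<and> (\<forall>t. of_real t \<in> S \<longrightarrow> F (of_real t) = of_real (f t)))"

text \<open>The modulus of exp (\<theta> \<bullet> x + z (v \<bullet> x)) depends only on the real
  part of z, so the weighted integral is complex differentiable on the whole vertical strip above
  the part of the line inside \<open>Theta \<mu>\<close>.\<close>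

lemma wlaplace_hol_ext:
  fixes \<mu> :: "(real^'n::finite) measure"
  assumes s [measurable_cong]: "sets \<mu> = sets borel" and p: "subexp p"
  shows "hol_ext {z. \<theta> + Re z *\<^sub>R v \<in> Theta \<mu>} (\<lambda>t. wlaplace \<mu> p (\<theta> + t *\<^sub>R v))"
  unfolding hol_ext_def
proof (intro exI conjI allI impI)
  note [measurable] = subexp_measurable[OF p]
  let ?F = "\<lambda>z. \<integral>x. complex_of_real (p x) * exp (complex_of_real (\<theta> \<bullet> x) + z * complex_of_real (v \<bullet> x)) \<partial>\<mu>"
  show "?F holomorphic_on {z. \<theta> + Re z *\<^sub>R v \<in> Theta \<mu>}"
    unfolding holomorphic_on_def
  proof
    fix z assume "z \<in> {z. \<theta> + Re z *\<^sub>R v \<in> Theta \<mu>}"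
    then have t: "\<theta> + Re z *\<^sub>R v \<in> Theta \<mu>" by simp
    obtain e where e: "0 < e" "integrable \<mu> (\<lambda>x. \<bar>p x * exp ((\<theta> + Re z *\<^sub>R v) \<bullet> x)\<bar> * exp (e * norm x))"
      using subexp_exp_norm_integrable[OF s t p] by blast
    let ?q = "\<lambda>x. complex_of_real (p x) * exp (complex_of_real (\<theta> \<bullet> x) + z * complex_of_real (v \<bullet> x))"
    have "((\<lambda>h. \<integral>x. ?q x * exp (h * complex_of_real (v \<bullet> x)) \<partial>\<mu>) has_derivative
       (\<lambda>h. \<integral>x. ?q x * (h * complex_of_real (v \<bullet> x)) \<partial>\<mu>)) (at 0)"
    proof (rule has_derivative_integral_exp[OF s _ _ e(1), where B = "norm v + 1"])
      have "cmod (?q x) = \<bar>p x * exp ((\<theta> + Re z *\<^sub>R v) \<bullet> x)\<bar>" for x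
        by (simp add: norm_mult inner_add_left abs_mult)
      then show "integrable \<mu> (\<lambda>x. cmod (?q x) * exp (e * norm x))" using e(2) by simp
      show "linear (\<lambda>h. h * complex_of_real (v \<bullet> x))" for x :: "real^'n"
        by (rule linearI) (simp_all add: algebra_simps)
      show "cmod (h * complex_of_real (v \<bullet> x)) \<le> (norm v + 1) * norm h * norm x" for h x
      proof -
        have "\<bar>v \<bullet> x\<bar> \<le> norm v * norm x" by (rule Cauchy_Schwarz_ineq2)
        also have "\<dots> \<le> (norm v + 1) * norm x" by (intro mult_right_mono) auto
        finally have "norm h * \<bar>v \<bullet> x\<bar> \<le> norm h * ((norm v + 1) * norm x)" by (rule mult_left_mono) simp
        then show ?thesis by (simp add: norm_mult mult_ac)
      qed
    qed (simp_all add: add_nonneg_pos)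
    moreover have "?q x * (h * complex_of_real (v \<bullet> x)) = h * (?q x * complex_of_real (v \<bullet> x))" for h x
      by simp
    moreover have "?q x * exp (h * complex_of_real (v \<bullet> x)) = complex_of_real (p x) * exp (complex_of_real (\<theta> \<bullet> x) + (z + h) * complex_of_real (v \<bullet> x))" for h x
      by (simp add: exp_add distrib_right)
    ultimately have "((\<lambda>h. ?F (z + h)) has_derivative (\<lambda>h. h * (\<integral>x. ?q x * complex_of_real (v \<bullet> x) \<partial>\<mu>))) (at 0)"
      by (simp only: integral_mult_right_zero)
    then have "(?F has_derivative (\<lambda>h. h * (\<integral>x. ?q x * complex_of_real (v \<bullet> x) \<partial>\<mu>))) (at z)"
      unfolding has_derivative_at by (simp only: add_0_left add_0_right)
    moreover have "(\<lambda>h. h * c) = (*) c" for c :: complex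
      by (simp add: fun_eq_iff mult.commute)
    ultimately have "(?F has_field_derivative (\<integral>x. ?q x * complex_of_real (v \<bullet> x) \<partial>\<mu>)) (at z)"
      unfolding has_field_derivative_def by (simp only:)
    then have "?F field_differentiable (at z)"
      unfolding field_differentiable_def by blast
    then show "?F field_differentiable (at z within {z. \<theta> + Re z *\<^sub>R v \<in> Theta \<mu>})"
      by (rule field_differentiable_at_within)
  qed
next
  fix t :: real
  have "complex_of_real (p x) * exp (complex_of_real (\<theta> \<bullet> x) + of_real t * complex_of_real (v \<bullet> x))
     = complex_of_real (p x * exp ((\<theta> + t *\<^sub>R v) \<bullet> x))" for x
    by (simp add: inner_add_left exp_of_real[symmetric])
  then show "(\<integral>x. complex_of_real (p x) * exp (complex_of_real (\<theta> \<bullet> x) + of_real t * complex_of_real (v \<bullet> x)) \<partial>\<mu>)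
     = of_real (wlaplace \<mu> p (\<theta> + t *\<^sub>R v))"
    by (simp only: integral_complex_of_real wlaplace_def)
qed


section \<open>Closure properties of holomorphic extensions and the identity theorem\<close>

lemma hol_ext_const: "hol_ext S (\<lambda>_. c)"
  unfolding hol_ext_def by (intro exI[of _ "\<lambda>_. of_real c"]) simp

lemma hol_ext_id: "hol_ext S (\<lambda>t. t)"
  unfolding hol_ext_def by (intro exI[of _ "\<lambda>z. z"]) simp

lemma hol_ext_add:
  assumes "hol_ext S f" "hol_ext S g" shows "hol_ext S (\<lambda>t. f t + g t)"
proof -
  obtain F G where "F holomorphic_on S" "\<And>t. of_real t \<in> S \<Longrightarrow> F (of_real t) = of_real (f t)"
    "G holomorphic_on S" "\<And>t. of_real t \<in> S \<Longrightarrow> G (of_real t) = of_real (g t)"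
    using assms unfolding hol_ext_def by metis
  then show ?thesis
    unfolding hol_ext_def by (intro exI[of _ "\<lambda>z. F z + G z"]) (auto intro: holomorphic_intros)
qed

lemma hol_ext_mult:
  assumes "hol_ext S f" "hol_ext S g" shows "hol_ext S (\<lambda>t. f t * g t)"
proof -
  obtain F G where "F holomorphic_on S" "\<And>t. of_real t \<in> S \<Longrightarrow> F (of_real t) = of_real (f t)"
    "G holomorphic_on S" "\<And>t. of_real t \<in> S \<Longrightarrow> G (of_real t) = of_real (g t)"
    using assms unfolding hol_ext_def by metis
  then show ?thesis
    unfolding hol_ext_def by (intro exI[of _ "\<lambda>z. F z * G z"]) (auto intro: holomorphic_intros)
qed

lemma hol_ext_diff:
  assumes "hol_ext S f" "hol_ext S g" shows "hol_ext S (\<lambda>t. f t - g t)"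
  using hol_ext_add[OF assms(1) hol_ext_mult[OF hol_ext_const[of S "-1"] assms(2)]] by simp

lemma hol_ext_power: "hol_ext S f \<Longrightarrow> hol_ext S (\<lambda>t. f t ^ n)"
  by (induction n) (auto intro: hol_ext_const hol_ext_mult)

lemma hol_ext_sum: "(\<And>i. i \<in> I \<Longrightarrow> hol_ext S (f i)) \<Longrightarrow> hol_ext S (\<lambda>t. \<Sum>i\<in>I. f i t)"
  by (induction I rule: infinite_finite_induct) (auto intro: hol_ext_const hol_ext_add)

lemma hol_ext_prod: "(\<And>i. i \<in> I \<Longrightarrow> hol_ext S (f i)) \<Longrightarrow> hol_ext S (\<lambda>t. \<Prod>i\<in>I. f i t)"
  by (induction I rule: infinite_finite_induct) (auto intro: hol_ext_const hol_ext_mult)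

lemma hol_ext_det:
  fixes M :: "real \<Rightarrow> real^'n::finite^'n"
  assumes "\<And>i j. hol_ext S (\<lambda>t. M t $ i $ j)"
  shows "hol_ext S (\<lambda>t. det (M t))"
  unfolding det_def by (intro hol_ext_sum hol_ext_mult hol_ext_const hol_ext_prod assms)

lemma hol_ext_polynomial:
  fixes P :: "real^'n::finite \<Rightarrow> real"
  assumes "real_polynomial_function P" and u: "\<And>i. hol_ext S (\<lambda>t. u t $ i)"
  shows "hol_ext S (\<lambda>t. P (u t))"
  using assms(1)
proof (induction P rule: real_polynomial_function.induct)
  case (linear f)
  have "f (u t) = (\<Sum>i\<in>UNIV. u t $ i * f (axis i 1))" for t
    by (subst basis_expansion[of "u t", symmetric])
      (simp add: linear_sum[OF bounded_linear.linear[OF linear]] scalar_mult_eq_scaleR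
        linear_scale[OF bounded_linear.linear[OF linear]])
  then show ?case by (simp add: hol_ext_sum hol_ext_mult hol_ext_const u)
qed (auto intro: hol_ext_const hol_ext_add hol_ext_mult)

text \<open>The zeros accumulate at a, so by analytic continuation the extension vanishes on the
  whole connected set S, in particular at b.\<close>

lemma hol_ext_identity:
  assumes f: "hol_ext S f" and S: "open S" "connected S" "\<And>t. \<bar>t - a\<bar> < e \<Longrightarrow> of_real t \<in> S"
    and e: "0 < e" and z: "\<And>t. \<bar>t - a\<bar> < e \<Longrightarrow> f t = 0" and b: "of_real b \<in> S"
  shows "f b = 0"
proof -
  obtain F where F: "F holomorphic_on S" "\<And>t. of_real t \<in> S \<Longrightarrow> F (of_real t) = of_real (f t)"
    using f unfolding hol_ext_def by blast
  let ?U = "complex_of_real ` {t. \<bar>t - a\<bar> < e}"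
  have "of_real a islimpt ?U"
    unfolding islimpt_approachable
  proof (intro allI impI)
    fix d :: real assume d: "0 < d"
    define s where "s = min d e / 2"
    have s: "0 < s" "s < d" "s < e" using d e by (auto simp: s_def)
    then have "complex_of_real (a + s) \<in> ?U" by (intro imageI) auto
    moreover have "complex_of_real (a + s) \<noteq> of_real a" using s by (simp only: of_real_eq_iff)
    moreover have "dist (complex_of_real (a + s)) (of_real a) < d"
      using s by (simp add: dist_norm)
    ultimately show "\<exists>x'\<in>?U. x' \<noteq> of_real a \<and> dist x' (of_real a) < d" by blast
  qed
  then have "F (of_real b) = 0"
  proof (rule analytic_continuation[OF F(1) S(1,2), of ?U "of_real a" "of_real b", rotated 2])
    show "?U \<subseteq> S" using S(3) by auto
    show "of_real a \<in> S" using S(3) e by simp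
    show "of_real b \<in> S" by (rule b)
    show "F z = 0" if "z \<in> ?U" for z using that F(2) S(3) z by auto
  qed
  then show ?thesis using F(2)[OF b] by simp
qed

lemma open_line:
  fixes u v :: "'a::real_normed_vector"
  assumes "open S" "u \<in> S"
  obtains e where "0 < e" "\<And>t. \<bar>t\<bar> < e \<Longrightarrow> u + t *\<^sub>R v \<in> S"
proof -
  obtain r where r: "0 < r" "ball u r \<subseteq> S" using assms open_contains_ball by blast
  define e where "e = r / (norm v + 1)"
  have v: "0 < norm v + 1" by (simp add: add_nonneg_pos)
  have "u + t *\<^sub>R v \<in> S" if "\<bar>t\<bar> < e" for t
  proof -
    have "\<bar>t\<bar> * norm v \<le> \<bar>t\<bar> * (norm v + 1)" by (intro mult_left_mono) auto
    also have "\<dots> < r" using that v by (simp add: e_def field_simps)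
    finally have "u + t *\<^sub>R v \<in> ball u r" by (simp add: dist_norm)
    then show ?thesis using r by blast
  qed
  moreover have "0 < e" using r v by (simp add: e_def)
  ultimately show ?thesis using that by blast
qed

text \<open>Reduction to one variable: along the line through a point of S and w the polynomial
  extends to an entire function that vanishes near the first point.\<close>

lemma polynomial_eq_0:
  fixes P :: "real^'n::finite \<Rightarrow> real"
  assumes P: "real_polynomial_function P" and S: "open S" "S \<noteq> {}" "\<And>u. u \<in> S \<Longrightarrow> P u = 0"
  shows "P w = 0"
proof -
  obtain u where u: "u \<in> S" using S by blast
  then obtain e where e: "0 < e" "\<And>t. \<bar>t\<bar> < e \<Longrightarrow> u + t *\<^sub>R (w - u) \<in> S"
    using open_line[OF S(1)] by blast
  have "hol_ext UNIV (\<lambda>t. P (u + t *\<^sub>R (w - u)))"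
    by (rule hol_ext_polynomial[OF P]) (auto intro!: hol_ext_add hol_ext_mult hol_ext_const hol_ext_id)
  then have "P (u + 1 *\<^sub>R (w - u)) = 0"
    by (rule hol_ext_identity[where a = 0 and e = e]) (use e S(3) in auto)
  then show ?thesis by simp
qed

section \<open>Cumulants\<close>

lemma cumulant_grad_eqI: "GDERIV (cumulant \<mu>) \<theta> :> D \<Longrightarrow> cumulant_grad \<mu> \<theta> = D"
  unfolding cumulant_grad_def
proof (rule the_equality)
  fix E assume "GDERIV (cumulant \<mu>) \<theta> :> D" "GDERIV (cumulant \<mu>) \<theta> :> E"
  then have "(\<lambda>h. h \<bullet> E) = (\<lambda>h. h \<bullet> D)"
    unfolding gderiv_def by (rule has_derivative_unique[rotated])
  then have "h \<bullet> (E - D) = 0" for h by (simp add: inner_diff_right fun_eq_iff)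
  then show "E = D" using inner_eq_zero_iff by (metis right_minus_eq)
qed

lemma has_derivative_vec:
  fixes f :: "'a::real_normed_vector \<Rightarrow> real^'n::finite"
  assumes "\<And>i. ((\<lambda>x. f x $ i) has_derivative (\<lambda>h. D h $ i)) (at x)"
  shows "(f has_derivative D) (at x)"
  using assms
  by (subst has_derivative_componentwise_within) (auto simp: Basis_vec_def inner_axis)

locale nef =
  fixes \<mu> :: "(real^'n::finite) measure"
  assumes generator: "nef_generator \<mu>"
begin

lemma sets_borel [measurable_cong]: "sets \<mu> = sets borel"
  using generator by (simp add: nef_generator_def)

lemma not_AE_hyperplane: "a \<noteq> 0 \<Longrightarrow> \<not> (AE x in \<mu>. a \<bullet> x = b)"
  using generator by (auto simp: nef_generator_def)

abbreviation "L \<equiv> wlaplace \<mu> (\<lambda>_. 1)"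
abbreviation "L1 i \<equiv> wlaplace \<mu> (\<lambda>x. x $ i)"
abbreviation "L2 i j \<equiv> wlaplace \<mu> (\<lambda>x. x $ i * x $ j)"

lemma subexp_1: "subexp (\<lambda>_. 1)" by (rule subexp_const)
lemma subexp_nth: "subexp (\<lambda>x. x $ i)" using subexp_mult_nth[OF subexp_1, of i] by simp
lemma subexp_nth2: "subexp (\<lambda>x. x $ i * x $ j)" by (rule subexp_mult_nth[OF subexp_nth])

lemma integrable_subexp: "\<theta> \<in> Theta \<mu> \<Longrightarrow> subexp p \<Longrightarrow> integrable \<mu> (\<lambda>x. p x * exp (\<theta> \<bullet> x))"
  by (rule subexp_integrable[OF sets_borel])

text \<open>Nondegeneracy enters here: a zero integral of a positive function means that \<mu> is
  null, and a null measure is concentrated on every hyperplane.\<close>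

lemma L_pos: assumes "\<theta> \<in> Theta \<mu>" shows "0 < L \<theta>"
proof -
  have i: "integrable \<mu> (\<lambda>x. 1 * exp (\<theta> \<bullet> x))" by (rule integrable_subexp[OF assms subexp_1])
  have "L \<theta> \<noteq> 0"
  proof
    assume "L \<theta> = 0"
    then have "AE x in \<mu>. 1 * exp (\<theta> \<bullet> x) = 0"
      using integral_nonneg_eq_0_iff_AE[OF i] by (simp add: wlaplace_def)
    then have "AE x in \<mu>. axis undefined 1 \<bullet> x = 0" by (rule eventually_mono) simp
    then show False using not_AE_hyperplane[of "axis undefined 1" 0] by (simp add: axis_eq_0_iff)
  qed
  moreover have "0 \<le> L \<theta>" unfolding wlaplace_def by (rule Bochner_Integration.integral_nonneg) simp
  ultimately show ?thesis by simp
qed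

lemma cumulant_eq: assumes "\<theta> \<in> Theta \<mu>" shows "cumulant \<mu> \<theta> = ln (L \<theta>)"
proof -
  have i: "integrable \<mu> (\<lambda>x. 1 * exp (\<theta> \<bullet> x))" by (rule integrable_subexp[OF assms subexp_1])
  have "laplace_tr \<mu> \<theta> = ennreal (L \<theta>)"
    unfolding laplace_tr_def wlaplace_def using nn_integral_eq_integral[OF i] by simp
  then show ?thesis using L_pos[OF assms] by (simp add: cumulant_def)
qed

lemma wlaplace_mult_inner:
  assumes "\<theta> \<in> Theta \<mu>" "subexp p"
  shows "wlaplace \<mu> (\<lambda>x. p x * (h \<bullet> x)) \<theta> = (\<Sum>i\<in>UNIV. h $ i * wlaplace \<mu> (\<lambda>x. p x * x $ i) \<theta>)"
proof -
  have "p x * (h \<bullet> x) * exp (\<theta> \<bullet> x) = (\<Sum>i\<in>UNIV. h $ i * ((p x * x $ i) * exp (\<theta> \<bullet> x)))" for x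
    by (simp add: inner_vec_def sum_distrib_left sum_distrib_right mult_ac)
  then have "wlaplace \<mu> (\<lambda>x. p x * (h \<bullet> x)) \<theta> = (\<integral>x. (\<Sum>i\<in>UNIV. h $ i * ((p x * x $ i) * exp (\<theta> \<bullet> x))) \<partial>\<mu>)"
    by (simp add: wlaplace_def)
  also have "\<dots> = (\<Sum>i\<in>UNIV. \<integral>x. h $ i * ((p x * x $ i) * exp (\<theta> \<bullet> x)) \<partial>\<mu>)"
    by (rule Bochner_Integration.integral_sum)
      (intro integrable_mult_right integrable_subexp assms subexp_mult_nth)
  finally show ?thesis by (simp add: wlaplace_def)
qed

lemma L_has_derivative: "\<theta> \<in> Theta \<mu> \<Longrightarrow> (L has_derivative (\<lambda>h. \<Sum>j\<in>UNIV. h $ j * L1 j \<theta>)) (at \<theta>)"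
  using wlaplace_has_derivative[OF sets_borel _ subexp_1, of \<theta>] wlaplace_mult_inner[OF _ subexp_1, of \<theta>]
  by simp

lemma L1_has_derivative: "\<theta> \<in> Theta \<mu> \<Longrightarrow> (L1 i has_derivative (\<lambda>h. \<Sum>j\<in>UNIV. h $ j * L2 i j \<theta>)) (at \<theta>)"
  using wlaplace_has_derivative[OF sets_borel _ subexp_nth, of \<theta>] wlaplace_mult_inner[OF _ subexp_nth, of \<theta>]
  by simp

lemma cumulant_grad_eq:
  assumes t: "\<theta> \<in> Theta \<mu>"
  shows "cumulant_grad \<mu> \<theta> = (\<chi> i. L1 i \<theta> / L \<theta>)"
proof (rule cumulant_grad_eqI)
  have "((\<lambda>\<theta>. ln (L \<theta>)) has_derivative (\<lambda>h. (\<Sum>j\<in>UNIV. h $ j * L1 j \<theta>) * inverse (L \<theta>))) (at \<theta>)"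
    using has_derivative_ln[OF L_pos[OF t] L_has_derivative[OF t]] .
  then have "(cumulant \<mu> has_derivative (\<lambda>h. (\<Sum>j\<in>UNIV. h $ j * L1 j \<theta>) * inverse (L \<theta>))) (at \<theta>)"
    by (rule has_derivative_transform_within_open[OF _ open_Theta t]) (simp add: cumulant_eq)
  then show "GDERIV (cumulant \<mu>) \<theta> :> (\<chi> i. L1 i \<theta> / L \<theta>)"
    by (simp add: gderiv_def inner_vec_def divide_inverse sum_distrib_right mult.assoc)
qed

lemma cumulant_grad_has_derivative:
  assumes t: "\<theta> \<in> Theta \<mu>"
  shows "(cumulant_grad \<mu> has_derivative
     (\<lambda>h. (\<chi> i j. (L2 i j \<theta> * L \<theta> - L1 i \<theta> * L1 j \<theta>) / (L \<theta>)\<^sup>2) *v h)) (at \<theta>)"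
proof -
  have L: "L \<theta> \<noteq> 0" using L_pos[OF t] by simp
  have "((\<lambda>\<theta>. \<chi> i. L1 i \<theta> / L \<theta>) has_derivative
     (\<lambda>h. (\<chi> i j. (L2 i j \<theta> * L \<theta> - L1 i \<theta> * L1 j \<theta>) / (L \<theta>)\<^sup>2) *v h)) (at \<theta>)"
  proof (rule has_derivative_vec)
    fix i
    have e: "- L1 i \<theta> * (inverse (L \<theta>) * (\<Sum>j\<in>UNIV. h $ j * L1 j \<theta>) * inverse (L \<theta>)) + (\<Sum>j\<in>UNIV. h $ j * L2 i j \<theta>) / L \<theta>
        = ((\<chi> i j. (L2 i j \<theta> * L \<theta> - L1 i \<theta> * L1 j \<theta>) / (L \<theta>)\<^sup>2) *v h) $ i" for h
    proof -
      have "((\<chi> i j. (L2 i j \<theta> * L \<theta> - L1 i \<theta> * L1 j \<theta>) / (L \<theta>)\<^sup>2) *v h) $ i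
        = (\<Sum>j\<in>UNIV. (h $ j * L2 i j \<theta>) / L \<theta> - L1 i \<theta> / (L \<theta>)\<^sup>2 * (h $ j * L1 j \<theta>))"
        using L by (simp add: matrix_vector_mult_def) (intro sum.cong refl, simp add: field_simps power2_eq_square)
      also have "\<dots> = (\<Sum>j\<in>UNIV. h $ j * L2 i j \<theta>) / L \<theta> - L1 i \<theta> / (L \<theta>)\<^sup>2 * (\<Sum>j\<in>UNIV. h $ j * L1 j \<theta>)"
        by (simp add: sum_subtractf sum_divide_distrib sum_distrib_left)
      finally show ?thesis using L by (simp add: field_simps power2_eq_square)
    qed
    show "((\<lambda>\<theta>. (\<chi> i. L1 i \<theta> / L \<theta>) $ i) has_derivative
     (\<lambda>h. ((\<chi> i j. (L2 i j \<theta> * L \<theta> - L1 i \<theta> * L1 j \<theta>) / (L \<theta>)\<^sup>2) *v h) $ i)) (at \<theta>)"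
      using has_derivative_divide[OF L1_has_derivative[OF t, of i] L_has_derivative[OF t] L]
      unfolding e by simp
  qed
  then show ?thesis
    by (rule has_derivative_transform_within_open[OF _ open_Theta t]) (simp add: cumulant_grad_eq)
qed

text \<open>With \<open>(L \<theta>)\<^sup>2\<close> factored out, the entries are polynomials in L
  and its derivatives. They extend holomorphically without division by L, whose extension may vanish
  at complex points.\<close>

lemma cumulant_hess_eq:
  assumes t: "\<theta> \<in> Theta \<mu>"
  shows "cumulant_hess \<mu> \<theta> = (1 / (L \<theta>)\<^sup>2) *\<^sub>R (\<chi> i j. L2 i j \<theta> * L \<theta> - L1 i \<theta> * L1 j \<theta>)"
  using jacobian_eqI[OF cumulant_grad_has_derivative[OF t]]
  by (simp add: cumulant_hess_def vec_eq_iff)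

text \<open>With p_\<theta> and p_\<eta> the normalized densities, f is (p_\<eta> - p_\<theta>) ln
  (p_\<eta> / p_\<theta>), the integrand of the symmetrized Kullback-Leibler divergence. Its
  integral is v \<bullet> (k'(\<eta>) - k'(\<theta>)), which vanishes for equal means; then the log
  ratio \<open>v \<bullet> x - c\<close> is zero almost everywhere, and nondegeneracy forces v =
  0.\<close>

lemma inj_on_cumulant_grad: "inj_on (cumulant_grad \<mu>) (Theta \<mu>)"
proof (rule inj_onI)
  fix \<theta> \<eta> assume t: "\<theta> \<in> Theta \<mu>" and n: "\<eta> \<in> Theta \<mu>" and eq: "cumulant_grad \<mu> \<theta> = cumulant_grad \<mu> \<eta>"
  define v where "v = \<eta> - \<theta>"
  define c where "c = ln (L \<eta>) - ln (L \<theta>)"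
  have L: "0 < L \<theta>" "0 < L \<eta>" using L_pos t n by auto
  have ec: "exp c = L \<eta> / L \<theta>" using L by (simp add: c_def exp_diff)
  define f where "f x = (exp (\<eta> \<bullet> x) / L \<eta> - exp (\<theta> \<bullet> x) / L \<theta>) * (v \<bullet> x - c)" for x
  \<comment> \<open>Relative to p_\<theta> the integrand is (e^s - 1) s with s the log ratio:
    nonnegative, and zero only for s = 0.\<close>
  have fe: "f x = exp (\<theta> \<bullet> x) / L \<theta> * ((exp (v \<bullet> x - c) - 1) * (v \<bullet> x - c))" for x
  proof -
    have "exp (\<eta> \<bullet> x) = exp (\<theta> \<bullet> x) * exp (v \<bullet> x)"
      by (simp add: v_def inner_diff_left exp_add[symmetric])
    moreover have "exp (v \<bullet> x - c) = exp (v \<bullet> x) * L \<theta> / L \<eta>" by (simp add: exp_diff ec)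
    ultimately have "exp (\<eta> \<bullet> x) / L \<eta> = exp (\<theta> \<bullet> x) / L \<theta> * exp (v \<bullet> x - c)" using L by simp
    then show ?thesis by (simp add: f_def left_diff_distrib right_diff_distrib)
  qed
  have pos: "0 \<le> (exp s - 1) * s" for s :: real
    by (cases "0 \<le> s") (auto intro: mult_nonneg_nonneg mult_nonpos_nonpos)
  have zero: "s = 0" if "(exp s - 1) * s = 0" for s :: real using that by auto
  have i0: "integrable \<mu> (\<lambda>x. exp (\<eta> \<bullet> x))" "integrable \<mu> (\<lambda>x. exp (\<theta> \<bullet> x))"
    using integrable_subexp[OF _ subexp_1] t n by fastforce+
  have sv: "subexp (\<lambda>x. v \<bullet> x)" using subexp_mult_inner[OF subexp_1] by simp
  have i1: "integrable \<mu> (\<lambda>x. (v \<bullet> x) * exp (\<eta> \<bullet> x))" "integrable \<mu> (\<lambda>x. (v \<bullet> x) * exp (\<theta> \<bullet> x))"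
    using integrable_subexp[OF _ sv] t n by auto
  have g: "wlaplace \<mu> (\<lambda>x. v \<bullet> x) \<theta>' = L \<theta>' * (v \<bullet> cumulant_grad \<mu> \<theta>')" if "\<theta>' \<in> Theta \<mu>" for \<theta>'
    using wlaplace_mult_inner[OF that subexp_1, of v] L_pos[OF that]
    by (simp add: cumulant_grad_eq[OF that] inner_vec_def sum_distrib_left)
  have f: "f = (\<lambda>x. (((v \<bullet> x) * exp (\<eta> \<bullet> x)) / L \<eta> - (c / L \<eta>) * exp (\<eta> \<bullet> x))
       - (((v \<bullet> x) * exp (\<theta> \<bullet> x)) / L \<theta> - (c / L \<theta>) * exp (\<theta> \<bullet> x)))"
    by (rule ext) (simp add: f_def algebra_simps diff_divide_distrib)
  have "integrable \<mu> f" unfolding f using i0 i1 by simp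
  moreover have "integral\<^sup>L \<mu> f = (wlaplace \<mu> (\<lambda>x. v \<bullet> x) \<eta> / L \<eta> - (c / L \<eta>) * L \<eta>)
       - (wlaplace \<mu> (\<lambda>x. v \<bullet> x) \<theta> / L \<theta> - (c / L \<theta>) * L \<theta>)"
    unfolding f wlaplace_def using i0 i1 by simp
  moreover have "\<dots> = 0" using L by (simp add: g[OF t] g[OF n] eq)
  moreover have "0 \<le> f x" for x unfolding fe using L pos by simp
  ultimately have "AE x in \<mu>. f x = 0"
    using integral_nonneg_eq_0_iff_AE[of \<mu> f] by simp
  moreover have "v \<bullet> x = c" if "f x = 0" for x
    using that L zero[of "v \<bullet> x - c"] unfolding fe by auto
  ultimately have "AE x in \<mu>. v \<bullet> x = c" by (auto elim: AE_mp)
  then have "v = 0" using not_AE_hyperplane by blast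
  then show "\<theta> = \<eta>" by (simp add: v_def)
qed

lemma isCont_cumulant_grad: "\<theta> \<in> Theta \<mu> \<Longrightarrow> isCont (cumulant_grad \<mu>) \<theta>"
  using cumulant_grad_has_derivative has_derivative_continuous by blast

lemma variance_fun_grad: "\<theta> \<in> Theta \<mu> \<Longrightarrow> variance_fun \<mu> (cumulant_grad \<mu> \<theta>) = cumulant_hess \<mu> \<theta>"
  by (simp add: variance_fun_def inv_into_f_f[OF inj_on_cumulant_grad])


text \<open>Clearing denominators turns \<open>det (k'' \<theta>) = P (k' \<theta>, 1)\<close> into a polynomial relation between
  the Laplace transform and its derivatives, which extend holomorphically to a strip around
  every line in \<open>Theta \<mu>\<close>.\<close>

lemma det_hess_extend:
  assumes P: "real_polynomial_function P"
    and hom: "\<And>c u. P (c *\<^sub>R u) = c ^ (CARD('n) + 2) * P u"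
    and S: "open S" "S \<noteq> {}" "S \<subseteq> mean_domain \<mu>"
    and eq: "\<And>m. m \<in> S \<Longrightarrow> det (variance_fun \<mu> m) = P (hvec m)"
    and m: "m \<in> mean_domain \<mu>"
  shows "det (variance_fun \<mu> m) = P (hvec m)"
proof -
  define M where "M \<theta> = (\<chi> i j. L2 i j \<theta> * L \<theta> - L1 i \<theta> * L1 j \<theta>)" for \<theta>
  define U :: "real^'n \<Rightarrow> real^'n option" where
    "U \<theta> = (\<chi> i. case i of None \<Rightarrow> L \<theta> | Some j \<Rightarrow> L1 j \<theta>)" for \<theta>
  \<comment> \<open>Equals L^(3n+2) times the difference of the two sides, written without division:
    \<open>det (M \<theta>)\<close> carries L^(2n) and, by homogeneity,
    \<open>P (U \<theta>)\<close> carries L^(n+2).\<close>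
  define \<Phi> where "\<Phi> \<theta> = L \<theta> ^ (CARD('n) + 2) * det (M \<theta>) - (L \<theta>)\<^sup>2 ^ CARD('n) * P (U \<theta>)" for \<theta>
  have iff: "det (variance_fun \<mu> (cumulant_grad \<mu> \<theta>)) = P (hvec (cumulant_grad \<mu> \<theta>)) \<longleftrightarrow> \<Phi> \<theta> = 0"
    if t: "\<theta> \<in> Theta \<mu>" for \<theta>
  proof -
    have L: "L \<theta> \<noteq> 0" using L_pos[OF t] by simp
    have "U \<theta> $ i = (L \<theta> *\<^sub>R hvec (cumulant_grad \<mu> \<theta>)) $ i" for i
      using L by (cases i) (simp_all add: U_def cumulant_grad_eq[OF t])
    then have "U \<theta> = L \<theta> *\<^sub>R hvec (cumulant_grad \<mu> \<theta>)" by (simp add: vec_eq_iff)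
    then have 1: "P (U \<theta>) = L \<theta> ^ (CARD('n) + 2) * P (hvec (cumulant_grad \<mu> \<theta>))" by (simp only: hom)
    have "M \<theta> = (L \<theta>)\<^sup>2 *\<^sub>R cumulant_hess \<mu> \<theta>"
      using L by (simp add: M_def cumulant_hess_eq[OF t])
    then have 2: "det (M \<theta>) = (L \<theta>)\<^sup>2 ^ CARD('n) * det (variance_fun \<mu> (cumulant_grad \<mu> \<theta>))"
      by (simp only: det_scaleR variance_fun_grad[OF t])
    show ?thesis unfolding \<Phi>_def 1 2 using L by (auto simp: field_simps)
  qed
  obtain \<theta> where \<theta>: "\<theta> \<in> Theta \<mu>" "m = cumulant_grad \<mu> \<theta>" using m by (auto simp: mean_domain_def)
  obtain \<theta>\<^sub>0 where \<theta>\<^sub>0: "\<theta>\<^sub>0 \<in> Theta \<mu>" "cumulant_grad \<mu> \<theta>\<^sub>0 \<in> S" using S(2,3) by (auto simp: mean_domain_def)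
  have "open (Theta \<mu> \<inter> cumulant_grad \<mu> -` S)"
    by (rule continuous_open_preimage)
      (auto intro!: continuous_at_imp_continuous_on isCont_cumulant_grad S)
  then obtain e where e: "0 < e" "\<And>t. \<bar>t\<bar> < e \<Longrightarrow> \<theta>\<^sub>0 + t *\<^sub>R (\<theta> - \<theta>\<^sub>0) \<in> Theta \<mu> \<inter> cumulant_grad \<mu> -` S"
    using \<theta>\<^sub>0 open_line[of "Theta \<mu> \<inter> cumulant_grad \<mu> -` S" \<theta>\<^sub>0 "\<theta> - \<theta>\<^sub>0"] by blast
  \<comment> \<open>Complex parameters whose real part keeps the line inside
    \<open>Theta \<mu>\<close>: parameter 0 is the point whose mean lies in S, parameter 1 the
    target.\<close>
  let ?S = "{z. \<theta>\<^sub>0 + Re z *\<^sub>R (\<theta> - \<theta>\<^sub>0) \<in> Theta \<mu>}"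
  have lin: "linear (\<lambda>z. Re z *\<^sub>R (\<theta> - \<theta>\<^sub>0))"
    by (rule linearI) (simp_all add: scaleR_left_distrib)
  have "?S = (\<lambda>z. \<theta>\<^sub>0 + Re z *\<^sub>R (\<theta> - \<theta>\<^sub>0)) -` Theta \<mu>" by auto
  then have "open ?S" by (auto intro!: open_vimage continuous_intros)
  have tr: "x \<in> (\<lambda>y. - a + y) ` T \<longleftrightarrow> a + x \<in> T" for x a :: "real^'n" and T
    by (auto simp: image_iff intro!: bexI[of _ "a + x"])
  have "z \<in> ?S \<longleftrightarrow> Re z *\<^sub>R (\<theta> - \<theta>\<^sub>0) \<in> (\<lambda>x. - \<theta>\<^sub>0 + x) ` Theta \<mu>" for z
    by (simp only: tr mem_Collect_eq)
  then have "?S = (\<lambda>z. Re z *\<^sub>R (\<theta> - \<theta>\<^sub>0)) -` ((\<lambda>x. - \<theta>\<^sub>0 + x) ` Theta \<mu>)" by blast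
  moreover have "convex ((\<lambda>z. Re z *\<^sub>R (\<theta> - \<theta>\<^sub>0)) -` ((\<lambda>x. - \<theta>\<^sub>0 + x) ` Theta \<mu>))"
    by (intro convex_linear_vimage[OF lin] convex_translation convex_Theta sets_borel)
  ultimately have "convex ?S" by (simp only:)
  then have "connected ?S" by (rule convex_connected)
  have h: "hol_ext ?S (\<lambda>t. wlaplace \<mu> p (\<theta>\<^sub>0 + t *\<^sub>R (\<theta> - \<theta>\<^sub>0)))" if "subexp p" for p
    by (rule wlaplace_hol_ext[OF sets_borel that])
  have "hol_ext ?S (\<lambda>t. U (\<theta>\<^sub>0 + t *\<^sub>R (\<theta> - \<theta>\<^sub>0)) $ i)" for i
    by (cases i) (simp_all add: U_def h subexp_1 subexp_nth)
  moreover have "hol_ext ?S (\<lambda>t. M (\<theta>\<^sub>0 + t *\<^sub>R (\<theta> - \<theta>\<^sub>0)) $ i $ j)" for i j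
    by (simp add: M_def h subexp_1 subexp_nth subexp_nth2 hol_ext_diff hol_ext_mult)
  ultimately have "hol_ext ?S (\<lambda>t. \<Phi> (\<theta>\<^sub>0 + t *\<^sub>R (\<theta> - \<theta>\<^sub>0)))"
    unfolding \<Phi>_def
    by (intro hol_ext_diff hol_ext_mult hol_ext_power hol_ext_det hol_ext_polynomial[OF P] h subexp_1)
  then have "\<Phi> (\<theta>\<^sub>0 + 1 *\<^sub>R (\<theta> - \<theta>\<^sub>0)) = 0"
  proof (rule hol_ext_identity[OF _ \<open>open ?S\<close> \<open>connected ?S\<close>, where a = 0 and e = e])
    show "\<Phi> (\<theta>\<^sub>0 + t *\<^sub>R (\<theta> - \<theta>\<^sub>0)) = 0" if "\<bar>t - 0\<bar> < e" for t
      using e(2)[of t] that iff[of "\<theta>\<^sub>0 + t *\<^sub>R (\<theta> - \<theta>\<^sub>0)"] eq by auto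
  qed (use e \<theta> in auto)
  then show ?thesis using iff[OF \<theta>(1)] \<theta>(2) by simp
qed

end

text \<open>The degree matches the power of \<open>denom g m\<close> in \<open>det_pull_fun\<close>.
  The form is tied to the matrix function on its domain only, since the values elsewhere are
  arbitrary.\<close>

definition homog_det :: "'n::finite varfun \<Rightarrow> (real^'n option \<Rightarrow> real) \<Rightarrow> bool" where
  "homog_det W P \<longleftrightarrow> real_polynomial_function P \<and> (\<forall>c u. P (c *\<^sub>R u) = c ^ (CARD('n) + 2) * P u)
     \<and> (\<forall>m\<in>fst W. det (snd W m) = P (hvec m))"

lemma real_polynomial_function_compose_mult:
  fixes g :: "'n::finite gmat"
  assumes "real_polynomial_function P"
  shows "real_polynomial_function (\<lambda>u. P (g *v u))"
  using assms
proof (induction rule: real_polynomial_function.induct)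
  case (linear f)
  then have "bounded_linear (\<lambda>u. f (g *v u))"
    using bounded_linear_compose matrix_vector_mul_bounded_linear by blast
  then show ?case by (rule real_polynomial_function.intros(1))
next
  case (const c)
  show ?case by (rule real_polynomial_function.intros(2))
next
  case (add f f')
  then show ?case by (intro real_polynomial_function.intros(3))
next
  case (mult f f')
  then show ?case by (intro real_polynomial_function.intros(4))
qed

text \<open>On S homogeneity absorbs the power of \<open>denom g m\<close> and leaves
  \<open>P (g *v hvec m)\<close>. As a function of the homogeneous vector this is again a form of
  degree n + 2, so \<open>det_hess_extend\<close> applies to it.\<close>

lemma G_orbit_det:
  fixes W :: "'n::finite varfun"
  assumes W1: "W1 \<in> G_orbit W" and P: "homog_det W P"
  obtains g :: "'n gmat" where "invertible g"
    "\<And>m. m \<in> fst W1 \<Longrightarrow> det (snd W1 m) = P (g *v hvec m) / (det g)\<^sup>2"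
proof -
  obtain g :: "'n gmat" and S where g: "invertible g" and S: "open S" "S \<noteq> {}"
    "S \<subseteq> fst W1 \<inter> pull_dom g (fst W)" "\<And>m. m \<in> S \<Longrightarrow> pull_fun g (snd W) m = snd W1 m"
    using W1 unfolding G_orbit_def by blast
  obtain \<mu> where \<mu>: "nef_generator \<mu>" "fst W1 = mean_domain \<mu>"
    "\<And>m. m \<in> fst W1 \<Longrightarrow> snd W1 m = variance_fun \<mu> m"
    using W1 unfolding G_orbit_def nef_variance_function_def is_variance_function_of_def by blast
  interpret nef \<mu> by unfold_locales (rule \<mu>)
  let ?P = "\<lambda>u. P (g *v u) * (1 / (det g)\<^sup>2)"
  have pol: "real_polynomial_function ?P"
    by (rule real_polynomial_function.intros(4)[OF real_polynomial_function_compose_mult real_polynomial_function.intros(2)])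
      (use P in \<open>simp add: homog_det_def\<close>)
  have hom: "P (c *\<^sub>R u) = c ^ (CARD('n) + 2) * P u" for c u
    using P unfolding homog_det_def by blast
  have dg: "det g \<noteq> 0" using g by (simp add: invertible_det_nz)
  have 1: "det (variance_fun \<mu> m) = ?P (hvec m)" if m: "m \<in> S" for m
  proof -
    have d: "denom g m \<noteq> 0" "moebius g m \<in> fst W" using S(3) m by (auto simp: pull_dom_def)
    have "variance_fun \<mu> m = pull_fun g (snd W) m" using S(3,4) m \<mu>(3) by auto
    then have "det (variance_fun \<mu> m) * (det g)\<^sup>2 = denom g m ^ (CARD('n) + 2) * det (snd W (moebius g m))"
      by (simp only: det_pull_fun[OF g d(1)])
    also have "\<dots> = P (g *v hvec m)"
      using P d unfolding homog_det_def by (simp only: mult_hvec[OF d(1)] hom)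
    finally show ?thesis using dg by (simp add: field_simps)
  qed
  have "det (snd W1 m) = ?P (hvec m)" if m: "m \<in> fst W1" for m
    unfolding \<mu>(3)[OF m]
  proof (rule det_hess_extend[OF pol _ S(1,2)])
    show "P (g *v (c *\<^sub>R u)) * (1 / (det g)\<^sup>2) = c ^ (CARD('n) + 2) * (P (g *v u) * (1 / (det g)\<^sup>2))" for c u
      by (simp only: matrix_vector_mult_scaleR hom mult.assoc)
  qed (use S \<mu> m 1 in auto)
  then show ?thesis using that[OF g] by simp
qed

text \<open>Both determinant formulas hold on all of \<open>fst V\<close>, hence on a common open
  set. Homogeneity spreads their agreement over an open cone, where equality of polynomials becomes
  an identity; substituting \<open>matrix_inv g'\<close> leaves a single matrix h.\<close>

lemma G_orbit_common:
  fixes W W' :: "'n::finite varfun"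
  assumes V: "V \<in> G_orbit W" "V \<in> G_orbit W'" and P: "homog_det W P" "homog_det W' P'"
  obtains h :: "'n gmat" and c :: real where "c \<noteq> 0" "\<And>u. P (h *v u) = c * P' u"
proof -
  obtain g where g: "invertible g" "\<And>m. m \<in> fst V \<Longrightarrow> det (snd V m) = P (g *v hvec m) / (det g)\<^sup>2"
    using G_orbit_det[OF V(1) P(1)] by blast
  obtain g' where g': "invertible g'" "\<And>m. m \<in> fst V \<Longrightarrow> det (snd V m) = P' (g' *v hvec m) / (det g')\<^sup>2"
    using G_orbit_det[OF V(2) P(2)] by blast
  obtain S where S: "open S" "S \<noteq> {}" "S \<subseteq> fst V" using V(1) unfolding G_orbit_def by blast
  define c where "c = (det g)\<^sup>2 / (det g')\<^sup>2"
  have dg: "det g \<noteq> 0" "det g' \<noteq> 0" using g g' by (auto simp: invertible_det_nz)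
  define Q where "Q u = P (g *v u) - c * P' (g' *v u)" for u
  have pol: "real_polynomial_function Q"
    unfolding Q_def using P unfolding homog_det_def
    by (auto intro!: real_polynomial_function_diff[OF real_polynomial_function_compose_mult
        real_polynomial_function.intros(4)[OF real_polynomial_function.intros(2) real_polynomial_function_compose_mult]])
  have hom: "Q (s *\<^sub>R u) = s ^ (CARD('n) + 2) * Q u" for s u
  proof -
    have "P (s *\<^sub>R x) = s ^ (CARD('n) + 2) * P x" "P' (s *\<^sub>R x) = s ^ (CARD('n) + 2) * P' x" for x
      using P unfolding homog_det_def by blast+
    then show ?thesis unfolding Q_def by (simp only: matrix_vector_mult_scaleR) (simp add: algebra_simps)
  qed
  have Q0: "Q (hvec m) = 0" if "m \<in> S" for m
  proof -
    have "m \<in> fst V" using that S by blast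
    then have "P (g *v hvec m) / (det g)\<^sup>2 = P' (g' *v hvec m) / (det g')\<^sup>2" using g(2) g'(2) by metis
    then show ?thesis using dg by (simp add: Q_def c_def field_simps)
  qed
  let ?p = "\<lambda>u :: real^'n option. \<chi> i. u $ Some i / u $ None"
  \<comment> \<open>The vectors \<open>hvec m\<close> lie in an affine hyperplane. Taking all their
    nonzero multiples, by way of the continuous dehomogenization \<open>?p\<close>, makes an open
    set of the full space.\<close>
  let ?C = "{u :: real^'n option. u $ None \<noteq> 0} \<inter> ?p -` S"
  have "open ?C"
  proof (rule continuous_open_preimage)
    show "open {u :: real^'n option. u $ None \<noteq> 0}"
      by (intro open_Collect_neq continuous_intros)
    show "continuous_on {u :: real^'n option. u $ None \<noteq> 0} ?p"
      by (auto intro!: continuous_intros)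
  qed (rule S)
  moreover have "?C \<noteq> {}"
  proof -
    obtain m where "m \<in> S" using S by blast
    then have "hvec m \<in> ?C" by (simp add: vec_lambda_unique)
    then show ?thesis by blast
  qed
  moreover have "Q u = 0" if "u \<in> ?C" for u
  proof -
    have "u $ i = (u $ None *\<^sub>R hvec (?p u)) $ i" for i using that by (cases i) auto
    then have "u = u $ None *\<^sub>R hvec (?p u)" by (intro vec_eq_iff[THEN iffD2] allI)
    then have "Q u = Q (u $ None *\<^sub>R hvec (?p u))" by (rule arg_cong)
    also have "\<dots> = (u $ None) ^ (CARD('n) + 2) * Q (hvec (?p u))" by (rule hom)
    finally have "Q u = (u $ None) ^ (CARD('n) + 2) * Q (hvec (?p u))" .
    then show ?thesis using Q0[of "?p u"] that by simp
  qed
  ultimately have Q: "Q u = 0" for u using polynomial_eq_0[OF pol] by blast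
  have "P ((g ** matrix_inv g') *v u) = c * P' u" for u
  proof -
    have "g' *v (matrix_inv g' *v u) = u"
      by (simp add: matrix_vector_mul_assoc matrix_inv_works[OF g'(1)])
    then show ?thesis using Q[of "matrix_inv g' *v u"] by (simp add: Q_def matrix_vector_mul_assoc[symmetric])
  qed
  moreover have "c \<noteq> 0" using dg by (simp add: c_def)
  ultimately show ?thesis using that by blast
qed


section \<open>Distinguishing the orbits\<close>

lemma pos_less_iff: "pos i < pos j \<longleftrightarrow> i < j" for i j :: "'n::{finite,linorder}"
proof -
  have "pos i < pos j" if "i < j" for i j :: 'n
    unfolding pos_def by (rule psubset_card_mono) (use that in \<open>auto simp: psubset_eq set_eq_iff intro!: exI[of _ j]\<close>)
  then show ?thesis by (metis less_asym' linorder_cases)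
qed

lemma inj_pos: "inj (pos :: 'n::{finite,linorder} \<Rightarrow> nat)"
  by (metis injI linorder_cases nat_less_le pos_less_iff)

lemma range_pos: "range (pos :: 'n::{finite,linorder} \<Rightarrow> nat) = {1..CARD('n)}"
proof (rule card_subset_eq)
  have "1 \<le> pos i \<and> pos i \<le> CARD('n)" for i :: 'n
    unfolding pos_def by (auto intro: card_mono simp: Suc_le_eq card_gt_0_iff)
  then show "range (pos :: 'n \<Rightarrow> nat) \<subseteq> {1..CARD('n)}" by auto
qed (simp_all add: card_image[OF inj_pos])

lemma pos_ge_1: "1 \<le> pos i"
  using range_pos by (metis atLeastAtMost_iff rangeI)

lemma pos_surj: "1 \<le> j \<Longrightarrow> j \<le> CARD('n) \<Longrightarrow> \<exists>i :: 'n::{finite,linorder}. pos i = j"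
  using range_pos[where 'n = 'n] by (metis atLeastAtMost_iff imageE)

lemma card_pos_le: "k \<le> CARD('n) \<Longrightarrow> card {i :: 'n::{finite,linorder}. pos i \<le> k} = k"
proof -
  assume k: "k \<le> CARD('n)"
  have "pos ` {i :: 'n. pos i \<le> k} = {1..k}"
    using pos_surj[where 'n = 'n] pos_ge_1 k by (force simp: image_iff)
  then have "card (pos ` {i :: 'n. pos i \<le> k}) = k" by simp
  then show ?thesis by (simp add: card_image[OF inj_on_subset[OF inj_pos subset_UNIV]])
qed

section \<open>The determinants as homogeneous forms\<close>

definition P_I :: "nat \<Rightarrow> real^'n::{finite,linorder} option \<Rightarrow> real" where
  "P_I k u = u $ None ^ (CARD('n) + 2 - k) * (\<Prod>i | pos i \<le> k. u $ Some i)"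

text \<open>The hyperplane at infinity and the n + 1 facets of the simplex, each with multiplicity
  one.\<close>

definition P_II :: "real^'n::{finite,linorder} option \<Rightarrow> real" where
  "P_II u = u $ None * (\<Prod>i\<in>UNIV. u $ Some i) * (u $ None - (\<Sum>i\<in>UNIV. u $ Some i))"

text \<open>The last factor is a sum of squares of two independent linear forms, hence not a product
  of real linear forms.\<close>

definition P_V :: "real^'n::{finite,linorder} option \<Rightarrow> real" where
  "P_V u = u $ None * (\<Prod>i\<in>UNIV - {last_ix}. u $ Some i)
     * ((u $ None + (\<Sum>i\<in>UNIV - {last_ix}. u $ Some i))\<^sup>2 + (u $ Some last_ix)\<^sup>2)"

lemma real_polynomial_function_nth: "real_polynomial_function (\<lambda>u :: real^'n::finite. u $ i)"
  by (rule real_polynomial_function.intros(1)) (rule bounded_linear_vec_nth)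

lemmas pol_intros = real_polynomial_function.intros(2-4) real_polynomial_function_nth
  real_polynomial_function_diff real_polynomial_function_sum real_polynomial_function_prod
  real_polynomial_function_power

text \<open>The determinant has degree k in m, so the homogenizing coordinate fills up the degree
  with the power n + 2 - k, which is at least 2.\<close>

lemma homog_det_I:
  assumes k: "k \<le> CARD('n)"
  shows "homog_det (V_I k :: 'n::{finite,linorder} varfun) (P_I k)"
  unfolding homog_det_def
proof (intro conjI allI ballI)
  show "real_polynomial_function (P_I k :: real^'n option \<Rightarrow> real)"
    unfolding P_I_def[abs_def] by (intro pol_intros) auto
  fix c :: real and u :: "real^'n option"
  have "CARD('n) + 2 = (CARD('n) + 2 - k) + k" using k by simp
  then have "c ^ (CARD('n) + 2) = c ^ (CARD('n) + 2 - k) * c ^ k" by (simp only: power_add[symmetric])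
  then show "P_I k (c *\<^sub>R u) = c ^ (CARD('n) + 2) * P_I k u"
    using card_pos_le[OF k] by (simp only: P_I_def vector_scaleR_component real_scaleR_def
      power_mult_distrib prod.distrib prod_constant mult_ac)
next
  fix m :: "(real, 'n) vec"
  have "det (snd (V_I k) m) = (\<Prod>i\<in>UNIV. if pos i \<le> k then m $ i else 1)"
    by (subst det_diagonal) (simp_all add: V_I_def diag_def)
  then show "det (snd (V_I k) m) = P_I k (hvec m)"
    by (simp add: P_I_def prod.If_cases)
qed

lemma fst_V_II:
  "fst (V_II :: 'n::{finite,linorder} varfun) = {m. (\<forall>i. 0 < m $ i) \<and> (\<Sum>i\<in>UNIV. m $ i) < 1}"
proof -
  have B: "range (\<lambda>i. axis i 1) = (Basis :: (real, 'n) vec set)"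
    by (auto simp: Basis_vec_def)
  have inj: "inj (\<lambda>i :: 'n. axis i (1::real))"
    by (auto simp: inj_def axis_eq_axis)
  show ?thesis
    unfolding V_II_def fst_conv B interior_std_simplex
    by (simp add: B[symmetric] sum.reindex[OF inj] inner_axis)
qed

text \<open>Rank-one update with s = -1: on the open simplex the diagonal is nonzero, and the sum of
  m_i^2 / m_i collapses to the sum of the m_i.\<close>

lemma homog_det_II: "homog_det (V_II :: 'n::{finite,linorder} varfun) P_II"
  unfolding homog_det_def
proof (intro conjI allI ballI)
  show "real_polynomial_function (P_II :: real^'n option \<Rightarrow> real)"
    unfolding P_II_def[abs_def] by (intro pol_intros) auto
  show "P_II (c *\<^sub>R u) = c ^ (CARD('n) + 2) * P_II u" for c and u :: "real^'n option"
    by (simp add: P_II_def prod.distrib sum_distrib_left[symmetric] right_diff_distrib[symmetric])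
  fix m :: "(real, 'n) vec" assume m: "m \<in> fst V_II"
  then have pos: "m $ i \<noteq> 0" for i by (auto simp: fst_V_II less_le)
  have "snd V_II m = (- 1) *\<^sub>R outer m + diag (\<lambda>i. m $ i)" by (simp add: V_II_def)
  then have "det (snd V_II m) = (\<Prod>i\<in>UNIV. m $ i) * (1 + (- 1) * (\<Sum>i\<in>UNIV. (m $ i)\<^sup>2 / m $ i))"
    by (simp only: det_diag_plus_outer[OF pos])
  also have "(\<Sum>i\<in>UNIV. (m $ i)\<^sup>2 / m $ i) = (\<Sum>i\<in>UNIV. m $ i)"
    using pos by (simp add: power2_eq_square)
  finally show "det (snd V_II m) = P_II (hvec m)" by (simp add: P_II_def)
qed

text \<open>With q the last diagonal entry, the quotients m_i^2 / m_i of the other coordinates add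
  up to q - 1. The rank-one update thus contributes q + m_last^2 / q, and the factor q of the
  diagonal turns this into q^2 + m_last^2.\<close>

lemma homog_det_V: "homog_det (V_V :: 'n::{finite,linorder} varfun) P_V"
  unfolding homog_det_def
proof (intro conjI allI ballI)
  let ?J = "UNIV - {last_ix :: 'n}"
  show "real_polynomial_function (P_V :: real^'n option \<Rightarrow> real)"
    unfolding P_V_def[abs_def] by (intro pol_intros) auto
  have card: "Suc (card ?J) = CARD('n)" by (simp add: card_Suc_Diff1)
  show "P_V (c *\<^sub>R u) = c ^ (CARD('n) + 2) * P_V u" for c and u :: "real^'n option"
  proof -
    have 1: "(c * u $ None + (\<Sum>i\<in>?J. c * u $ Some i))\<^sup>2 + (c * u $ Some last_ix)\<^sup>2
      = c\<^sup>2 * ((u $ None + (\<Sum>i\<in>?J. u $ Some i))\<^sup>2 + (u $ Some last_ix)\<^sup>2)"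
      by (simp add: sum_distrib_left[symmetric] distrib_left[symmetric] power_mult_distrib)
    have 2: "c ^ (CARD('n) + 2) = c * c ^ card ?J * c\<^sup>2"
      by (simp only: card[symmetric] power_add power_Suc)
    show ?thesis
      by (simp only: P_V_def vector_scaleR_component real_scaleR_def 1 2 prod.distrib prod_constant mult_ac)
  qed
  fix m :: "(real, 'n) vec" assume "m \<in> fst V_V"
  then have m: "0 < m $ i" if "i \<noteq> last_ix" for i using that by (auto simp: V_V_def)
  define q where "q = 1 + (\<Sum>j\<in>?J. m $ j)"
  let ?d = "\<lambda>i. if i = last_ix then q else m $ i"
  have "0 < q" unfolding q_def using m by (intro add_pos_nonneg sum_nonneg) (auto simp: less_imp_le)
  then have d: "?d i \<noteq> 0" for i using m[of i] by auto
  have split: "(\<Sum>i\<in>UNIV. (m $ i)\<^sup>2 / ?d i) = (m $ last_ix)\<^sup>2 / q + (\<Sum>i\<in>?J. m $ i)"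
    by (subst sum.remove[of _ last_ix]) (auto intro!: sum.cong simp: power2_eq_square)
  have split': "(\<Prod>i\<in>UNIV. ?d i) = q * (\<Prod>i\<in>?J. m $ i)"
    by (subst prod.remove[of _ last_ix]) (auto intro!: prod.cong)
  have "snd V_V m = 1 *\<^sub>R outer m + diag ?d" unfolding q_def by (simp add: V_V_def)
  then have "det (snd V_V m) = (q * (\<Prod>i\<in>?J. m $ i)) * (1 + 1 * ((m $ last_ix)\<^sup>2 / q + (\<Sum>i\<in>?J. m $ i)))"
    by (simp only: det_diag_plus_outer[OF d] split split')
  also have "\<dots> = (\<Prod>i\<in>?J. m $ i) * (q * (q + (m $ last_ix)\<^sup>2 / q))"
  proof -
    have "1 + 1 * ((m $ last_ix)\<^sup>2 / q + (\<Sum>i\<in>?J. m $ i)) = q + (m $ last_ix)\<^sup>2 / q"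
      by (simp add: q_def)
    then show ?thesis by (simp only: mult_ac)
  qed
  also have "q * (q + (m $ last_ix)\<^sup>2 / q) = q\<^sup>2 + (m $ last_ix)\<^sup>2"
    using \<open>0 < q\<close> by (simp add: distrib_left power2_eq_square)
  finally show "det (snd V_V m) = P_V (hvec m)" by (simp add: P_V_def q_def)
qed

section \<open>Products of powers of linear forms, restricted to lines\<close>

definition linear_product :: "'i set \<Rightarrow> (real^'n \<Rightarrow> real) \<Rightarrow> bool" where
  "linear_product I P \<longleftrightarrow> finite I \<and>
     (\<exists>a e. (\<forall>i\<in>I. 0 < e i) \<and> (\<forall>u. P u = (\<Prod>i\<in>I. (a i \<bullet> u) ^ (e i :: nat))))"

lemma linear_product_line:
  fixes P :: "real^'n::finite \<Rightarrow> real"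
  assumes "linear_product I P"
  obtains \<alpha> \<beta> e where "\<And>i. i \<in> I \<Longrightarrow> 0 < e i"
    "\<And>t. P (h *v (x + t *\<^sub>R y)) = (\<Prod>i\<in>I. (\<alpha> i + t * \<beta> i) ^ (e i :: nat))"
proof -
  obtain a e where e: "\<And>i. i \<in> I \<Longrightarrow> 0 < e i" and P: "\<And>u. P u = (\<Prod>i\<in>I. (a i \<bullet> u) ^ (e i :: nat))"
    using assms unfolding linear_product_def by blast
  show ?thesis
    by (rule that[of e "\<lambda>i. a i \<bullet> (h *v x)" "\<lambda>i. a i \<bullet> (h *v y)"])
      (simp_all add: e P matrix_vector_right_distrib inner_add_right matrix_vector_mult_scaleR)
qed

text \<open>A factor that vanishes at a point of the line but not at s has nonzero slope, hence
  exactly one zero. Multiplicities sit in the exponents, so \<open>card I\<close> bounds the number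
  of distinct zeros.\<close>

lemma linear_product_roots:
  fixes P :: "real^'n::finite \<Rightarrow> real"
  assumes P: "linear_product I P" and c: "c \<noteq> 0" "\<And>u. P (h *v u) = c * P' u"
    and T: "\<And>t. t \<in> T \<Longrightarrow> P' (x + t *\<^sub>R y) = 0" and s: "P' (x + s *\<^sub>R y) \<noteq> 0"
  shows "card T \<le> card I"
proof -
  have fin: "finite I" using P by (simp add: linear_product_def)
  obtain \<alpha> \<beta> e where e: "\<And>i. i \<in> I \<Longrightarrow> 0 < e i"
    and L: "\<And>t. P (h *v (x + t *\<^sub>R y)) = (\<Prod>i\<in>I. (\<alpha> i + t * \<beta> i) ^ (e i :: nat))"
    using linear_product_line[OF P] by metis
  have "T \<subseteq> (\<lambda>i. - \<alpha> i / \<beta> i) ` I"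
  proof
    fix t assume "t \<in> T"
    then have "(\<Prod>i\<in>I. (\<alpha> i + t * \<beta> i) ^ e i) = 0" using T c(2)[of "x + t *\<^sub>R y"] L[of t] by simp
    then obtain i where i: "i \<in> I" "\<alpha> i + t * \<beta> i = 0" using fin by (auto simp: prod_zero_iff)
    have "(\<Prod>i\<in>I. (\<alpha> i + s * \<beta> i) ^ e i) \<noteq> 0" using s c(1) c(2)[of "x + s *\<^sub>R y"] L[of s] by simp
    then have "\<alpha> i + s * \<beta> i \<noteq> 0" using i(1) fin e by (auto simp: prod_zero_iff)
    then have "\<beta> i \<noteq> 0" using i(2) by auto
    then have "t = - \<alpha> i / \<beta> i" using i(2) by (simp add: field_simps)
    then show "t \<in> (\<lambda>i. - \<alpha> i / \<beta> i) ` I" using i(1) by blast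
  qed
  then show ?thesis using fin surj_card_le by blast
qed

text \<open>An affine factor with nonzero slope has a real zero. On a line without zeros every
  factor, and so the product, is therefore constant.\<close>

lemma linear_product_nonvanishing:
  fixes P :: "real^'n::finite \<Rightarrow> real"
  assumes P: "linear_product I P" and c: "c \<noteq> 0" "\<And>u. P (h *v u) = c * P' u"
    and nz: "\<And>t. P' (x + t *\<^sub>R y) \<noteq> 0"
  shows "P' (x + s *\<^sub>R y) = P' (x + t *\<^sub>R y)"
proof -
  have fin: "finite I" using P by (simp add: linear_product_def)
  obtain \<alpha> \<beta> e where e: "\<And>i. i \<in> I \<Longrightarrow> 0 < e i"
    and L: "\<And>t. P (h *v (x + t *\<^sub>R y)) = (\<Prod>i\<in>I. (\<alpha> i + t * \<beta> i) ^ (e i :: nat))"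
    using linear_product_line[OF P] by metis
  have "\<beta> i = 0" if "i \<in> I" for i
  proof (rule ccontr)
    assume "\<beta> i \<noteq> 0"
    then have "\<alpha> i + (- \<alpha> i / \<beta> i) * \<beta> i = 0" by simp
    then have "(\<Prod>j\<in>I. (\<alpha> j + (- \<alpha> i / \<beta> i) * \<beta> j) ^ e j) = 0"
      using fin e[OF \<open>i \<in> I\<close>] \<open>i \<in> I\<close> \<open>\<alpha> i + (- \<alpha> i / \<beta> i) * \<beta> i = 0\<close>
      by (intro prod_zero) (auto intro!: bexI[of _ i])
    then show False using nz[of "- \<alpha> i / \<beta> i"] c(1) c(2)[of "x + (- \<alpha> i / \<beta> i) *\<^sub>R y"] L[of "- \<alpha> i / \<beta> i"] by simp
  qed
  then have "c * P' (x + s *\<^sub>R y) = c * P' (x + t *\<^sub>R y)"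
    unfolding c(2)[symmetric] L by (intro prod.cong) auto
  then show ?thesis using c(1) by simp
qed

lemma linear_product_I:
  assumes k: "k \<le> CARD('n)"
  shows "linear_product (insert None (Some ` {i :: 'n. pos i \<le> k})) (P_I k :: real^'n::{finite,linorder} option \<Rightarrow> real)"
    (is "linear_product ?I _")
  unfolding linear_product_def
proof (intro conjI exI ballI allI)
  let ?e = "\<lambda>i :: 'n option. case i of None \<Rightarrow> CARD('n) + 2 - k | Some _ \<Rightarrow> 1"
  show "0 < ?e i" for i using k by (auto split: option.split)
  show "P_I k u = (\<Prod>i\<in>?I. (axis i 1 \<bullet> u) ^ ?e i)" for u :: "real^'n option"
    by (subst prod.insert) (auto simp: P_I_def prod.reindex inner_axis')
qed simp

text \<open>The double option type supplies exactly n + 2 indices: the outer \<open>None\<close>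
  stands for the slanted facet, the others for the n + 1 homogeneous coordinates.\<close>

lemma linear_product_II:
  "linear_product (UNIV :: 'n option option set) (P_II :: real^'n::{finite,linorder} option \<Rightarrow> real)"
  unfolding linear_product_def
proof (intro conjI exI ballI allI)
  let ?a = "\<lambda>i :: 'n option option. case i of None \<Rightarrow> axis None 1 - (\<Sum>i\<in>UNIV. axis (Some i) 1)
     | Some j \<Rightarrow> axis j (1::real)"
  show "0 < Suc 0" by simp
  show "P_II u = (\<Prod>i\<in>UNIV. (?a i \<bullet> u) ^ Suc 0)" for u :: "real^'n option"
    by (simp add: prod_option inner_axis' inner_diff_left inner_sum_left P_II_def mult_ac)
qed simp

section \<open>Lines on which the forms differ\<close>

lemma line_I:
  assumes k: "k \<le> CARD('n)"
  obtains x y :: "real^'n::{finite,linorder} option" and T s where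
    "card T = k + 1" "\<And>t. t \<in> T \<Longrightarrow> P_I k (x + t *\<^sub>R y) = 0" "P_I k (x + s *\<^sub>R y) \<noteq> 0"
proof -
  \<comment> \<open>The zeros are spread out: the factor \<open>u $ Some i\<close> vanishes at t =
    \<open>pos i\<close> and the homogenizing one at t = 0, which gives the k + 1 zeros 0, ...,
    k.\<close>
  define x :: "real^'n option" where "x = (\<chi> i. case i of None \<Rightarrow> 0 | Some j \<Rightarrow> - real (pos j))"
  define y :: "real^'n option" where "y = (\<chi> i. 1)"
  have P: "P_I k (x + t *\<^sub>R y) = t ^ (CARD('n) + 2 - k) * (\<Prod>i | pos (i::'n) \<le> k. t - real (pos i))" for t
    by (simp add: P_I_def x_def y_def)
  have "card (real ` {0..k}) = k + 1" by (simp add: card_image)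
  moreover have "P_I k (x + t *\<^sub>R y) = 0" if "t \<in> real ` {0..k}" for t
  proof -
    from that obtain j where j: "j \<le> k" "t = real j" by auto
    show ?thesis
    proof (cases "j = 0")
      case True
      then show ?thesis unfolding P using k j by simp
    next
      case False
      then obtain i :: 'n where "pos i = j" using pos_surj[of j, where 'n = 'n] j k by auto
      then show ?thesis unfolding P using j by (auto simp: prod_zero_iff)
    qed
  qed
  moreover have "P_I k (x + (- 1) *\<^sub>R y) \<noteq> 0"
    unfolding P by (auto simp: prod_zero_iff)
  ultimately show ?thesis using that by blast
qed

lemma line_II:
  obtains x y :: "real^'n::{finite,linorder} option" and T s where
    "card T = CARD('n) + 2" "\<And>t. t \<in> T \<Longrightarrow> P_II (x + t *\<^sub>R y) = 0" "P_II (x + s *\<^sub>R y) \<noteq> 0"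
proof -
  let ?n = "CARD('n)"
  define x :: "real^'n option" where "x = (\<chi> i. case i of None \<Rightarrow> 0 | Some j \<Rightarrow> - real (pos j))"
  \<comment> \<open>The slope n + 1 exceeds the total slope n of the other coordinates by one, so
    the slanted facet becomes t + \<sigma>; its zero is negative and thus differs from 0, ...,
    n.\<close>
  define y :: "real^'n option" where "y = (\<chi> i. case i of None \<Rightarrow> real ?n + 1 | Some j \<Rightarrow> 1)"
  define \<sigma> where "\<sigma> = (\<Sum>i\<in>(UNIV :: 'n set). real (pos i))"
  have "0 < real (pos i)" for i :: 'n using pos_ge_1[of i] by simp
  then have \<sigma>: "0 < \<sigma>" unfolding \<sigma>_def by (intro sum_pos) auto
  have P: "P_II (x + t *\<^sub>R y) = t * (real ?n + 1) * (\<Prod>i\<in>(UNIV :: 'n set). t - real (pos i)) * (t + \<sigma>)" for t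
    by (simp add: P_II_def x_def y_def sum_subtractf \<sigma>_def algebra_simps)
  let ?T = "insert (- \<sigma>) (real ` {0..?n})"
  have "- \<sigma> \<notin> real ` {0..?n}" using \<sigma> by auto
  then have "card ?T = ?n + 2" by (simp add: card_image)
  moreover have "P_II (x + t *\<^sub>R y) = 0" if "t \<in> ?T" for t
  proof -
    consider "t = - \<sigma>" | "t = 0" | j where "1 \<le> j" "j \<le> ?n" "t = real j"
      using \<open>t \<in> ?T\<close> by (force simp: Suc_le_eq)
    then show ?thesis
    proof cases
      case 1
      then show ?thesis unfolding P by simp
    next
      case 2
      then show ?thesis unfolding P by simp
    next
      case (3 j)
      then obtain i :: 'n where "pos i = j" using pos_surj[of j, where 'n = 'n] by auto
      then show ?thesis unfolding P using 3 by (auto simp: prod_zero_iff)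
    qed
  qed
  moreover have "P_II (x + (- \<sigma> - 1) *\<^sub>R y) \<noteq> 0"
  proof -
    have "- \<sigma> - 1 - real (pos i) \<noteq> 0" for i :: 'n using \<sigma> by linarith
    then show ?thesis using \<sigma> by (simp add: P prod_zero_iff)
  qed
  ultimately show ?thesis using that by blast
qed

lemma line_V:
  obtains x y :: "real^'n::{finite,linorder} option" where
    "\<And>t. P_V (x + t *\<^sub>R y) \<noteq> 0" "P_V (x + 0 *\<^sub>R y) \<noteq> P_V (x + 1 *\<^sub>R y)"
proof -
  \<comment> \<open>Only the last coordinate moves and the others stay at 1: the linear factors are
    constantly 1, and the quadratic factor is q^2 + t^2 with q = n.\<close>
  define x :: "real^'n option" where "x = (\<chi> i. if i = Some last_ix then 0 else 1)"
  define y :: "real^'n option" where "y = (\<chi> i. if i = Some last_ix then 1 else 0)"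
  define q where "q = 1 + real (card (UNIV - {last_ix :: 'n}))"
  have "0 < q" unfolding q_def by linarith
  have P: "P_V (x + t *\<^sub>R y) = q\<^sup>2 + t\<^sup>2" for t
  proof -
    have "(\<Sum>i\<in>UNIV - {last_ix :: 'n}. (x + t *\<^sub>R y) $ Some i) = (\<Sum>i\<in>UNIV - {last_ix :: 'n}. 1)"
      "(\<Prod>i\<in>UNIV - {last_ix :: 'n}. (x + t *\<^sub>R y) $ Some i) = (\<Prod>i\<in>UNIV - {last_ix :: 'n}. 1)"
      by (intro sum.cong prod.cong; simp add: x_def y_def)+
    then show ?thesis by (simp only: P_V_def) (simp add: x_def y_def q_def)
  qed
  have "q\<^sup>2 + t\<^sup>2 \<noteq> 0" for t using \<open>0 < q\<close> by (simp add: sum_power2_eq_zero_iff)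
  then have "\<And>t. P_V (x + t *\<^sub>R y) \<noteq> 0" by (simp only: P) simp
  then show ?thesis using that[of x y] by (simp only: P) simp
qed

section \<open>Pairwise disjointness\<close>

lemma disjoint_I_I:
  assumes "k < l" "l \<le> CARD('n)"
  shows "G_orbit (V_I k :: 'n::{finite,linorder} varfun) \<inter> G_orbit (V_I l) = {}"
proof (rule ccontr)
  have k: "k \<le> CARD('n)" using assms by simp
  assume "\<not> ?thesis"
  then obtain V where V: "V \<in> G_orbit (V_I k :: 'n varfun)" "V \<in> G_orbit (V_I l)" by blast
  obtain h :: "'n gmat" and c where h: "c \<noteq> 0" "\<And>u. P_I k (h *v u) = c * P_I l u"
    using G_orbit_common[OF V homog_det_I[OF k] homog_det_I[OF assms(2)]] by blast
  obtain x y :: "real^'n option" and T s where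
    "card T = l + 1" "\<And>t. t \<in> T \<Longrightarrow> P_I l (x + t *\<^sub>R y) = 0" "P_I l (x + s *\<^sub>R y) \<noteq> 0"
    using line_I[OF assms(2)] by metis
  \<comment> \<open>The k + 1 factors of \<open>P_I k\<close> would have to produce the l + 1 zeros
    of \<open>P_I l\<close>; k < l decides which of the two forms receives the substitution
    h.\<close>
  then have "l + 1 \<le> card (insert None (Some ` {i :: 'n. pos i \<le> k}))"
    using linear_product_roots[OF linear_product_I[OF k] h, of T x y s] by simp
  then show False using assms by (simp add: card_image card_pos_le[OF k])
qed

lemma disjoint_I_II:
  assumes k: "k \<le> CARD('n)"
  shows "G_orbit (V_I k :: 'n::{finite,linorder} varfun) \<inter> G_orbit V_II = {}"
proof (rule ccontr)
  assume "\<not> ?thesis"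
  then obtain V where V: "V \<in> G_orbit (V_I k :: 'n varfun)" "V \<in> G_orbit V_II" by blast
  obtain h :: "'n gmat" and c where h: "c \<noteq> 0" "\<And>u. P_I k (h *v u) = c * P_II u"
    using G_orbit_common[OF V homog_det_I[OF k] homog_det_II] by blast
  obtain x y :: "real^'n option" and T s where
    "card T = CARD('n) + 2" "\<And>t. t \<in> T \<Longrightarrow> P_II (x + t *\<^sub>R y) = 0" "P_II (x + s *\<^sub>R y) \<noteq> 0"
    using line_II by metis
  then have "CARD('n) + 2 \<le> card (insert None (Some ` {i :: 'n. pos i \<le> k}))"
    using linear_product_roots[OF linear_product_I[OF k] h, of T x y s] by simp
  then show False using k by (simp add: card_image card_pos_le[OF k])
qed

text \<open>Covers types I and II together: all that matters is that the form of W splits into real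
  linear factors.\<close>

lemma disjoint_V:
  fixes W :: "'n::{finite,linorder} varfun"
  assumes "homog_det W P" "linear_product I P"
  shows "G_orbit W \<inter> G_orbit V_V = {}"
proof (rule ccontr)
  assume "\<not> ?thesis"
  then obtain V where V: "V \<in> G_orbit W" "V \<in> G_orbit V_V" by blast
  obtain h :: "'n gmat" and c where h: "c \<noteq> 0" "\<And>u. P (h *v u) = c * P_V u"
    using G_orbit_common[OF V assms(1) homog_det_V] by blast
  obtain x y :: "real^'n option" where
    "\<And>t. P_V (x + t *\<^sub>R y) \<noteq> 0" "P_V (x + 0 *\<^sub>R y) \<noteq> P_V (x + 1 *\<^sub>R y)"
    using line_V by blast
  then show False using linear_product_nonvanishing[OF assms(2) h, of x y 0 1] by blast
qed

lemma disjoint_orbits: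
  "disjoint_family_on
     (\<lambda>i. G_orbit ((map V_I [0..<CARD('n) + 1] @ [V_II, V_V :: 'n::{finite,linorder} varfun]) ! i))
     {..<CARD('n) + 3}"
proof -
  let ?n = "CARD('n)"
  let ?W = "\<lambda>i. (map V_I [0..<?n + 1] @ [V_II, V_V :: 'n varfun]) ! i"
  have W: "?W i = V_I i" if "i \<le> ?n" for i
    using that by (simp only: nth_append length_map length_upt nth_map nth_upt) simp
  have W': "?W (?n + 1) = V_II" "?W (?n + 2) = V_V"
    by (simp_all only: nth_append length_map length_upt) simp_all
  have less: "G_orbit (?W i) \<inter> G_orbit (?W j) = {}" if "i < j" "j < ?n + 3" for i j
  proof -
    have "j \<le> ?n \<or> i \<le> ?n \<and> j = ?n + 1 \<or> i \<le> ?n \<and> j = ?n + 2 \<or> i = ?n + 1 \<and> j = ?n + 2"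
      using that by arith
    then consider "j \<le> ?n" | "i \<le> ?n" "j = ?n + 1" | "i \<le> ?n" "j = ?n + 2" | "i = ?n + 1" "j = ?n + 2"
      by blast
    then show ?thesis
    proof cases
      case 1
      then show ?thesis using that disjoint_I_I by (simp only: W)
    next
      case 2
      then show ?thesis using disjoint_I_II by (simp only: W W')
    next
      case 3
      then show ?thesis using disjoint_V[OF homog_det_I linear_product_I] by (simp only: W W')
    next
      case 4
      then show ?thesis using disjoint_V[OF homog_det_II linear_product_II] by (simp only: W')
    qed
  qed
  show ?thesis
    unfolding disjoint_family_on_def
  proof (intro ballI impI)
    fix i j assume "i \<in> {..<?n + 3}" "j \<in> {..<?n + 3}" "i \<noteq> j"
    then show "G_orbit (?W i) \<inter> G_orbit (?W j) = {}"
      using less[of i j] less[of j i] by (cases "i < j") (auto simp only: lessThan_iff Int_commute nat_neq_iff)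
  qed
qed


section \<open>Natural exponential families with explicit Laplace transform\<close>

text \<open>Reduces the definition to calculus with an explicit cumulant K, where \<psi> inverts the
  gradient. Nondegeneracy comes along: if a \<bullet> x = b almost everywhere, then K (\<theta> + t
  a) = K \<theta> + t b, so the gradients at \<theta> and \<theta> + t a agree, against
  injectivity.\<close>

lemma nef_variance_functionI:
  fixes W :: "'n::finite varfun" and K :: "real^'n \<Rightarrow> real"
  assumes s [measurable_cong]: "sets \<mu> = sets borel"
    and U: "open U" "U \<noteq> {}"
    and fin: "\<And>\<theta>. \<theta> \<in> U \<Longrightarrow> laplace_tr \<mu> \<theta> = ennreal (exp (K \<theta>))"
    and inf: "\<And>\<theta>. \<theta> \<notin> U \<Longrightarrow> laplace_tr \<mu> \<theta> = \<infinity>"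
    and K: "\<And>\<theta>. \<theta> \<in> U \<Longrightarrow> GDERIV K \<theta> :> K' \<theta>"
    and K': "\<And>\<theta>. \<theta> \<in> U \<Longrightarrow> (K' has_derivative (\<lambda>h. K'' \<theta> *v h)) (at \<theta>)"
    and \<psi>: "\<And>\<theta>. \<theta> \<in> U \<Longrightarrow> K' \<theta> \<in> fst W \<and> \<psi> (K' \<theta>) = \<theta>"
    and M: "\<And>m. m \<in> fst W \<Longrightarrow> \<psi> m \<in> U \<and> K' (\<psi> m) = m"
    and V: "\<And>\<theta>. \<theta> \<in> U \<Longrightarrow> snd W (K' \<theta>) = K'' \<theta>"
  shows "nef_variance_function W"
proof -
  have "{\<theta>. laplace_tr \<mu> \<theta> < \<infinity>} = U"
    using fin inf by (auto simp: less_top[symmetric])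
  then have Theta: "Theta \<mu> = U" using U(1) by (simp add: Theta_def interior_open)
  have c: "cumulant \<mu> \<theta> = K \<theta>" if "\<theta> \<in> U" for \<theta> by (simp add: cumulant_def fin[OF that])
  have g: "cumulant_grad \<mu> \<theta> = K' \<theta>" if t: "\<theta> \<in> U" for \<theta>
  proof (rule cumulant_grad_eqI)
    show "GDERIV (cumulant \<mu>) \<theta> :> K' \<theta>"
      unfolding gderiv_def
      by (rule has_derivative_transform_within_open[OF K[OF t, unfolded gderiv_def] U(1) t]) (simp add: c)
  qed
  have h: "cumulant_hess \<mu> \<theta> = K'' \<theta>" if t: "\<theta> \<in> U" for \<theta>
    unfolding cumulant_hess_def
    by (rule jacobian_eqI, rule has_derivative_transform_within_open[OF K'[OF t] U(1) t]) (simp add: g)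
  have nondeg: "\<not> (AE x in \<mu>. a \<bullet> x = b)" if a: "a \<noteq> 0" for a b
  proof
    assume AE: "AE x in \<mu>. a \<bullet> x = b"
    obtain \<theta> where \<theta>: "\<theta> \<in> U" using U by blast
    obtain e where e: "0 < e" "\<And>t. \<bar>t\<bar> < e \<Longrightarrow> \<theta> + t *\<^sub>R a \<in> U"
      using open_line[OF U(1) \<theta>] by blast
    define t where "t = e / 2"
    have t: "0 < t" "\<theta> + t *\<^sub>R a \<in> U" using e by (auto simp: t_def)
    have shift: "K (\<eta> + t *\<^sub>R a) = K \<eta> + t * b" if n: "\<eta> \<in> U" "\<eta> + t *\<^sub>R a \<in> U" for \<eta>
    proof -
      have "laplace_tr \<mu> (\<eta> + t *\<^sub>R a) = (\<integral>\<^sup>+ x. ennreal (exp (t * b)) * ennreal (exp (\<eta> \<bullet> x)) \<partial>\<mu>)"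
        unfolding laplace_tr_def
      proof (rule nn_integral_cong_AE)
        show "AE x in \<mu>. ennreal (exp ((\<eta> + t *\<^sub>R a) \<bullet> x)) = ennreal (exp (t * b)) * ennreal (exp (\<eta> \<bullet> x))"
          using AE by eventually_elim (simp add: inner_add_left exp_add mult.commute flip: ennreal_mult')
      qed
      also have "\<dots> = ennreal (exp (t * b)) * laplace_tr \<mu> \<eta>"
        unfolding laplace_tr_def by (rule nn_integral_cmult) simp
      finally have "ennreal (exp (K (\<eta> + t *\<^sub>R a))) = ennreal (exp (t * b) * exp (K \<eta>))"
        using fin n by (simp flip: ennreal_mult')
      then have "exp (K (\<eta> + t *\<^sub>R a)) = exp (t * b + K \<eta>)" by (simp add: exp_add)
      then show ?thesis by simp
    qed
    let ?U = "U \<inter> (\<lambda>\<eta>. \<eta> + t *\<^sub>R a) -` U"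
    have oU: "open ?U" by (intro open_Int U(1) open_vimage continuous_intros)
    have tU: "\<theta> \<in> ?U" using \<theta> t by simp
    have "((\<lambda>\<eta>. K (\<eta> + t *\<^sub>R a) - t * b) has_derivative (\<lambda>h. h \<bullet> K' (\<theta> + t *\<^sub>R a) - 0)) (at \<theta>)"
    proof (rule has_derivative_diff[OF _ has_derivative_const])
      have "((\<lambda>\<eta>. \<eta> + t *\<^sub>R a) has_derivative (\<lambda>h. h)) (at \<theta>)" by (auto intro!: derivative_eq_intros)
      then show "((\<lambda>\<eta>. K (\<eta> + t *\<^sub>R a)) has_derivative (\<lambda>h. h \<bullet> K' (\<theta> + t *\<^sub>R a))) (at \<theta>)"
        using has_derivative_compose[of "\<lambda>\<eta>. \<eta> + t *\<^sub>R a" "\<lambda>h. h" \<theta> UNIV K "\<lambda>h. h \<bullet> K' (\<theta> + t *\<^sub>R a)"]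
          K[OF t(2)] by (simp add: gderiv_def)
    qed
    then have "(K has_derivative (\<lambda>h. h \<bullet> K' (\<theta> + t *\<^sub>R a) - 0)) (at \<theta>)"
      by (rule has_derivative_transform_within_open[OF _ oU tU]) (simp add: shift)
    then have "(\<lambda>h. h \<bullet> K' (\<theta> + t *\<^sub>R a) - 0) = (\<lambda>h. h \<bullet> K' \<theta>)"
      using K[OF \<theta>] has_derivative_unique unfolding gderiv_def by blast
    then have "h \<bullet> (K' (\<theta> + t *\<^sub>R a) - K' \<theta>) = 0" for h
      by (simp add: inner_diff_right fun_eq_iff)
    from this[of "K' (\<theta> + t *\<^sub>R a) - K' \<theta>"] have "K' (\<theta> + t *\<^sub>R a) = K' \<theta>" by simp
    then have "\<theta> + t *\<^sub>R a = \<theta>" using \<psi>[OF \<theta>] \<psi>[OF t(2)] by simp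
    then show False using a t by simp
  qed
  have gen: "nef_generator \<mu>"
    using s U nondeg by (auto simp: nef_generator_def Theta)
  interpret nef \<mu> by unfold_locales (rule gen)
  have dom: "fst W = mean_domain \<mu>"
    unfolding mean_domain_def Theta
  proof
    show "fst W \<subseteq> cumulant_grad \<mu> ` U" using M g by (metis image_eqI subsetI)
    show "cumulant_grad \<mu> ` U \<subseteq> fst W" using \<psi> g by auto
  qed
  have "snd W m = variance_fun \<mu> m" if m: "m \<in> fst W" for m
  proof -
    have p: "\<psi> m \<in> U" "K' (\<psi> m) = m" using M[OF m] by auto
    have "variance_fun \<mu> (cumulant_grad \<mu> (\<psi> m)) = cumulant_hess \<mu> (\<psi> m)"
      using p by (intro variance_fun_grad) (simp add: Theta)
    then show ?thesis using V[OF p(1)] p by (simp add: g h)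
  qed
  then show ?thesis
    unfolding nef_variance_function_def is_variance_function_of_def using gen dom by blast
qed

text \<open>All four families have a cumulant of the form \<open>G (\<Sum>i. \<phi> i (\<theta>\<^sub>i))\<close> with
  \<open>G'' = \<epsilon> G'\<^sup>2\<close>, which makes the variance \<open>\<epsilon> m m\<^sup>T\<close> plus a diagonal matrix.\<close>

lemma nef_variance_function_separable:
  fixes W :: "'n::finite varfun" and \<phi> :: "'n \<Rightarrow> real \<Rightarrow> real"
  defines "s \<equiv> \<lambda>\<theta> :: real^'n. \<Sum>i\<in>UNIV. \<phi> i (\<theta> $ i)"
  assumes b: "sets \<mu> = sets borel"
    and J: "open J"
    and fin: "\<And>\<theta>. s \<theta> \<in> J \<Longrightarrow> laplace_tr \<mu> \<theta> = ennreal (exp (G (s \<theta>)))"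
    and inf: "\<And>\<theta>. s \<theta> \<notin> J \<Longrightarrow> laplace_tr \<mu> \<theta> = \<infinity>"
    and \<phi>: "\<And>i x. (\<phi> i has_real_derivative \<phi>' i x) (at x)"
    and \<phi>': "\<And>i x. (\<phi>' i has_real_derivative \<phi>'' i x) (at x)"
    and G: "\<And>x. x \<in> J \<Longrightarrow> (G has_real_derivative G' x) (at x)"
    and G': "\<And>x. x \<in> J \<Longrightarrow> (G' has_real_derivative \<epsilon> * (G' x)\<^sup>2) (at x)"
    and ne: "s \<theta>\<^sub>0 \<in> J"
    and \<psi>: "\<And>\<theta>. s \<theta> \<in> J \<Longrightarrow> (\<chi> i. G' (s \<theta>) * \<phi>' i (\<theta> $ i)) \<in> fst W \<and> \<psi> (\<chi> i. G' (s \<theta>) * \<phi>' i (\<theta> $ i)) = \<theta>"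
    and M: "\<And>m. m \<in> fst W \<Longrightarrow> s (\<psi> m) \<in> J \<and> (\<forall>i. G' (s (\<psi> m)) * \<phi>' i (\<psi> m $ i) = m $ i)"
    and V: "\<And>\<theta>. s \<theta> \<in> J \<Longrightarrow> snd W (\<chi> i. G' (s \<theta>) * \<phi>' i (\<theta> $ i))
      = \<epsilon> *\<^sub>R outer (\<chi> i. G' (s \<theta>) * \<phi>' i (\<theta> $ i)) + diag (\<lambda>i. G' (s \<theta>) * \<phi>'' i (\<theta> $ i))"
  shows "nef_variance_function W"
proof -
  define K' where "K' \<theta> = (\<chi> i. G' (s \<theta>) * \<phi>' i (\<theta> $ i))" for \<theta>
  define K'' where "K'' \<theta> = \<epsilon> *\<^sub>R outer (K' \<theta>) + diag (\<lambda>i. G' (s \<theta>) * \<phi>'' i (\<theta> $ i))" for \<theta>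
  have nth: "((\<lambda>\<theta>. \<theta> $ i) has_derivative (\<lambda>h. h $ i)) (at \<theta>)" for i and \<theta> :: "real^'n"
    by (rule bounded_linear_imp_has_derivative) (rule bounded_linear_vec_nth)
  have comp: "((\<lambda>\<theta>. f (\<theta> $ i)) has_derivative (\<lambda>h. D * h $ i)) (at \<theta>)"
    if "(f has_real_derivative D) (at (\<theta> $ i))" for f D i and \<theta> :: "real^'n"
    using has_derivative_compose[OF nth[of i \<theta>], of f "(*) D"] that by (simp add: has_field_derivative_def)
  have s: "(s has_derivative (\<lambda>h. \<Sum>i\<in>UNIV. \<phi>' i (\<theta> $ i) * h $ i)) (at \<theta>)" for \<theta>
    unfolding s_def by (intro has_derivative_sum comp \<phi>)
  have scont: "continuous_on UNIV s"
    using s by (meson continuous_at_imp_continuous_on has_derivative_continuous)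
  have comps: "((\<lambda>\<theta>. f (s \<theta>)) has_derivative (\<lambda>h. D * (\<Sum>i\<in>UNIV. \<phi>' i (\<theta> $ i) * h $ i))) (at \<theta>)"
    if "(f has_real_derivative D) (at (s \<theta>))" for f D and \<theta> :: "real^'n"
    using has_derivative_compose[OF s[of \<theta>], of f "(*) D"] that by (simp add: has_field_derivative_def)
  show ?thesis
  proof (rule nef_variance_functionI[OF b, of "s -` J" "\<lambda>\<theta>. G (s \<theta>)" K' K'' W \<psi>])
    show "open (s -` J)" using scont J by (simp add: continuous_on_open_vimage)
    show "s -` J \<noteq> {}" using ne by blast
    fix \<theta> assume t: "\<theta> \<in> s -` J"
    then have t: "s \<theta> \<in> J" by simp
    show "GDERIV (\<lambda>\<theta>. G (s \<theta>)) \<theta> :> K' \<theta>"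
      using comps[OF G[OF t]]
      by (simp add: gderiv_def K'_def inner_vec_def sum_distrib_left mult_ac)
    show "(K' has_derivative (*v) (K'' \<theta>)) (at \<theta>)"
    proof (rule has_derivative_vec)
      fix i
      \<comment> \<open>In this product rule the derivative of G' contributes \<epsilon> m_i m_j by
        the differential equation for G, and the derivative of \<phi>' only a diagonal
        entry.\<close>
      have "((\<lambda>\<theta>. G' (s \<theta>) * \<phi>' i (\<theta> $ i)) has_derivative
         (\<lambda>h. G' (s \<theta>) * (\<phi>'' i (\<theta> $ i) * h $ i) + (\<epsilon> * (G' (s \<theta>))\<^sup>2 * (\<Sum>i\<in>UNIV. \<phi>' i (\<theta> $ i) * h $ i)) * \<phi>' i (\<theta> $ i))) (at \<theta>)"
        by (rule has_derivative_mult[OF comps[OF G'[OF t]] comp[OF \<phi>']])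
      moreover have "(K'' \<theta> *v h) $ i = G' (s \<theta>) * (\<phi>'' i (\<theta> $ i) * h $ i) + (\<epsilon> * (G' (s \<theta>))\<^sup>2 * (\<Sum>i\<in>UNIV. \<phi>' i (\<theta> $ i) * h $ i)) * \<phi>' i (\<theta> $ i)" for h
      proof -
        have "(K'' \<theta> *v h) $ i = (\<Sum>j\<in>UNIV. \<epsilon> * (G' (s \<theta>))\<^sup>2 * \<phi>' i (\<theta> $ i) * (\<phi>' j (\<theta> $ j) * h $ j)
            + (if i = j then G' (s \<theta>) * \<phi>'' i (\<theta> $ i) * h $ j else 0))"
          by (simp add: matrix_vector_mult_def K''_def K'_def outer_def diag_def distrib_right power2_eq_square mult_ac)
            (intro sum.cong refl, simp add: algebra_simps)
        also have "\<dots> = \<epsilon> * (G' (s \<theta>))\<^sup>2 * \<phi>' i (\<theta> $ i) * (\<Sum>j\<in>UNIV. \<phi>' j (\<theta> $ j) * h $ j) + G' (s \<theta>) * \<phi>'' i (\<theta> $ i) * h $ i"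
          by (simp add: sum.distrib sum_distrib_left)
        finally show ?thesis by simp
      qed
      ultimately show "((\<lambda>x. K' x $ i) has_derivative (\<lambda>h. (K'' \<theta> *v h) $ i)) (at \<theta>)"
        by (simp add: K'_def)
    qed
  qed (use fin inf \<psi> M V in \<open>auto simp: K'_def K''_def vec_eq_iff\<close>)
qed


section \<open>Mixtures of products of Dirac, Poisson and normal laws\<close>

text \<open>For each \<open>x > 0\<close> the measure with density \<open>w x\<close> relative to \<open>B\<close>, transported by \<open>T x\<close>, has
  Laplace transform \<open>exp (x \<phi>)\<close>.\<close>

definition mixable :: "(real \<Rightarrow> real) \<Rightarrow> bool" where
  "mixable \<phi> \<longleftrightarrow> (\<exists>B (w :: real \<times> real \<Rightarrow> ennreal) (T :: real \<times> real \<Rightarrow> real).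
     sets B = sets borel \<and> sigma_finite_measure B
     \<and> w \<in> borel_measurable (borel \<Otimes>\<^sub>M borel) \<and> T \<in> borel_measurable (borel \<Otimes>\<^sub>M borel)
     \<and> (\<forall>x>0. \<forall>s. (\<integral>\<^sup>+ y. w (x, y) * ennreal (exp (s * T (x, y))) \<partial>B) = ennreal (exp (x * \<phi> s))))"

text \<open>The Dirac law at x: the base measure is a point mass, and the transport map returns the
  parameter.\<close>

lemma mixable_id: "mixable (\<lambda>s. s)"
proof -
  have "sigma_finite_measure (return borel (0::real))"
    by (simp add: prob_space_return prob_space_imp_sigma_finite)
  moreover have "(\<integral>\<^sup>+ y. (\<lambda>_. 1) (x, y) * ennreal (exp (s * fst (x, y))) \<partial>return borel (0::real)) = ennreal (exp (x * s))" for x s :: real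
    by (simp add: nn_integral_return mult.commute)
  ultimately show ?thesis
    unfolding mixable_def
    by (intro exI[of _ "return borel 0"] exI[of _ "\<lambda>_. 1"] exI[of _ fst]) simp
qed

text \<open>The Poisson law of parameter x without its factor e^(-x). The weights 1/n! belong to B,
  which makes B finite of mass e; x^n is written with \<open>powr\<close> because B lives on the
  reals.\<close>

lemma mixable_exp: "mixable exp"
proof -
  define B where "B = distr (density (count_space UNIV) (\<lambda>n::nat. ennreal (1 / fact n))) borel real"
  have int: "(\<integral>\<^sup>+ y. f y \<partial>B) = (\<Sum>n. ennreal (1 / fact n) * f (real n))"
    if [measurable]: "f \<in> borel_measurable borel" for f
    unfolding B_def
    by (subst nn_integral_distr) (auto simp: nn_integral_density nn_integral_count_space_nat)
  have e: "(\<Sum>n. ennreal (x ^ n / fact n)) = ennreal (exp x)" if "0 \<le> x" for x :: real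
  proof -
    have "(\<lambda>n. x ^ n / fact n) sums exp x"
      using exp_converges[of x] by (simp add: divide_inverse mult.commute)
    then show ?thesis
      using that by (subst suminf_ennreal2) (auto simp: sums_iff)
  qed
  have "emeasure B (space B) = (\<integral>\<^sup>+ y. 1 \<partial>B)" by simp
  also have "\<dots> = (\<Sum>n. ennreal (1 ^ n / fact n))" by (subst int) simp_all
  also have "\<dots> = ennreal (exp 1)" by (rule e) simp
  finally have "finite_measure B" by (intro finite_measureI) simp
  then have "sigma_finite_measure B"
    by (simp add: finite_measure.axioms(1) finite_measure_def)
  moreover have "(\<integral>\<^sup>+ y. (\<lambda>p. ennreal (fst p powr snd p)) (x, y) * ennreal (exp (s * snd (x, y))) \<partial>B) = ennreal (exp (x * exp s))"
    if "0 < x" for x s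
  proof -
    have "(\<integral>\<^sup>+ y. (\<lambda>p. ennreal (fst p powr snd p)) (x, y) * ennreal (exp (s * snd (x, y))) \<partial>B)
       = (\<Sum>n. ennreal (1 / fact n) * (ennreal (x powr real n) * ennreal (exp (s * real n))))"
      by (subst int) simp_all
    also have "\<dots> = (\<Sum>n. ennreal ((x * exp s) ^ n / fact n))"
      using that by (intro suminf_cong)
        (simp add: powr_realpow power_mult_distrib exp_of_nat_mult[symmetric] mult.commute flip: ennreal_mult')
    also have "\<dots> = ennreal (exp (x * exp s))" using that by (intro e) simp
    finally show ?thesis .
  qed
  ultimately show ?thesis
    unfolding mixable_def
    by (intro exI[of _ B] exI[of _ "\<lambda>p. ennreal (fst p powr snd p)"] exI[of _ snd])
      (simp_all add: B_def)
qed

text \<open>The normal law of variance x, as a standard normal variable scaled by sqrt x; completing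
  the square gives the transform.\<close>

lemma mixable_square: "mixable (\<lambda>s. s\<^sup>2 / 2)"
proof -
  have "sigma_finite_measure (lborel :: real measure)" by (rule lborel.sigma_finite_measure_axioms)
  moreover have "(\<integral>\<^sup>+ y. (\<lambda>p. ennreal (std_normal_density (snd p))) (x, y) * ennreal (exp (s * (\<lambda>p. sqrt (fst p) * snd p) (x, y))) \<partial>lborel)
     = ennreal (exp (x * (s\<^sup>2 / 2)))" if "0 < x" for x s
  proof -
    define a where "a = s * sqrt x"
    have a2: "a\<^sup>2 = s\<^sup>2 * x" using that by (simp add: a_def power_mult_distrib)
    have *: "std_normal_density y * exp (a * y) = exp (a\<^sup>2 / 2) * normal_density a 1 y" for y
      by (simp add: normal_density_def flip: exp_add) (simp add: power2_eq_square field_simps)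
    interpret N: prob_space "density lborel (normal_density a 1)" by (rule prob_space_normal_density) simp
    have "(\<integral>\<^sup>+ y. ennreal (std_normal_density y) * ennreal (exp (a * y)) \<partial>lborel)
      = (\<integral>\<^sup>+ y. ennreal (exp (a\<^sup>2 / 2)) * ennreal (normal_density a 1 y) \<partial>lborel)"
      by (intro nn_integral_cong) (simp add: * flip: ennreal_mult')
    also have "\<dots> = ennreal (exp (a\<^sup>2 / 2)) * (\<integral>\<^sup>+ y. ennreal (normal_density a 1 y) \<partial>lborel)"
      by (rule nn_integral_cmult) simp
    also have "(\<integral>\<^sup>+ y. ennreal (normal_density a 1 y) \<partial>lborel) = 1"
      using N.emeasure_space_1 by (simp add: emeasure_density)
    finally show ?thesis by (simp add: a_def a2[unfolded a_def] mult_ac)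
  qed
  ultimately show ?thesis
    unfolding mixable_def
    by (intro exI[of _ lborel] exI[of _ "\<lambda>p. ennreal (std_normal_density (snd p))"] exI[of _ "\<lambda>p. sqrt (fst p) * snd p"])
      simp_all
qed

text \<open>Given the mixing variable x the coordinates are independent, so by Tonelli the inner
  integral factors into the n given transforms. Base measures that do not depend on x turn the
  mixture into a single density on a product space.\<close>

lemma mixture:
  fixes \<phi> :: "'n::finite \<Rightarrow> real \<Rightarrow> real" and \<Lambda> :: "real measure"
  assumes \<phi>: "\<And>i. mixable (\<phi> i)" and \<Lambda> [measurable_cong]: "sets \<Lambda> = sets borel"
    and pos: "AE x in \<Lambda>. 0 < x"
  obtains \<mu> :: "(real^'n) measure" where "sets \<mu> = sets borel"
    "\<And>\<theta>. laplace_tr \<mu> \<theta> = (\<integral>\<^sup>+ x. ennreal (exp (x * (\<Sum>i\<in>UNIV. \<phi> i (\<theta> $ i)))) \<partial>\<Lambda>)"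
proof -
  define Q where "Q i B w T \<longleftrightarrow> sets B = sets borel \<and> sigma_finite_measure B
     \<and> w \<in> borel_measurable (borel \<Otimes>\<^sub>M borel) \<and> T \<in> borel_measurable (borel \<Otimes>\<^sub>M borel)
     \<and> (\<forall>x>0. \<forall>s. (\<integral>\<^sup>+ y. w (x, y) * ennreal (exp (s * T (x, y))) \<partial>B) = ennreal (exp (x * \<phi> i s)))"
    for i and B :: "real measure" and w :: "real \<times> real \<Rightarrow> ennreal" and T :: "real \<times> real \<Rightarrow> real"
  have "\<forall>i. \<exists>B w T. Q i B w T" using \<phi> unfolding mixable_def Q_def by blast
  from choice[OF this] obtain B where "\<forall>i. \<exists>w T. Q i (B i) w T" ..
  from choice[OF this] obtain w where "\<forall>i. \<exists>T. Q i (B i) (w i) T" ..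
  from choice[OF this] obtain T where Q: "\<forall>i. Q i (B i) (w i) (T i)" ..
  have B [measurable_cong]: "\<And>i. sets (B i) = sets borel" and sf: "\<And>i. sigma_finite_measure (B i)"
    and w [measurable]: "\<And>i. w i \<in> borel_measurable (borel \<Otimes>\<^sub>M borel)"
    and T [measurable]: "\<And>i. T i \<in> borel_measurable (borel \<Otimes>\<^sub>M borel)"
    and int: "\<And>i x s. 0 < x \<Longrightarrow> (\<integral>\<^sup>+ y. w i (x, y) * ennreal (exp (s * T i (x, y))) \<partial>B i) = ennreal (exp (x * \<phi> i s))"
    using Q unfolding Q_def by blast+
  interpret product_sigma_finite B by (simp add: product_sigma_finite_def sf)
  let ?P = "PiM UNIV B"
  interpret P: sigma_finite_measure ?P by (rule sigma_finite) simp
  define W where "W p = (\<Prod>i\<in>UNIV. w i (fst p, snd p i))" for p :: "real \<times> ('n \<Rightarrow> real)"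
  define X :: "real \<times> ('n \<Rightarrow> real) \<Rightarrow> real^'n" where "X p = (\<Sum>i\<in>UNIV. T i (fst p, snd p i) *\<^sub>R axis i 1)" for p
  have comp: "(\<lambda>p. (fst p, snd p i)) \<in> measurable (\<Lambda> \<Otimes>\<^sub>M ?P) (borel \<Otimes>\<^sub>M borel)" for i
    by measurable
  have W [measurable]: "W \<in> borel_measurable (\<Lambda> \<Otimes>\<^sub>M ?P)"
    unfolding W_def using measurable_compose[OF comp w] by (intro borel_measurable_prod_ennreal) auto
  have X [measurable]: "X \<in> borel_measurable (\<Lambda> \<Otimes>\<^sub>M ?P)"
    unfolding X_def using measurable_compose[OF comp T]
    by (intro borel_measurable_sum borel_measurable_scaleR borel_measurable_const) auto
  define \<mu> where "\<mu> = distr (density (\<Lambda> \<Otimes>\<^sub>M ?P) W) borel X"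
  have "laplace_tr \<mu> \<theta> = (\<integral>\<^sup>+ x. ennreal (exp (x * (\<Sum>i\<in>UNIV. \<phi> i (\<theta> $ i)))) \<partial>\<Lambda>)" for \<theta>
  proof -
    have ex: "ennreal (exp (\<theta> \<bullet> X p)) = (\<Prod>i\<in>UNIV. ennreal (exp (\<theta> $ i * T i (fst p, snd p i))))" for p
    proof -
      have "\<theta> \<bullet> X p = (\<Sum>i\<in>UNIV. \<theta> $ i * T i (fst p, snd p i))"
        by (simp add: X_def inner_sum_right inner_axis mult.commute)
      then show ?thesis by (simp add: exp_sum prod_ennreal)
    qed
    have "laplace_tr \<mu> \<theta> = (\<integral>\<^sup>+ p. W p * ennreal (exp (\<theta> \<bullet> X p)) \<partial>(\<Lambda> \<Otimes>\<^sub>M ?P))"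
    proof -
      have X': "X \<in> measurable (density (\<Lambda> \<Otimes>\<^sub>M ?P) W) borel" using X by simp
      have e: "(\<lambda>x. ennreal (exp (\<theta> \<bullet> x))) \<in> borel_measurable borel" by measurable
      show ?thesis
        unfolding laplace_tr_def \<mu>_def nn_integral_distr[OF X', simplified, OF e]
        by (rule nn_integral_density[OF W measurable_compose[OF X e]])
    qed
    also have "\<dots> = (\<integral>\<^sup>+ x. \<integral>\<^sup>+ y. W (x, y) * ennreal (exp (\<theta> \<bullet> X (x, y))) \<partial>?P \<partial>\<Lambda>)"
    proof (rule P.nn_integral_fst[symmetric])
      have "(\<lambda>p. ennreal (exp (\<theta> \<bullet> X p))) \<in> borel_measurable (\<Lambda> \<Otimes>\<^sub>M ?P)"
        by (rule measurable_compose[OF X]) measurable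
      then show "(\<lambda>p. W p * ennreal (exp (\<theta> \<bullet> X p))) \<in> borel_measurable (\<Lambda> \<Otimes>\<^sub>M ?P)"
        by (rule borel_measurable_times_ennreal[OF W])
    qed
    also have "\<dots> = (\<integral>\<^sup>+ x. \<integral>\<^sup>+ y. (\<Prod>i\<in>UNIV. w i (x, y i) * ennreal (exp (\<theta> $ i * T i (x, y i)))) \<partial>?P \<partial>\<Lambda>)"
      by (simp add: ex W_def prod.distrib)
    also have "\<dots> = (\<integral>\<^sup>+ x. (\<Prod>i\<in>UNIV. \<integral>\<^sup>+ y. w i (x, y) * ennreal (exp (\<theta> $ i * T i (x, y))) \<partial>B i) \<partial>\<Lambda>)"
    proof (intro nn_integral_cong product_nn_integral_prod)
      fix x :: real and i
      have "(\<lambda>y. (x, y)) \<in> measurable (B i) (borel \<Otimes>\<^sub>M borel)" by measurable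
      note Tw = measurable_compose[OF this w] measurable_compose[OF this T]
      have "(\<lambda>y. ennreal (exp (\<theta> $ i * T i (x, y)))) \<in> borel_measurable (B i)"
        by (rule measurable_compose[OF Tw(2)]) measurable
      then show "(\<lambda>y. w i (x, y) * ennreal (exp (\<theta> $ i * T i (x, y)))) \<in> borel_measurable (B i)"
        by (rule borel_measurable_times_ennreal[OF Tw(1)])
    qed simp
    also have "\<dots> = (\<integral>\<^sup>+ x. (\<Prod>i\<in>UNIV. ennreal (exp (x * \<phi> i (\<theta> $ i)))) \<partial>\<Lambda>)"
      by (intro nn_integral_cong_AE eventually_mono[OF pos]) (simp add: int)
    also have "\<dots> = (\<integral>\<^sup>+ x. ennreal (exp (x * (\<Sum>i\<in>UNIV. \<phi> i (\<theta> $ i)))) \<partial>\<Lambda>)"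
      by (simp add: prod_ennreal exp_sum sum_distrib_left)
    finally show ?thesis .
  qed
  then show ?thesis using that[of \<mu>] by (simp add: \<mu>_def)
qed

lemma mixture_at_1:
  fixes \<phi> :: "'n::finite \<Rightarrow> real \<Rightarrow> real"
  assumes "\<And>i. mixable (\<phi> i)"
  obtains \<mu> :: "(real^'n) measure" where "sets \<mu> = sets borel"
    "\<And>\<theta>. laplace_tr \<mu> \<theta> = ennreal (exp (\<Sum>i\<in>UNIV. \<phi> i (\<theta> $ i)))"
proof -
  have "AE x in return borel (1::real). 0 < x" by (simp add: AE_return)
  then obtain \<mu> :: "(real^'n) measure" where "sets \<mu> = sets borel"
    "\<And>\<theta>. laplace_tr \<mu> \<theta> = (\<integral>\<^sup>+ x. ennreal (exp (x * (\<Sum>i\<in>UNIV. \<phi> i (\<theta> $ i)))) \<partial>return borel 1)"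
    using mixture[of \<phi> "return borel 1"] assms by auto
  then show ?thesis using that[of \<mu>] by (simp add: nn_integral_return)
qed

text \<open>The mixing measure has density e^(-cx) on the positive half-line. The rate c = 1 serves
  type III; c = 0, which is Lebesgue measure on the half-line, serves type IV.\<close>

lemma mixture_exponential:
  fixes \<phi> :: "'n::finite \<Rightarrow> real \<Rightarrow> real"
  assumes "\<And>i. mixable (\<phi> i)"
  obtains \<mu> :: "(real^'n) measure" where "sets \<mu> = sets borel"
    "\<And>\<theta>. (\<Sum>i\<in>UNIV. \<phi> i (\<theta> $ i)) < c \<Longrightarrow> laplace_tr \<mu> \<theta> = ennreal (1 / (c - (\<Sum>i\<in>UNIV. \<phi> i (\<theta> $ i))))"
    "\<And>\<theta>. \<not> (\<Sum>i\<in>UNIV. \<phi> i (\<theta> $ i)) < c \<Longrightarrow> laplace_tr \<mu> \<theta> = \<infinity>"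
proof -
  define f where "f x = ennreal (exp (- c * x)) * indicator {0<..} x" for x :: real
  have f [measurable]: "f \<in> borel_measurable borel" unfolding f_def by measurable
  define \<Lambda> where "\<Lambda> = density lborel f"
  have "AE x in \<Lambda>. 0 < x"
    unfolding \<Lambda>_def by (subst AE_density) (auto simp: f_def indicator_def)
  then obtain \<mu> :: "(real^'n) measure" where \<mu>: "sets \<mu> = sets borel"
    "\<And>\<theta>. laplace_tr \<mu> \<theta> = (\<integral>\<^sup>+ x. ennreal (exp (x * (\<Sum>i\<in>UNIV. \<phi> i (\<theta> $ i)))) \<partial>\<Lambda>)"
    using mixture[of \<phi> \<Lambda>] assms by (auto simp: \<Lambda>_def)
  have int: "(\<integral>\<^sup>+ x. ennreal (exp (x * s)) \<partial>\<Lambda>) = (\<integral>\<^sup>+ x. ennreal (exp (- (c - s) * x)) * indicator {0<..} x \<partial>lborel)" for s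
    unfolding \<Lambda>_def
    by (subst nn_integral_density)
      (auto simp: f_def indicator_def exp_add[symmetric] algebra_simps simp flip: ennreal_mult' intro!: nn_integral_cong)
  have "(\<integral>\<^sup>+ x. ennreal (exp (x * s)) \<partial>\<Lambda>) = ennreal (1 / (c - s))" if s: "s < c" for s
  proof -
    define l where "l = c - s"
    have l: "0 < l" using s by (simp add: l_def)
    interpret E: prob_space "density lborel (exponential_density l)" by (rule prob_space_exponential_density[OF l])
    have "1 = (\<integral>\<^sup>+ x. ennreal (exponential_density l x) \<partial>lborel)"
      using E.emeasure_space_1 by (simp add: emeasure_density)
    also have "\<dots> = (\<integral>\<^sup>+ x. ennreal l * (ennreal (exp (- l * x)) * indicator {0<..} x) \<partial>lborel)"
    proof (rule nn_integral_cong_AE)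
      \<comment> \<open>The exponential density is positive at 0, where the indicator of the open
        half-line vanishes; they differ only on this null set.\<close>
      show "AE x in lborel. ennreal (exponential_density l x) = ennreal l * (ennreal (exp (- l * x)) * indicator {0<..} x)"
        using AE_lborel_singleton[of 0]
        by eventually_elim (use l in \<open>auto simp: exponential_density_def indicator_def mult.commute simp flip: ennreal_mult'\<close>)
    qed
    also have "\<dots> = ennreal l * (\<integral>\<^sup>+ x. ennreal (exp (- l * x)) * indicator {0<..} x \<partial>lborel)"
      by (rule nn_integral_cmult) simp
    finally have 1: "1 = ennreal l * (\<integral>\<^sup>+ x. ennreal (exp (- l * x)) * indicator {0<..} x \<partial>lborel)" .
    have "ennreal (1 / l) = ennreal (1 / l) * (ennreal l * (\<integral>\<^sup>+ x. ennreal (exp (- l * x)) * indicator {0<..} x \<partial>lborel))"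
      by (simp only: 1[symmetric] mult_1_right)
    also have "\<dots> = (ennreal (1 / l) * ennreal l) * (\<integral>\<^sup>+ x. ennreal (exp (- l * x)) * indicator {0<..} x \<partial>lborel)"
      by (simp only: mult.assoc)
    also have "ennreal (1 / l) * ennreal l = 1" using l by (simp flip: ennreal_mult')
    finally show ?thesis by (simp add: int l_def)
  qed
  moreover have "(\<integral>\<^sup>+ x. ennreal (exp (x * s)) \<partial>\<Lambda>) = \<infinity>" if s: "\<not> s < c" for s
  proof -
    \<comment> \<open>For s \<ge> c the integrand is at least 1 on the half-line, whose Lebesgue
      measure is infinite.\<close>
    have "\<infinity> = emeasure lborel ({0<..} :: real set)"
    proof (rule ccontr)
      assume "\<infinity> \<noteq> emeasure lborel ({0<..} :: real set)"
      then obtain n :: nat where "emeasure lborel ({0<..} :: real set) < of_nat n"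
        using ennreal_Ex_less_of_nat by (metis infinity_ennreal_def less_top)
      also have "of_nat n = emeasure lborel ({0<..real n})" by (simp add: ennreal_of_nat_eq_real_of_nat)
      also have "\<dots> \<le> emeasure lborel ({0<..} :: real set)" by (intro emeasure_mono) auto
      finally show False by simp
    qed
    also have "\<dots> = (\<integral>\<^sup>+ x. indicator ({0<..} :: real set) x \<partial>lborel)" by (rule nn_integral_indicator[symmetric]) simp
    also have "\<dots> \<le> (\<integral>\<^sup>+ x. ennreal (exp (- (c - s) * x)) * indicator {0<..} x \<partial>lborel)"
      by (intro nn_integral_mono) (use s in \<open>auto simp: indicator_def one_le_exp_iff\<close>)
    finally show ?thesis by (simp add: int top_unique)
  qed
  ultimately show ?thesis using that[of \<mu>] \<mu> by simp
qed


section \<open>The variance functions of types I to IV\<close>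

text \<open>Independent Poisson coordinates up to position k and standard normal ones after it; the
  cumulant is the plain sum, so G is the identity and \<epsilon> = 0.\<close>

lemma nef_V_I: "nef_variance_function (V_I k :: 'n::{finite,linorder} varfun)"
proof -
  define \<phi> :: "'n \<Rightarrow> real \<Rightarrow> real" where "\<phi> i = (if pos i \<le> k then exp else (\<lambda>t. t\<^sup>2 / 2))" for i
  define \<phi>' :: "'n \<Rightarrow> real \<Rightarrow> real" where "\<phi>' i = (if pos i \<le> k then exp else (\<lambda>t. t))" for i
  define \<phi>'' :: "'n \<Rightarrow> real \<Rightarrow> real" where "\<phi>'' i = (if pos i \<le> k then exp else (\<lambda>t. 1))" for i
  define \<psi> :: "(real, 'n) vec \<Rightarrow> (real, 'n) vec" where "\<psi> m = (\<chi> i. if pos i \<le> k then ln (m $ i) else m $ i)" for m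
  have "mixable (\<phi> i)" for i by (simp add: \<phi>_def mixable_exp mixable_square)
  then obtain \<mu> :: "(real, 'n) vec measure" where \<mu>: "sets \<mu> = sets borel"
    "\<And>\<theta>. laplace_tr \<mu> \<theta> = ennreal (exp (\<Sum>i\<in>UNIV. \<phi> i (\<theta> $ i)))"
    using mixture_at_1[of \<phi>] by blast
  show ?thesis
  proof (rule nef_variance_function_separable[of \<mu> UNIV \<phi> "\<lambda>x. x" \<phi>' \<phi>'' "\<lambda>_. 1" 0 0 "V_I k" \<psi>])
    show "(\<phi> i has_real_derivative \<phi>' i x) (at x)" "(\<phi>' i has_real_derivative \<phi>'' i x) (at x)" for i x
      unfolding \<phi>_def \<phi>'_def \<phi>''_def by (auto intro!: derivative_eq_intros)
  qed (auto simp: \<mu> V_I_def \<phi>'_def \<phi>''_def \<psi>_def vec_eq_iff outer_def diag_def)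
qed

lemma has_real_derivative_neg_ln_diff:
  assumes "x < (c::real)"
  shows "((\<lambda>x. - ln (c - x)) has_real_derivative 1 / (c - x)) (at x)"
    "((\<lambda>x. 1 / (c - x)) has_real_derivative 1 * (1 / (c - x))\<^sup>2) (at x)"
  using assms by (auto intro!: derivative_eq_intros simp: power2_eq_square)

text \<open>Poisson coordinates with a common exponential parameter. With S the sum of the exp
  \<theta>_i, the means are exp \<theta>_i / (1 - S); one plus their total is 1 / (1 - S), whence
  exp \<theta>_i is m_i divided by one plus the total.\<close>

lemma nef_V_III: "nef_variance_function (V_III :: 'n::{finite,linorder} varfun)"
proof -
  define \<psi> :: "(real, 'n) vec \<Rightarrow> (real, 'n) vec" where
    "\<psi> m = (\<chi> i. ln (m $ i / (1 + (\<Sum>j\<in>UNIV. m $ j))))" for m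
  obtain \<mu> :: "(real, 'n) vec measure" where \<mu>: "sets \<mu> = sets borel"
    "\<And>\<theta>. (\<Sum>i\<in>UNIV. exp (\<theta> $ i)) < 1 \<Longrightarrow> laplace_tr \<mu> \<theta> = ennreal (1 / (1 - (\<Sum>i\<in>UNIV. exp (\<theta> $ i))))"
    "\<And>\<theta>. \<not> (\<Sum>i\<in>UNIV. exp (\<theta> $ i)) < 1 \<Longrightarrow> laplace_tr \<mu> \<theta> = \<infinity>"
    using mixture_exponential[of "\<lambda>_ :: 'n. exp" 1] mixable_exp by blast
  show ?thesis
  \<comment> \<open>The base point, with all coordinates - ln (n + 1), gives the sum n / (n + 1) <
    1.\<close>
  proof (rule nef_variance_function_separable[of \<mu> "{..<1}" "\<lambda>_. exp" "\<lambda>x. - ln (1 - x)" "\<lambda>_. exp" "\<lambda>_. exp"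
        "\<lambda>x. 1 / (1 - x)" 1 "\<chi> i. - ln (real CARD('n) + 1)" V_III \<psi>])
    fix \<theta> :: "(real, 'n) vec"
    assume "(\<Sum>i\<in>UNIV. exp (\<theta> $ i)) \<in> {..<1}"
    then have S: "0 < 1 - (\<Sum>i\<in>UNIV. exp (\<theta> $ i))" by simp
    let ?S = "\<Sum>i\<in>UNIV. exp (\<theta> $ i)"
    show "laplace_tr \<mu> \<theta> = ennreal (exp (- ln (1 - ?S)))"
      using S by (simp add: \<mu>(2) exp_minus divide_inverse)
    have "1 + (\<Sum>i\<in>UNIV. 1 / (1 - ?S) * exp (\<theta> $ i)) = 1 + ?S / (1 - ?S)"
      by (simp add: sum_divide_distrib)
    also have "\<dots> = 1 / (1 - ?S)" using S by (simp add: field_simps)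
    finally have 1: "1 + (\<Sum>i\<in>UNIV. 1 / (1 - ?S) * exp (\<theta> $ i)) = 1 / (1 - ?S)" .
    show "(\<chi> i. 1 / (1 - ?S) * exp (\<theta> $ i)) \<in> fst V_III \<and> \<psi> (\<chi> i. 1 / (1 - ?S) * exp (\<theta> $ i)) = \<theta>"
      using S by (simp add: V_III_def \<psi>_def 1[simplified] vec_eq_iff)
    show "snd V_III (\<chi> i. 1 / (1 - ?S) * exp (\<theta> $ i)) =
       1 *\<^sub>R outer (\<chi> i. 1 / (1 - ?S) * exp (\<theta> $ i)) + diag (\<lambda>i. 1 / (1 - ?S) * exp (\<theta> $ i))"
      by (simp add: V_III_def vec_eq_iff diag_def)
  next
    fix m :: "(real, 'n) vec"
    assume "m \<in> fst V_III"
    then have m: "0 < m $ i" for i by (simp add: V_III_def)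
    define q where "q = 1 + (\<Sum>j\<in>UNIV. m $ j)"
    have q: "0 < q" unfolding q_def using m by (intro add_pos_nonneg sum_nonneg) (auto simp: less_imp_le)
    have e: "exp (\<psi> m $ i) = m $ i / q" for i using m[of i] q by (simp add: \<psi>_def q_def[symmetric])
    have "(\<Sum>i\<in>UNIV. exp (\<psi> m $ i)) = (q - 1) / q" by (simp add: e q_def flip: sum_divide_distrib)
    also have "\<dots> = 1 - 1 / q" using q by (simp add: diff_divide_distrib)
    finally have S: "(\<Sum>i\<in>UNIV. exp (\<psi> m $ i)) = 1 - 1 / q" .
    show "(\<Sum>i\<in>UNIV. exp (\<psi> m $ i)) \<in> {..<1} \<and> (\<forall>i. 1 / (1 - (\<Sum>i\<in>UNIV. exp (\<psi> m $ i))) * exp (\<psi> m $ i) = m $ i)"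
      unfolding S using q by (simp add: e)
  next
    have "real CARD('n) / (real CARD('n) + 1) < 1" by simp
    then show "(\<Sum>i\<in>UNIV. exp ((\<chi> i. - ln (real CARD('n) + 1) :: (real, 'n) vec) $ i)) \<in> {..<1}"
      by (simp add: exp_minus divide_inverse)
  qed (simp_all add: \<mu> has_real_derivative_neg_ln_diff[simplified] DERIV_exp)
qed

lemma pos_first: "pos (first :: 'n::{finite,linorder}) = 1"
proof -
  have "{j. j \<le> (first :: 'n)} = {first}" unfolding first_def by (auto intro: antisym)
  then show ?thesis by (simp add: pos_def)
qed

text \<open>The first coordinate is the mixing variable itself, through the Dirac law; the others
  are Poisson or normal with that variable as parameter. The cumulant is - ln (- s), so the first
  mean is -1/s and scales all the others.\<close>

lemma nef_V_IV:
  assumes k: "1 \<le> k"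
  shows "nef_variance_function (V_IV k :: 'n::{finite,linorder} varfun)"
proof -
  let ?f = "first :: 'n"
  define \<phi> :: "'n \<Rightarrow> real \<Rightarrow> real" where
    "\<phi> i = (if i = ?f then (\<lambda>t. t) else if pos i \<le> k then exp else (\<lambda>t. t\<^sup>2 / 2))" for i
  define \<phi>' :: "'n \<Rightarrow> real \<Rightarrow> real" where
    "\<phi>' i = (if i = ?f then (\<lambda>t. 1) else if pos i \<le> k then exp else (\<lambda>t. t))" for i
  define \<phi>'' :: "'n \<Rightarrow> real \<Rightarrow> real" where
    "\<phi>'' i = (if i = ?f then (\<lambda>t. 0) else if pos i \<le> k then exp else (\<lambda>t. 1))" for i
  define \<rho> where "\<rho> m i = (if pos i \<le> k then ln (m $ i / m $ ?f) else m $ i / m $ ?f)" for m :: "(real, 'n) vec" and i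
  \<comment> \<open>The ratios m_i / m_first are free of s and determine the other coordinates of
    \<theta>; the first one is then whatever makes s equal to -1 / m_first.\<close>
  define \<psi> :: "(real, 'n) vec \<Rightarrow> (real, 'n) vec" where
    "\<psi> m = (\<chi> i. if i = ?f then - 1 / m $ ?f - (\<Sum>j\<in>UNIV - {?f}. \<phi> j (\<rho> m j)) else \<rho> m i)" for m
  have s: "(\<Sum>i\<in>UNIV. \<phi> i (\<theta> $ i)) = \<theta> $ ?f + (\<Sum>i\<in>UNIV - {?f}. \<phi> i (\<theta> $ i))" for \<theta>
    by (subst sum.remove[of _ ?f]) (auto simp: \<phi>_def)
  have "mixable (\<phi> i)" for i by (simp add: \<phi>_def mixable_exp mixable_square mixable_id)
  then obtain \<mu> :: "(real, 'n) vec measure" where \<mu>: "sets \<mu> = sets borel"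
    "\<And>\<theta>. (\<Sum>i\<in>UNIV. \<phi> i (\<theta> $ i)) < 0 \<Longrightarrow> laplace_tr \<mu> \<theta> = ennreal (1 / (0 - (\<Sum>i\<in>UNIV. \<phi> i (\<theta> $ i))))"
    "\<And>\<theta>. \<not> (\<Sum>i\<in>UNIV. \<phi> i (\<theta> $ i)) < 0 \<Longrightarrow> laplace_tr \<mu> \<theta> = \<infinity>"
    using mixture_exponential[of \<phi> 0] by blast
  have fk: "pos ?f \<le> k" using k by (simp add: pos_first)
  \<comment> \<open>Chosen so that s takes the value -1.\<close>
  let ?\<theta> = "(\<chi> i. if i = ?f then - 1 - (\<Sum>j\<in>UNIV - {?f}. \<phi> j 0) else 0) :: (real, 'n) vec"
  show ?thesis
  proof (rule nef_variance_function_separable[of \<mu> "{..<0}" \<phi> "\<lambda>x. - ln (0 - x)" \<phi>' \<phi>''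
        "\<lambda>x. 1 / (0 - x)" 1 ?\<theta> "V_IV k" \<psi>])
    show "(\<phi> i has_real_derivative \<phi>' i x) (at x)" "(\<phi>' i has_real_derivative \<phi>'' i x) (at x)" for i x
      unfolding \<phi>_def \<phi>'_def \<phi>''_def by (auto intro!: derivative_eq_intros)
    have "(\<Sum>i\<in>UNIV - {?f}. \<phi> i (?\<theta> $ i)) = (\<Sum>j\<in>UNIV - {?f}. \<phi> j 0)" by (intro sum.cong) auto
    then have "(\<Sum>i\<in>UNIV. \<phi> i (?\<theta> $ i)) = - 1" unfolding s by simp
    then show "(\<Sum>i\<in>UNIV. \<phi> i (?\<theta> $ i)) \<in> {..<0}" by (simp only:) simp
    fix \<theta> :: "(real, 'n) vec"
    define S where "S = (\<Sum>i\<in>UNIV. \<phi> i (\<theta> $ i))"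
    assume "(\<Sum>i\<in>UNIV. \<phi> i (\<theta> $ i)) \<in> {..<0}"
    then have S: "S < 0" by (simp add: S_def)
    show "laplace_tr \<mu> \<theta> = ennreal (exp (- ln (0 - (\<Sum>i\<in>UNIV. \<phi> i (\<theta> $ i)))))"
      using S by (simp add: \<mu>(2) exp_minus divide_inverse S_def[symmetric])
    define m :: "(real, 'n) vec" where "m = (\<chi> i. 1 / (0 - S) * \<phi>' i (\<theta> $ i))"
    have mf: "m $ ?f = 1 / (0 - S)" by (simp add: m_def \<phi>'_def)
    have \<rho>: "\<rho> m i = \<theta> $ i" if "i \<noteq> ?f" for i
      using that S by (simp add: \<rho>_def mf) (simp add: m_def \<phi>'_def)
    have "(\<Sum>j\<in>UNIV - {?f}. \<phi> j (\<rho> m j)) = (\<Sum>j\<in>UNIV - {?f}. \<phi> j (\<theta> $ j))"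
      by (intro sum.cong) (auto simp: \<rho>)
    then have "\<psi> m = \<theta>" using s[of \<theta>] S by (simp add: \<psi>_def vec_eq_iff mf \<rho> S_def[symmetric])
    moreover have "m \<in> fst (V_IV k)" using S by (auto simp: V_IV_def m_def \<phi>'_def divide_pos_neg)
    ultimately show "(\<chi> i. 1 / (0 - (\<Sum>i\<in>UNIV. \<phi> i (\<theta> $ i))) * \<phi>' i (\<theta> $ i)) \<in> fst (V_IV k) \<and>
      \<psi> (\<chi> i. 1 / (0 - (\<Sum>i\<in>UNIV. \<phi> i (\<theta> $ i))) * \<phi>' i (\<theta> $ i)) = \<theta>"
      by (simp add: m_def S_def)
    have "snd (V_IV k) m = 1 *\<^sub>R outer m + diag (\<lambda>i. 1 / (0 - S) * \<phi>'' i (\<theta> $ i))"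
      by (simp add: V_IV_def mf) (auto simp: m_def \<phi>'_def \<phi>''_def vec_eq_iff diag_def)
    then show "snd (V_IV k) (\<chi> i. 1 / (0 - (\<Sum>i\<in>UNIV. \<phi> i (\<theta> $ i))) * \<phi>' i (\<theta> $ i)) =
       1 *\<^sub>R outer (\<chi> i. 1 / (0 - (\<Sum>i\<in>UNIV. \<phi> i (\<theta> $ i))) * \<phi>' i (\<theta> $ i)) +
       diag (\<lambda>i. 1 / (0 - (\<Sum>i\<in>UNIV. \<phi> i (\<theta> $ i))) * \<phi>'' i (\<theta> $ i))"
      by (simp only: m_def S_def)
  next
    fix m :: "(real, 'n) vec"
    assume "m \<in> fst (V_IV k)"
    then have m: "0 < m $ i" if "pos i \<le> k" for i using that by (simp add: V_IV_def)
    have "(\<Sum>j\<in>UNIV - {?f}. \<phi> j (\<psi> m $ j)) = (\<Sum>j\<in>UNIV - {?f}. \<phi> j (\<rho> m j))"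
      by (intro sum.cong) (auto simp: \<psi>_def)
    then have S: "(\<Sum>i\<in>UNIV. \<phi> i (\<psi> m $ i)) = - 1 / m $ ?f" by (simp add: s) (simp add: \<psi>_def)
    have "\<phi>' i (\<psi> m $ i) = m $ i / m $ ?f" for i
      using m[of i] m[OF fk] by (auto simp: \<phi>'_def \<psi>_def \<rho>_def)
    then show "(\<Sum>i\<in>UNIV. \<phi> i (\<psi> m $ i)) \<in> {..<0} \<and>
       (\<forall>i. 1 / (0 - (\<Sum>i\<in>UNIV. \<phi> i (\<psi> m $ i))) * \<phi>' i (\<psi> m $ i) = m $ i)"
      unfolding S using m[OF fk] by simp
  qed (auto simp: \<mu> intro!: has_real_derivative_neg_ln_diff[where c = 0, simplified])
qed

text \<open>One multinomial trial without normalization: one minus the total of the m_j is the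
  probability of the atom 0, and \<theta>_i is the log ratio of the atom at e_i to it. The sum of
  exponentials is positive, so every \<theta> falls into the half-line above -1 where ln (1 + x) is
  smooth.\<close>

lemma nef_V_II: "nef_variance_function (V_II :: 'n::{finite,linorder} varfun)"
proof -
  define \<psi> :: "(real, 'n) vec \<Rightarrow> (real, 'n) vec" where
    "\<psi> m = (\<chi> i. ln (m $ i / (1 - (\<Sum>j\<in>UNIV. m $ j))))" for m
  define X :: "'n option \<Rightarrow> (real, 'n) vec" where "X i = (case i of None \<Rightarrow> 0 | Some j \<Rightarrow> axis j 1)" for i
  define \<mu> where "\<mu> = distr (count_space UNIV) borel X"
  have pos: "0 < (\<Sum>i\<in>UNIV. exp (\<theta> $ i))" for \<theta> :: "(real, 'n) vec" by (intro sum_pos) auto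
  have \<mu>: "laplace_tr \<mu> \<theta> = ennreal (1 + (\<Sum>i\<in>UNIV. exp (\<theta> $ i)))" for \<theta>
  proof -
    have "laplace_tr \<mu> \<theta> = (\<integral>\<^sup>+ i. ennreal (exp (\<theta> \<bullet> X i)) \<partial>count_space UNIV)"
      unfolding laplace_tr_def \<mu>_def by (subst nn_integral_distr) auto
    also have "\<dots> = (\<Sum>i\<in>UNIV. ennreal (exp (\<theta> \<bullet> X i)))" by (rule nn_integral_count_space_finite) simp
    also have "\<dots> = ennreal (\<Sum>i\<in>UNIV. exp (\<theta> \<bullet> X i))" by (rule sum_ennreal) simp
    finally show ?thesis by (simp add: sum_option X_def inner_axis)
  qed
  show ?thesis
  proof (rule nef_variance_function_separable[of \<mu> "{- 1<..}" "\<lambda>_. exp" "\<lambda>x. ln (1 + x)" "\<lambda>_. exp" "\<lambda>_. exp"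
        "\<lambda>x. 1 / (1 + x)" "- 1" 0 V_II \<psi>])
    fix \<theta> :: "(real, 'n) vec"
    let ?S = "\<Sum>i\<in>UNIV. exp (\<theta> $ i)"
    have S: "0 < 1 + ?S" using pos[of \<theta>] by simp
    show "laplace_tr \<mu> \<theta> = ennreal (exp (ln (1 + ?S)))" using S by (simp add: \<mu>)
    show "laplace_tr \<mu> \<theta> = \<infinity>" if "?S \<notin> {- 1<..}" using that S by simp
    have "1 - (\<Sum>i\<in>UNIV. 1 / (1 + ?S) * exp (\<theta> $ i)) = 1 - ?S / (1 + ?S)"
      by (simp add: sum_divide_distrib)
    also have "\<dots> = 1 / (1 + ?S)" using S by (simp add: field_simps)
    finally have 1: "1 - (\<Sum>i\<in>UNIV. 1 / (1 + ?S) * exp (\<theta> $ i)) = 1 / (1 + ?S)" .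
    then have "(\<Sum>i\<in>UNIV. 1 / (1 + ?S) * exp (\<theta> $ i)) < 1"
      using S by (metis diff_gt_0_iff_gt divide_pos_pos zero_less_one)
    then show "(\<chi> i. 1 / (1 + ?S) * exp (\<theta> $ i)) \<in> fst V_II \<and> \<psi> (\<chi> i. 1 / (1 + ?S) * exp (\<theta> $ i)) = \<theta>"
      using S by (simp add: fst_V_II \<psi>_def 1[simplified] vec_eq_iff)
    show "snd V_II (\<chi> i. 1 / (1 + ?S) * exp (\<theta> $ i)) =
       - 1 *\<^sub>R outer (\<chi> i. 1 / (1 + ?S) * exp (\<theta> $ i)) + diag (\<lambda>i. 1 / (1 + ?S) * exp (\<theta> $ i))"
      by (simp add: V_II_def vec_eq_iff diag_def)
  next
    fix m :: "(real, 'n) vec"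
    assume "m \<in> fst V_II"
    then have m: "0 < m $ i" "(\<Sum>j\<in>UNIV. m $ j) < 1" for i by (simp_all add: fst_V_II)
    define q where "q = 1 - (\<Sum>j\<in>UNIV. m $ j)"
    have q: "0 < q" unfolding q_def using m by simp
    have e: "exp (\<psi> m $ i) = m $ i / q" for i using m(1)[of i] q by (simp add: \<psi>_def q_def[symmetric])
    have "(\<Sum>i\<in>UNIV. exp (\<psi> m $ i)) = (1 - q) / q" by (simp add: e q_def flip: sum_divide_distrib)
    also have "\<dots> = 1 / q - 1" using q by (simp add: diff_divide_distrib)
    finally have S: "(\<Sum>i\<in>UNIV. exp (\<psi> m $ i)) = 1 / q - 1" .
    show "(\<Sum>i\<in>UNIV. exp (\<psi> m $ i)) \<in> {- 1<..} \<and> (\<forall>i. 1 / (1 + (\<Sum>i\<in>UNIV. exp (\<psi> m $ i))) * exp (\<psi> m $ i) = m $ i)"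
      unfolding S using q by (simp add: e)
  next
    fix x :: real assume "x \<in> {- 1<..}"
    then show "((\<lambda>x. ln (1 + x)) has_real_derivative 1 / (1 + x)) (at x)"
      "((\<lambda>x. 1 / (1 + x)) has_real_derivative - 1 * (1 / (1 + x))\<^sup>2) (at x)"
      by (auto intro!: derivative_eq_intros simp: power2_eq_square)
  qed (simp_all add: \<mu>_def DERIV_exp)
qed


section \<open>Orbits of types I and II\<close>

lemma open_Collect_pos: "open {m :: real^'n::finite. \<forall>i. P i \<longrightarrow> 0 < m $ i}"
proof -
  have "{m :: real^'n. \<forall>i. P i \<longrightarrow> 0 < m $ i} = (\<Inter>i\<in>{i. P i}. {m. 0 < m $ i})" by auto
  moreover have "open (\<Inter>i\<in>{i. P i}. {m :: real^'n. 0 < m $ i})"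
    by (intro open_INT ballI open_Collect_less continuous_intros) simp
  ultimately show ?thesis by (simp only:)
qed

text \<open>The witnessing open set is the whole domain of W1, and the condition is the inverse-free
  congruence.\<close>

lemma G_orbitI:
  assumes "nef_variance_function W1" "invertible g" "open (fst W1)" "fst W1 \<noteq> {}"
    and "\<And>m. m \<in> fst W1 \<Longrightarrow> 0 < denom g m \<and> moebius g m \<in> fst W \<and>
      snd W (moebius g m) = denom g m *\<^sub>R (moebius_jac g m ** snd W1 m ** transpose (moebius_jac g m))"
  shows "W1 \<in> G_orbit W"
  unfolding G_orbit_def
proof (intro CollectI conjI exI)
  show "\<forall>m\<in>fst W1. pull_fun g (snd W) m = snd W1 m"
    using assms(5) by (auto intro!: pull_fun_eqI[OF assms(2)] simp: less_imp_neq[symmetric])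
qed (use assms in \<open>auto simp: pull_dom_def\<close>)

lemma mat_1_block: "(mat 1 :: 'n::finite gmat) = block (mat 1) 0 0 1"
  by (rule gmat_eqI) (simp_all add: mat_def)

lemma blk_mat_1: "blkA (mat 1 :: 'n::finite gmat) = mat 1" "blkb (mat 1 :: 'n gmat) = 0"
  "blkc (mat 1 :: 'n gmat) = 0" "blkd (mat 1 :: 'n gmat) = 1"
  by (simp_all add: mat_1_block)

lemma G_orbit_refl:
  assumes "nef_variance_function W" "open (fst W)" "fst W \<noteq> {}"
  shows "W \<in> G_orbit W"
proof (rule G_orbitI[OF assms(1) _ assms(2,3), of "mat 1"])
  show "invertible (mat 1 :: 'a gmat)" by (simp add: invertible_det_nz)
  fix m assume "m \<in> fst W"
  have d: "denom (mat 1) m = 1" by (simp add: blk_mat_1 denom_def)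
  moreover have h: "moebius (mat 1) m = m" by (simp add: moebius_def d blk_mat_1)
  moreover have "moebius_jac (mat 1) m = mat 1"
    by (simp add: moebius_jac_def d blk_mat_1)
  ultimately show "0 < denom (mat 1) m \<and> moebius (mat 1) m \<in> fst W \<and>
      snd W (moebius (mat 1) m) = denom (mat 1) m *\<^sub>R (moebius_jac (mat 1) m ** snd W m ** transpose (moebius_jac (mat 1) m))"
    using \<open>m \<in> fst W\<close> by (simp add: transpose_mat)
qed

text \<open>Congruence keeps the shape: the rank-one part moves to J m, so each orbit calculation
  reduces to J m and a weighted Gram sum of the rows of J.\<close>

lemma congruence_outer_diag:
  fixes J :: "real^'n::finite^'n"
  shows "(J ** (outer m + diag v) ** transpose J) $ i $ j
    = (J *v m) $ i * (J *v m) $ j + (\<Sum>l\<in>UNIV. J $ i $ l * v l * J $ j $ l)"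
proof -
  have "(J ** (outer m + diag v)) $ i $ l = (J *v m) $ i * m $ l + J $ i $ l * v l" for l
  proof -
    have "(J ** (outer m + diag v)) $ i $ l = (\<Sum>k\<in>UNIV. J $ i $ k * m $ k * m $ l + (if k = l then J $ i $ k * v k else 0))"
      by (simp add: matrix_matrix_mult_def outer_def diag_def distrib_left mult.assoc) (intro sum.cong refl, simp)
    also have "\<dots> = (J *v m) $ i * m $ l + J $ i $ l * v l"
      by (simp add: sum.distrib matrix_vector_mult_def sum_distrib_right)
    finally show ?thesis .
  qed
  then have "(J ** (outer m + diag v) ** transpose J) $ i $ j
    = (\<Sum>l\<in>UNIV. (J *v m) $ i * (J $ j $ l * m $ l) + J $ i $ l * v l * J $ j $ l)"
    by (simp add: matrix_matrix_mult_def[of "_ ** _"] transpose_def algebra_simps)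
  also have "\<dots> = (J *v m) $ i * (J *v m) $ j + (\<Sum>l\<in>UNIV. J $ i $ l * v l * J $ j $ l)"
    by (simp add: sum.distrib sum_distrib_left[symmetric] matrix_vector_mult_def)
  finally show ?thesis .
qed

lemma V_I_in_G_orbit: "(V_I k :: 'n::{finite,linorder} varfun) \<in> G_orbit (V_I k)"
proof (rule G_orbit_refl[OF nef_V_I])
  show "open (fst (V_I k :: 'n varfun))" by (simp add: V_I_def open_Collect_pos)
  have "(\<chi> i. 1) \<in> fst (V_I k :: 'n varfun)" by (simp add: V_I_def)
  then show "fst (V_I k :: 'n varfun) \<noteq> {}" by blast
qed

lemma V_II_in_G_orbit: "(V_II :: 'n::{finite,linorder} varfun) \<in> G_orbit V_II"
proof (rule G_orbit_refl[OF nef_V_II])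
  show "open (fst (V_II :: 'n varfun))" by (simp add: V_II_def)
  have "(\<chi> i. 1 / (real CARD('n) + 1)) \<in> fst (V_II :: 'n varfun)" by (simp add: fst_V_II field_simps)
  then show "fst (V_II :: 'n varfun) \<noteq> {}" by blast
qed

text \<open>Here \<open>g\<close> exchanges the first coordinate with the homogenizing one.\<close>

lemma V_IV_in_G_orbit:
  assumes k: "1 \<le> k"
  shows "(V_IV k :: 'n::{finite,linorder} varfun) \<in> G_orbit (V_I k)"
proof -
  let ?f = "first :: 'n"
  let ?A = "(\<chi> i j. if i = j \<and> i \<noteq> ?f then 1 else 0) :: ((real, 'n) vec, 'n) vec"
  let ?e = "axis ?f 1 :: (real, 'n) vec"
  define g :: "'n gmat" where "g = block ?A ?e ?e 0"
  have fk: "pos ?f \<le> k" using k by (simp add: pos_first)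
  have Av: "(?A *v m) $ i = (if i = ?f then 0 else m $ i)" for m i
    by (auto simp: matrix_vector_mult_def if_distrib[of "\<lambda>x. x * _"] sum.delta' cong: if_cong)
  show ?thesis
  proof (rule G_orbitI[OF nef_V_IV[OF k], of g])
    \<comment> \<open>g is the permutation matrix of a transposition, hence its own inverse; these
      are the block identities behind it.\<close>
    have "?A ** ?A + (\<chi> i j. ?e $ i * ?e $ j) = mat 1"
      by (auto simp: vec_eq_iff matrix_matrix_mult_def mat_def axis_def if_distrib[of "\<lambda>x. x * _"] sum.delta' cong: if_cong)
    moreover have "?A *v ?e = 0" "transpose ?A *v ?e = 0"
      by (auto simp: vec_eq_iff matrix_vector_mult_def transpose_def axis_def intro!: sum.neutral)
    ultimately have "g ** g = mat 1"
      unfolding g_def by (subst block_mult) (simp add: mat_1_block inner_axis')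
    then show "invertible g" unfolding invertible_def by blast
    show "open (fst (V_IV k :: 'n varfun))" by (simp add: V_IV_def open_Collect_pos)
    have "(\<chi> i. 1) \<in> fst (V_IV k :: 'n varfun)" by (simp add: V_IV_def)
    then show "fst (V_IV k :: 'n varfun) \<noteq> {}" by blast
    fix m :: "(real, 'n) vec" assume "m \<in> fst (V_IV k)"
    then have m: "0 < m $ i" if "pos i \<le> k" for i using that by (simp add: V_IV_def)
    define \<delta> where "\<delta> = m $ ?f"
    have \<delta>: "0 < \<delta>" using m[OF fk] by (simp add: \<delta>_def)
    have d: "denom g m = \<delta>" by (simp add: g_def denom_def inner_axis' \<delta>_def)
    have h: "moebius g m $ i = (if i = ?f then 1 / \<delta> else m $ i / \<delta>)" for i
      unfolding moebius_def d by (simp add: g_def Av) (simp add: axis_def)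
    define J where "J = moebius_jac g m"
    have J: "J $ i $ l = (if i = ?f then (if l = ?f then - 1 / \<delta>\<^sup>2 else 0)
       else if l = ?f then - m $ i / \<delta>\<^sup>2 else if l = i then 1 / \<delta> else 0)" for i l
      by (simp add: J_def moebius_jac_def d h) (auto simp: g_def axis_def power2_eq_square)
    \<comment> \<open>Euler's relation: the component 1 / m_first of the map is homogeneous of
      degree -1 in m, the others m_i / m_first of degree 0.\<close>
    have Jm: "(J *v m) $ i = (if i = ?f then - 1 / \<delta> else 0)" for i
    proof -
      have "(J *v m) $ i = J $ i $ ?f * m $ ?f + (\<Sum>l\<in>UNIV - {?f}. J $ i $ l * m $ l)"
        unfolding matrix_vector_mult_def by (simp add: sum.remove[of _ ?f])
      also have "(\<Sum>l\<in>UNIV - {?f}. J $ i $ l * m $ l) = (\<Sum>l\<in>UNIV - {?f}. if l = i then m $ i / \<delta> else 0)"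
        by (intro sum.cong) (auto simp: J)
      also have "\<dots> = (if i = ?f then 0 else m $ i / \<delta>)" by (simp add: sum.delta)
      finally show ?thesis using \<delta> by (simp add: J \<delta>_def power2_eq_square)
    qed
    define v where "v i = (if i = ?f then 0 else if pos i \<le> k then m $ i else m $ ?f)" for i
    have JvJ: "(\<Sum>l\<in>UNIV. J $ i $ l * v l * J $ j $ l) = (if i = j \<and> i \<noteq> ?f then v i / \<delta>\<^sup>2 else 0)" for i j
    proof -
      have "(\<Sum>l\<in>UNIV. J $ i $ l * v l * J $ j $ l) = (\<Sum>l\<in>UNIV. if l = i then (if i = j \<and> i \<noteq> ?f then v i / \<delta>\<^sup>2 else 0) else 0)"
        by (intro sum.cong) (auto simp: J v_def power2_eq_square)
      then show ?thesis by (simp add: sum.delta)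
    qed
    have V: "snd (V_IV k) m = outer m + diag v" unfolding v_def[abs_def] by (simp add: V_IV_def)
    have "snd (V_I k) (moebius g m) $ i $ j = (\<delta> *\<^sub>R (J ** (outer m + diag v) ** transpose J)) $ i $ j" for i j
      using \<delta> by (simp add: congruence_outer_diag Jm JvJ) (auto simp: V_I_def diag_def h v_def fk \<delta>_def[symmetric] power2_eq_square)
    then have "snd (V_I k) (moebius g m) = \<delta> *\<^sub>R (J ** (outer m + diag v) ** transpose J)"
      by (simp only: vec_eq_iff) simp
    moreover have "moebius g m \<in> fst (V_I k)" using \<delta> m by (simp add: V_I_def h)
    ultimately show "0 < denom g m \<and> moebius g m \<in> fst (V_I k) \<and>
      snd (V_I k) (moebius g m) = denom g m *\<^sub>R (moebius_jac g m ** snd (V_IV k) m ** transpose (moebius_jac g m))"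
      using \<delta> by (simp only: d V J_def)
  qed
qed

text \<open>Adding all other coordinates to the homogenizing one exchanges the hyperplane at
  infinity with the slanted facet: \<open>P_II\<close> becomes the product of all n + 1 coordinates
  and their sum, the form of type III. This dictates c = (1, ..., 1) and d = 1, and the map carries
  the orthant into the open simplex.\<close>

lemma V_III_in_G_orbit: "(V_III :: 'n::{finite,linorder} varfun) \<in> G_orbit V_II"
proof -
  define g :: "'n gmat" where "g = block (mat 1) 0 (\<chi> i. 1) 1"
  show ?thesis
  proof (rule G_orbitI[OF nef_V_III, of g])
    show "invertible g" by (simp add: invertible_det_nz g_def det_block_0)
    show "open (fst (V_III :: 'n varfun))" using open_Collect_pos[of "\<lambda>_. True"] by (simp add: V_III_def)
    have "(\<chi> i. 1) \<in> fst (V_III :: 'n varfun)" by (simp add: V_III_def)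
    then show "fst (V_III :: 'n varfun) \<noteq> {}" by blast
    fix m :: "(real, 'n) vec" assume "m \<in> fst V_III"
    then have m: "0 < m $ i" for i by (simp add: V_III_def)
    define \<delta> where "\<delta> = 1 + (\<Sum>i\<in>UNIV. m $ i)"
    have \<delta>: "0 < \<delta>" unfolding \<delta>_def using m by (intro add_pos_nonneg sum_nonneg) (auto simp: less_imp_le)
    have d: "denom g m = \<delta>" by (simp add: g_def denom_def inner_vec_def \<delta>_def)
    define h where "h i = m $ i / \<delta>" for i
    have mh: "m $ i = \<delta> * h i" for i using \<delta> by (simp add: h_def)
    have h: "moebius g m $ i = h i" for i
      unfolding moebius_def d by (simp add: g_def h_def)
    have sh: "\<delta> * (\<Sum>i\<in>UNIV. h i) = \<delta> - 1" unfolding sum_distrib_left mh[symmetric] by (simp add: \<delta>_def)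
    define J where "J = moebius_jac g m"
    have J: "J $ i $ l = ((if l = i then 1 else 0) - h i) / \<delta>" for i l
      by (simp add: J_def moebius_jac_def d h) (auto simp: g_def mat_def)
    have Jm: "(J *v m) $ i = h i / \<delta>" for i
    proof -
      have "(J *v m) $ i = (\<Sum>l\<in>UNIV. (if l = i then h i else 0) - h i * h l)"
        unfolding matrix_vector_mult_def using \<delta> by (simp add: J mh) (intro sum.cong refl, simp add: algebra_simps)
      also have "\<dots> = h i * (1 - (\<Sum>l\<in>UNIV. h l))"
        by (simp add: sum_subtractf sum_distrib_left[symmetric] right_diff_distrib)
      also have "1 - (\<Sum>l\<in>UNIV. h l) = 1 / \<delta>" using sh \<delta> by (simp add: field_simps)
      finally show ?thesis by simp
    qed
    have JmJ: "(\<Sum>l\<in>UNIV. J $ i $ l * m $ l * J $ j $ l)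
       = ((if i = j then h i else 0) - 2 * h i * h j + h i * h j * (\<Sum>l\<in>UNIV. h l)) / \<delta>" for i j
    proof -
      have "(\<Sum>l\<in>UNIV. J $ i $ l * m $ l * J $ j $ l) = (\<Sum>l\<in>UNIV. ((if l = i then (if i = j then h i else 0) - h j * h i else 0)
         - (if l = j then h i * h j else 0) + h i * h j * h l) / \<delta>)"
        using \<delta> by (intro sum.cong refl) (auto simp: J mh field_simps)
      also have "\<dots> = ((if i = j then h i else 0) - 2 * h i * h j + h i * h j * (\<Sum>l\<in>UNIV. h l)) / \<delta>"
        by (simp add: sum_divide_distrib[symmetric] sum.distrib sum_subtractf sum_distrib_left[symmetric])
      finally show ?thesis .
    qed
    have V: "snd V_III m = outer m + diag (\<lambda>i. m $ i)" by (simp add: V_III_def)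
    have "snd V_II (moebius g m) $ i $ j = (\<delta> *\<^sub>R (J ** (outer m + diag (\<lambda>i. m $ i)) ** transpose J)) $ i $ j" for i j
    proof -
      have "(\<delta> *\<^sub>R (J ** (outer m + diag (\<lambda>i. m $ i)) ** transpose J)) $ i $ j
        = h i * h j / \<delta> + ((if i = j then h i else 0) - 2 * h i * h j + h i * h j * (\<Sum>l\<in>UNIV. h l))"
      proof -
        have "\<delta> * (a / \<delta> * (b / \<delta>) + X / \<delta>) = a * b / \<delta> + X" for a b X
          using \<delta> by (simp add: field_simps)
        then show ?thesis by (simp only: vector_scaleR_component real_scaleR_def congruence_outer_diag Jm JmJ)
      qed
      \<comment> \<open>With this value the part - h_i h_j / \<delta> of the weighted sum cancels
        the rank-one term, leaving h_i on the diagonal minus h_i h_j.\<close>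
      also have "(\<Sum>l\<in>UNIV. h l) = 1 - 1 / \<delta>" using sh \<delta> by (simp add: field_simps)
      finally show ?thesis by (simp add: V_II_def outer_def diag_def h algebra_simps)
    qed
    then have "snd V_II (moebius g m) = \<delta> *\<^sub>R (J ** (outer m + diag (\<lambda>i. m $ i)) ** transpose J)"
      by (simp only: vec_eq_iff) simp
    moreover have "moebius g m \<in> fst V_II"
    proof -
      have "\<delta> * (\<Sum>i\<in>UNIV. h i) < \<delta> * 1" using sh by simp
      then have "(\<Sum>i\<in>UNIV. h i) < 1" using \<delta> by (simp only: mult_less_cancel_left_pos)
      then show ?thesis using m \<delta> by (simp add: fst_V_II h) (simp add: h_def)
    qed
    ultimately show "0 < denom g m \<and> moebius g m \<in> fst V_II \<and>
      snd V_II (moebius g m) = denom g m *\<^sub>R (moebius_jac g m ** snd V_III m ** transpose (moebius_jac g m))"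
      using \<delta> by (simp only: d V J_def)
  qed
qed

text \<open>Lying in one orbit is rendered as common membership in the orbit of
  \<open>V_I k\<close>, respectively \<open>V_II\<close>. In the list of n + 3 functions the
  \<open>V_I\<close> occupy positions 0 to n.\<close>

theorem theorem5p4:
  shows "(\<forall>k\<in>{1..CARD('n::{finite,linorder})}.
            {V_I k, V_IV k :: 'n varfun} \<subseteq> G_orbit (V_I k)) \<and>
         {V_II, V_III :: 'n varfun} \<subseteq> G_orbit V_II \<and>
         disjoint_family_on
           (\<lambda>i. G_orbit ((map V_I [0..<CARD('n) + 1] @ [V_II, V_V :: 'n varfun]) ! i))
           {..<CARD('n) + 3}"
  by (intro conjI ballI disjoint_orbits)
    (auto simp: V_I_in_G_orbit V_IV_in_G_orbit V_II_in_G_orbit V_III_in_G_orbit)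

end
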